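(* Let $X$ be a compact connected abelian group with $\dim X=d<\infty$, and let $\{T_1,\ldots,T_s\}$ be a set of $s\ge 2$ (distinct) epimorphisms of $X$. Then $\{T_1,\ldots,T_s\}$ is mixing if and only if the following holds: for every $l\ge 1$, every nonempty subset $\{k_1,\ldots,k_r\}\subset\{1,\ldots,s\}$ (with $k_1,\ldots,k_r$ distinct), and every $\lambda\in\mathbb{C}$, there do not exist nonzero vectors $w_1,\ldots,w_r\in\mathbb{C}^d$ with $\hat T_{k_i}^l w_i=\lambda w_i$ for $i=1,\ldots,r$ such that $w_1,\ldots,w_r$ are linearly dependent over $\mathbb{Q}$.
   Context: $m$ is the normalized Haar measure on $X$ and $\mathcal{B}$ is the completion of the Borel $\sigma$-algebra. An epimorphism of $X$ is a continuous surjective homomorphism $X\to X$. A finite set $F$, $|F|>1$, of epimorphisms of $X$ is called mixing if for every collection $B_\gamma\in\mathcal{B}$, $\gamma\in F$, one has $m\left(\bigcap_{\gamma\in F}\gamma^{-n}(B_\gamma)\right)\to\prod_{\gamma\in F}m(B_\gamma)$ as $n\to\infty$ (preimages). The character group $\hat X$ is a torsion-free abelian group of rank $d$; one fixes an identification $\mathbb{Z}^d\subset\hat X\subset\mathbb{Q}^d$. A continuous endomorphism $T$ of $X$ induces the endomorphism $\hat T:\chi\mapsto\chi\circ T$ of $\hat X$, which extends uniquely to a linear map $\hat T$ of $\mathbb{Q}^d$ (and of $\mathbb{C}^d$); $T$ is surjective iff $\det\hat T\neq 0$. *)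

theory Defs
  imports "HOL-Analysis.Analysis" "Jordan_Normal_Form.Char_Poly"
begin

(* From here on, "vec", "$" etc. refer to the dimension-as-a-number vectors of
   Jordan_Normal_Form.Matrix, so that the dimension d is an ordinary natural number. *)
unbundle no vec_syntax
hide_type (open) Finite_Cartesian_Product.vec

section \<open>Endomorphisms and Haar measure\<close>

definition continuous_endomorphism :: "('a::topological_ab_group_add \<Rightarrow> 'a) \<Rightarrow> bool" where
  "continuous_endomorphism T \<longleftrightarrow>
     (\<forall>x y. T (x + y) = T x + T y) \<and> continuous_on UNIV T"

definition epimorphism :: "('a::topological_ab_group_add \<Rightarrow> 'a) \<Rightarrow> bool" where
  "epimorphism T \<longleftrightarrow> continuous_endomorphism T \<and> surj T"

(* Regularity is part of the definition: without it, translation invariance would not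
   determine the measure on the Borel sets of a general compact group. *)
definition normalized_haar_measure :: "'a::topological_ab_group_add measure \<Rightarrow> bool" where
  "normalized_haar_measure m \<longleftrightarrow>
     sets m = sets borel \<and>
     emeasure m UNIV = 1 \<and>
     (\<forall>x. \<forall>B\<in>sets borel. emeasure m ((\<lambda>y. x + y) ` B) = emeasure m B) \<and>
     (\<forall>B\<in>sets borel.
        emeasure m B = (INF U\<in>{U. open U \<and> B \<subseteq> U}. emeasure m U) \<and>
        emeasure m B = (SUP K\<in>{K. compact K \<and> K \<subseteq> B}. emeasure m K))"

(* gamma^{-n}(B) is the preimage under the n-th iterate of gamma. *)
definition mixing :: "'a::topological_ab_group_add measure \<Rightarrow> ('a \<Rightarrow> 'a) set \<Rightarrow> bool" where
  "mixing m F \<longleftrightarrow>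
     finite F \<and> card F > 1 \<and> (\<forall>\<gamma>\<in>F. epimorphism \<gamma>) \<and>
     (\<forall>B. (\<forall>\<gamma>\<in>F. B \<gamma> \<in> sets (completion m)) \<longrightarrow>
        (\<lambda>n. measure (completion m) (\<Inter>\<gamma>\<in>F. (\<gamma> ^^ n) -` B \<gamma>))
          \<longlonglongrightarrow> (\<Prod>\<gamma>\<in>F. measure (completion m) (B \<gamma>)))"

section \<open>Dimension and characters\<close>

(* "dim_le" is the small inductive dimension of the library. On compact groups it agrees with
   the covering dimension and the large inductive dimension. *)
definition has_dimension :: "'a::topological_space itself \<Rightarrow> nat \<Rightarrow> bool" where
  "has_dimension _ d \<longleftrightarrow>
     (euclidean :: 'a topology) dim_le int d \<and> \<not> (euclidean :: 'a topology) dim_le (int d - 1)"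

(* The elements of the character group; its group operation is pointwise multiplication. *)
definition characters :: "('a::topological_ab_group_add \<Rightarrow> complex) set" where
  "characters =
     {\<chi>. continuous_on UNIV \<chi> \<and> (\<forall>x. cmod (\<chi> x) = 1) \<and> (\<forall>x y. \<chi> (x + y) = \<chi> x * \<chi> y)}"

definition integer_lattice :: "nat \<Rightarrow> rat vec set" where
  "integer_lattice d = {v \<in> carrier_vec d. \<forall>i<d. v $ i \<in> \<int>}"

(* An identification of the character group with a group between Z^d and Q^d. *)
definition dual_identification ::
    "nat \<Rightarrow> (('a::topological_ab_group_add \<Rightarrow> complex) \<Rightarrow> rat vec) \<Rightarrow> bool" where
  "dual_identification d \<iota> \<longleftrightarrow>
     \<iota> ` characters \<subseteq> carrier_vec d \<and>
     inj_on \<iota> characters \<and>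
     (\<forall>\<chi>\<in>characters. \<forall>\<psi>\<in>characters. \<iota> (\<lambda>x. \<chi> x * \<psi> x) = \<iota> \<chi> + \<iota> \<psi>) \<and>
     integer_lattice d \<subseteq> \<iota> ` characters"

(* The matrix of the unique linear map of Q^d extending the dual endomorphism
   chi |-> chi o T; see dual_matrix_unique below. *)
definition dual_matrix ::
    "nat \<Rightarrow> (('a::topological_ab_group_add \<Rightarrow> complex) \<Rightarrow> rat vec) \<Rightarrow> ('a \<Rightarrow> 'a) \<Rightarrow> rat mat" where
  "dual_matrix d \<iota> T =
     (THE A. A \<in> carrier_mat d d \<and> (\<forall>\<chi>\<in>characters. A *\<^sub>v \<iota> \<chi> = \<iota> (\<chi> \<circ> T)))"

definition complex_dual_matrix ::
    "nat \<Rightarrow> (('a::topological_ab_group_add \<Rightarrow> complex) \<Rightarrow> rat vec) \<Rightarrow> ('a \<Rightarrow> 'a) \<Rightarrow> complex mat" where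
  "complex_dual_matrix d \<iota> T = map_mat of_rat (dual_matrix d \<iota> T)"

(* Dependence of an indexed family: repeated vectors are dependent. *)
definition rat_linearly_dependent :: "nat \<Rightarrow> 'i set \<Rightarrow> ('i \<Rightarrow> complex vec) \<Rightarrow> bool" where
  "rat_linearly_dependent d I w \<longleftrightarrow>
     (\<exists>q :: 'i \<Rightarrow> rat. (\<exists>i\<in>I. q i \<noteq> 0) \<and>
        finsum_vec TYPE(complex) d (\<lambda>i. of_rat (q i) \<cdot>\<^sub>v w i) I = 0\<^sub>v d)"

section \<open>The linear extension of the dual endomorphism is well defined\<close>

lemma characters_comp:
  assumes "continuous_endomorphism T" "\<chi> \<in> characters"
  shows "\<chi> \<circ> T \<in> characters"
  using assms unfolding continuous_endomorphism_def characters_def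
  by (auto intro: continuous_on_compose2 simp: comp_def)

lemma characters_mult:
  assumes "\<chi> \<in> characters" "\<psi> \<in> characters"
  shows "(\<lambda>x. \<chi> x * \<psi> x) \<in> characters"
  using assms unfolding characters_def
  by (auto intro!: continuous_intros simp: norm_mult)

lemma characters_one: "(\<lambda>_. 1) \<in> characters"
  unfolding characters_def by auto

lemma characters_cnj:
  assumes "\<chi> \<in> characters"
  shows "(\<lambda>x. cnj (\<chi> x)) \<in> characters"
  using assms unfolding characters_def
  by (auto intro!: continuous_intros)

lemma common_denominator:
  fixes v :: "rat vec"
  shows "\<exists>N::nat. N > 0 \<and> (\<forall>i<d. of_nat N * v $ i \<in> \<int>)"
proof (induction d)
  case 0
  show ?case by auto
next
  case (Suc d)
  then obtain N :: nat where N: "N > 0" "\<And>i. i < d \<Longrightarrow> of_nat N * v $ i \<in> \<int>" by auto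
  obtain a b where ab: "quotient_of (v $ d) = (a, b)" by fastforce
  have b: "b > 0" using ab by (rule quotient_of_denom_pos)
  have vd: "v $ d = of_int a / of_int b" using ab by (rule quotient_of_div)
  have "of_nat (N * nat b) * v $ i \<in> \<int>" if "i < Suc d" for i
  proof (cases "i = d")
    case True
    have "of_nat (N * nat b) * v $ i = of_int (int N * a)"
      using b vd True by (simp add: of_nat_nat)
    then show ?thesis by (metis Ints_of_int)
  next
    case False
    then have "i < d" using that by simp
    then have "of_nat N * v $ i \<in> \<int>" by (rule N(2))
    then have "of_nat (nat b) * (of_nat N * v $ i) \<in> \<int>" by (rule Ints_mult[OF Ints_of_nat])
    moreover have "of_nat (N * nat b) * v $ i = of_nat (nat b) * (of_nat N * v $ i)"
      by (simp only: of_nat_mult ac_simps)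
    ultimately show ?thesis by (simp only:)
  qed
  then show ?case using N b by (intro exI[of _ "N * nat b"] conjI allI impI) (simp_all del: of_nat_mult)
qed

lemma mat_unit_vec_col:
  fixes A :: "rat mat"
  assumes "A \<in> carrier_mat d d" "j < d"
  shows "A *\<^sub>v unit_vec d j = col A j"
  using assms by (intro eq_vecI) auto

theorem dual_matrix_unique:
  fixes T :: "'a::topological_ab_group_add \<Rightarrow> 'a"
  assumes \<iota>: "dual_identification d \<iota>" and T: "continuous_endomorphism T"
  shows "\<exists>!A. A \<in> carrier_mat d d \<and> (\<forall>\<chi>\<in>characters. A *\<^sub>v \<iota> \<chi> = \<iota> (\<chi> \<circ> T))"
proof -
  note comp = characters_comp[OF T]
  have car: "\<iota> \<chi> \<in> carrier_vec d" if "\<chi> \<in> characters" for \<chi>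
    using \<iota> that unfolding dual_identification_def by auto
  have dim [simp]: "dim_vec (\<iota> \<chi>) = d" if "\<chi> \<in> characters" for \<chi>
    using car[OF that] by auto
  have inj: "\<chi> = \<psi>" if "\<chi> \<in> characters" "\<psi> \<in> characters" "\<iota> \<chi> = \<iota> \<psi>" for \<chi> \<psi>
    using \<iota> that unfolding dual_identification_def by (auto dest: inj_onD)
  have hom: "\<iota> (\<lambda>x. \<chi> x * \<psi> x) = \<iota> \<chi> + \<iota> \<psi>"
    if "\<chi> \<in> characters" "\<psi> \<in> characters" for \<chi> \<psi>
    using \<iota> that unfolding dual_identification_def by auto
  have lat: "\<exists>\<chi>\<in>characters. \<iota> \<chi> = v" if "v \<in> integer_lattice d" for v
    using \<iota> that unfolding dual_identification_def by (metis imageE subsetD)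
  have unit: "unit_vec d j \<in> integer_lattice d" for j
    unfolding integer_lattice_def unit_vec_def by auto
  define E where "E j = (SOME \<chi>. \<chi> \<in> characters \<and> \<iota> \<chi> = unit_vec d j)" for j
  have E: "E j \<in> characters" "\<iota> (E j) = unit_vec d j" for j
    using someI_ex[of "\<lambda>\<chi>. \<chi> \<in> characters \<and> \<iota> \<chi> = unit_vec d j"] lat[OF unit[of j]]
    unfolding E_def by blast+
  define A where "A = mat d d (\<lambda>(i, j). \<iota> (E j \<circ> T) $ i)"
  have A: "A \<in> carrier_mat d d" unfolding A_def by auto
  define P where "P \<chi> \<longleftrightarrow> \<chi> \<in> characters \<and> A *\<^sub>v \<iota> \<chi> = \<iota> (\<chi> \<circ> T)" for \<chi>
  have PE: "P (E j)" if "j < d" for j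
    unfolding P_def E(2) using that A E(1)[of j] comp[OF E(1)[of j]]
    by (auto simp: A_def mat_unit_vec_col intro!: eq_vecI)
  have Pmult: "P (\<lambda>x. \<chi> x * \<psi> x)" if "P \<chi>" "P \<psi>" for \<chi> \<psi>
  proof -
    have c: "\<chi> \<in> characters" "\<psi> \<in> characters" using that P_def by auto
    have "(\<lambda>x. \<chi> x * \<psi> x) \<circ> T = (\<lambda>x. (\<chi> \<circ> T) x * (\<psi> \<circ> T) x)" by auto
    then show ?thesis
      using that c A car hom[OF c] hom[OF comp[OF c(1)] comp[OF c(2)]] characters_mult[OF c]
      unfolding P_def by (auto simp: mult_add_distrib_mat_vec[OF A car[OF c(1)] car[OF c(2)]])
  qed
  have one: "\<iota> (\<lambda>_. 1) = 0\<^sub>v d"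
  proof (rule eq_vecI)
    fix i assume "i < dim_vec (0\<^sub>v d :: rat vec)"
    then have i: "i < d" by simp
    have eq: "\<iota> (\<lambda>_. 1) = \<iota> (\<lambda>_. 1) + \<iota> (\<lambda>_. 1)"
      using hom[OF characters_one characters_one] by simp
    have "\<iota> (\<lambda>_. 1) $ i = (\<iota> (\<lambda>_. 1) + \<iota> (\<lambda>_. 1)) $ i"
      by (rule arg_cong[OF eq, of "\<lambda>v. v $ i"])
    also have "\<dots> = \<iota> (\<lambda>_. 1) $ i + \<iota> (\<lambda>_. 1) $ i"
      using i dim[OF characters_one] by (intro index_add_vec) simp
    finally have "\<iota> (\<lambda>_. 1) $ i = \<iota> (\<lambda>_. 1) $ i + \<iota> (\<lambda>_. 1) $ i" .
    then show "\<iota> (\<lambda>_. 1) $ i = 0\<^sub>v d $ i" using i by simp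
  qed (use dim[OF characters_one] in simp)
  have Pone: "P (\<lambda>_. 1)"
    using characters_one A unfolding P_def by (auto simp: one comp_def)
  have inv: "\<iota> (\<lambda>x. cnj (\<chi> x)) = - \<iota> \<chi>" if c: "\<chi> \<in> characters" for \<chi>
  proof -
    have "(\<lambda>x. \<chi> x * cnj (\<chi> x)) = (\<lambda>_. 1)"
      using c unfolding characters_def by (auto simp: complex_norm_square[symmetric])
    then have "\<iota> \<chi> + \<iota> (\<lambda>x. cnj (\<chi> x)) = 0\<^sub>v d"
      using hom[OF c characters_cnj[OF c]] one by simp
    then have eq: "\<iota> \<chi> $ i + \<iota> (\<lambda>x. cnj (\<chi> x)) $ i = 0" if "i < d" for i
      using that dim[OF c] dim[OF characters_cnj[OF c]]
      by (metis index_add_vec(1) index_zero_vec(1))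
    then show ?thesis using dim[OF c] dim[OF characters_cnj[OF c]]
      by (intro eq_vecI) (auto simp: eq_neg_iff_add_eq_0 add.commute)
  qed
  have Pcnj: "P (\<lambda>x. cnj (\<chi> x))" if "P \<chi>" for \<chi>
  proof -
    have c: "\<chi> \<in> characters" using that P_def by auto
    have "(\<lambda>x. cnj (\<chi> x)) \<circ> T = (\<lambda>x. cnj ((\<chi> \<circ> T) x))" by auto
    moreover have "A *\<^sub>v (- \<iota> \<chi>) = - (A *\<^sub>v \<iota> \<chi>)"
      using A car[OF c] by (auto intro!: eq_vecI simp: scalar_prod_def sum_negf)
    ultimately show ?thesis
      using that c inv[OF c] inv[OF comp[OF c]] characters_cnj[OF c] unfolding P_def by auto
  qed
  have Pnat: "\<exists>\<psi>. P \<psi> \<and> \<iota> \<psi> = of_nat n \<cdot>\<^sub>v \<iota> \<chi>" if "P \<chi>" for \<chi> n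
  proof (induction n)
    case 0
    show ?case using Pone one that by (intro exI[of _ "\<lambda>_. 1"]) (auto intro!: eq_vecI simp: P_def)
  next
    case (Suc n)
    then obtain \<psi> where \<psi>: "P \<psi>" "\<iota> \<psi> = of_nat n \<cdot>\<^sub>v \<iota> \<chi>" by auto
    have "\<iota> (\<lambda>x. \<psi> x * \<chi> x) = of_nat n \<cdot>\<^sub>v \<iota> \<chi> + \<iota> \<chi>"
      using hom \<psi> that unfolding P_def by auto
    also have "\<dots> = of_nat (Suc n) \<cdot>\<^sub>v \<iota> \<chi>" by (intro eq_vecI) (auto simp: algebra_simps)
    finally show ?case using Pmult[OF \<psi>(1) that] by blast
  qed
  have Pint: "\<exists>\<psi>. P \<psi> \<and> \<iota> \<psi> = of_int z \<cdot>\<^sub>v \<iota> \<chi>" if P: "P \<chi>" for \<chi> z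
  proof (cases "z \<ge> 0")
    case True
    then have "of_int z = (of_nat (nat z) :: rat)" by simp
    then show ?thesis using Pnat[OF P] by metis
  next
    case False
    obtain \<psi> where \<psi>: "P \<psi>" "\<iota> \<psi> = of_nat (nat (- z)) \<cdot>\<^sub>v \<iota> \<chi>" using Pnat[OF P] by blast
    have "\<iota> (\<lambda>x. cnj (\<psi> x)) = of_int z \<cdot>\<^sub>v \<iota> \<chi>"
      using inv[of \<psi>] \<psi> False unfolding P_def by (auto intro!: eq_vecI simp: of_nat_nat)
    then show ?thesis using Pcnj[OF \<psi>(1)] by blast
  qed
  have Plat: "\<exists>\<psi>. P \<psi> \<and> \<iota> \<psi> = v" if v: "v \<in> integer_lattice d" for v
  proof -
    have "k \<le> d \<Longrightarrow> \<exists>\<psi>. P \<psi> \<and> \<iota> \<psi> = vec d (\<lambda>i. if i < k then v $ i else 0)" for k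
    proof (induction k)
      case 0
      show ?case using Pone one by (intro exI[of _ "\<lambda>_. 1"]) (auto intro!: eq_vecI)
    next
      case (Suc k)
      then obtain \<psi> where \<psi>: "P \<psi>" "\<iota> \<psi> = vec d (\<lambda>i. if i < k then v $ i else 0)" by auto
      obtain z where z: "v $ k = of_int z"
        using v Suc.prems unfolding integer_lattice_def
        by (metis (mono_tags, lifting) Ints_cases Suc_le_eq mem_Collect_eq)
      obtain \<phi> where \<phi>: "P \<phi>" "\<iota> \<phi> = of_int z \<cdot>\<^sub>v \<iota> (E k)"
        using Pint[OF PE[of k]] Suc.prems by auto
      have "\<iota> (\<lambda>x. \<psi> x * \<phi> x) = \<iota> \<psi> + \<iota> \<phi>" using hom \<psi> \<phi> unfolding P_def by auto
      also have "\<dots> = vec d (\<lambda>i. if i < Suc k then v $ i else 0)"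
        unfolding \<psi> \<phi> E using z Suc.prems
        by (intro eq_vecI) (auto simp: unit_vec_def less_Suc_eq)
      finally show ?case using Pmult[OF \<psi>(1) \<phi>(1)] by blast
    qed
    from this[of d] obtain \<psi> where "P \<psi>" "\<iota> \<psi> = vec d (\<lambda>i. if i < d then v $ i else 0)" by auto
    moreover have "vec d (\<lambda>i. if i < d then v $ i else 0) = v"
      using v unfolding integer_lattice_def by (intro eq_vecI) auto
    ultimately show ?thesis by auto
  qed
  have pow: "\<exists>\<psi>\<in>characters. \<iota> \<psi> = of_nat n \<cdot>\<^sub>v \<iota> \<chi> \<and> \<iota> (\<psi> \<circ> T) = of_nat n \<cdot>\<^sub>v \<iota> (\<chi> \<circ> T)"
    if c: "\<chi> \<in> characters" for n \<chi>
  proof (induction n)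
    case 0
    show ?case using characters_one one dim[OF c] dim[OF comp[OF c]]
      by (intro bexI[of _ "\<lambda>_. 1"]) (auto intro!: eq_vecI simp: comp_def)
  next
    case (Suc n)
    then obtain \<psi> where \<psi>: "\<psi> \<in> characters" "\<iota> \<psi> = of_nat n \<cdot>\<^sub>v \<iota> \<chi>"
      "\<iota> (\<psi> \<circ> T) = of_nat n \<cdot>\<^sub>v \<iota> (\<chi> \<circ> T)" by blast
    have 1: "\<iota> (\<lambda>x. \<psi> x * \<chi> x) = of_nat (Suc n) \<cdot>\<^sub>v \<iota> \<chi>"
      unfolding hom[OF \<psi>(1) c] \<psi> by (intro eq_vecI) (auto simp: algebra_simps)
    have "(\<lambda>x. \<psi> x * \<chi> x) \<circ> T = (\<lambda>x. (\<psi> \<circ> T) x * (\<chi> \<circ> T) x)" by auto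
    then have 2: "\<iota> ((\<lambda>x. \<psi> x * \<chi> x) \<circ> T) = of_nat (Suc n) \<cdot>\<^sub>v \<iota> (\<chi> \<circ> T)"
      using hom[OF comp[OF \<psi>(1)] comp[OF c]] \<psi>
      by (intro eq_vecI) (auto simp: algebra_simps)
    show ?case using 1 2 characters_mult[OF \<psi>(1) c] by blast
  qed
  have ex: "A *\<^sub>v \<iota> \<chi> = \<iota> (\<chi> \<circ> T)" if c: "\<chi> \<in> characters" for \<chi>
  proof -
    obtain N :: nat where N: "N > 0" "\<And>i. i < d \<Longrightarrow> of_nat N * \<iota> \<chi> $ i \<in> \<int>"
      using common_denominator[of d "\<iota> \<chi>"] by auto
    obtain \<psi> where \<psi>: "\<psi> \<in> characters" "\<iota> \<psi> = of_nat N \<cdot>\<^sub>v \<iota> \<chi>"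
      "\<iota> (\<psi> \<circ> T) = of_nat N \<cdot>\<^sub>v \<iota> (\<chi> \<circ> T)" using pow[OF c] by blast
    have "\<iota> \<psi> \<in> integer_lattice d"
      using N dim[OF c] car[OF c] unfolding \<psi> integer_lattice_def by auto
    then obtain \<psi>' where "P \<psi>'" "\<iota> \<psi>' = \<iota> \<psi>" using Plat by blast
    then have "P \<psi>" using inj \<psi>(1) P_def by metis
    then have "of_nat N \<cdot>\<^sub>v (A *\<^sub>v \<iota> \<chi>) = of_nat N \<cdot>\<^sub>v \<iota> (\<chi> \<circ> T)"
      using \<psi> A car[OF c] unfolding P_def by (simp add: mult_mat_vec)
    then have "of_nat N * (A *\<^sub>v \<iota> \<chi>) $ i = of_nat N * \<iota> (\<chi> \<circ> T) $ i" if "i < d" for i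
      using that A dim[OF comp[OF c]] by (metis carrier_matD(1) dim_mult_mat_vec index_smult_vec(1))
    then show ?thesis using N(1) A dim[OF comp[OF c]] by (intro eq_vecI) auto
  qed
  show ?thesis
  proof (rule ex1I[of _ A])
    show "A \<in> carrier_mat d d \<and> (\<forall>\<chi>\<in>characters. A *\<^sub>v \<iota> \<chi> = \<iota> (\<chi> \<circ> T))"
      using A ex by auto
  next
    fix B assume B: "B \<in> carrier_mat d d \<and> (\<forall>\<chi>\<in>characters. B *\<^sub>v \<iota> \<chi> = \<iota> (\<chi> \<circ> T))"
    show "B = A"
    proof (rule eq_matI)
      fix i j assume "i < dim_row A" "j < dim_col A"
      then have ij: "i < d" "j < d" using A by auto
      have "B *\<^sub>v unit_vec d j = A *\<^sub>v unit_vec d j"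
        using B ex E by metis
      then have "col B j = col A j" using A B ij by (simp add: mat_unit_vec_col)
      then show "B $$ (i, j) = A $$ (i, j)"
        using A B ij by (metis carrier_matD index_col)
    qed (use A B in auto)
  qed
qed

end

theory Submission
  imports Defs
    "HOL-Complex_Analysis.Great_Picard"
    "HOL-Computational_Algebra.Fundamental_Theorem_Algebra"
    "HOL-Library.Function_Algebras"
begin

unbundle no vec_syntax
hide_type (open) Finite_Cartesian_Product.vec
hide_const (open) Module.smult

text \<open>
  The characters of \<open>X\<close> separate points (Peter--Weyl), so by approximation mixing says that for
  characters \<open>\<chi>\<^sub>1, \<dots>, \<chi>\<^sub>s\<close>, not all trivial, the relation
  \<open>\<Sum>\<^sub>k A\<^sub>k\<^sup>n \<chi>\<^sub>k = 0\<close> between the dual matrices \<open>A\<^sub>k\<close> holds for finitely many \<open>n\<close> only.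
  If it holds for infinitely many \<open>n\<close>, then by the theorem of Skolem it holds along a whole
  progression \<open>n = l m + r\<close>. Let \<open>L\<close> be the block operator with blocks \<open>A\<^sub>k\<^sup>l\<close>, and apply to the
  vector \<open>v\<close> with blocks \<open>A\<^sub>k\<^sup>r \<chi>\<^sub>k\<close> its minimal annihilating polynomial of \<open>L\<close> divided by a linear
  factor: the blocks of the result are eigenvectors to a common eigenvalue (or zero), and they still
  sum to zero. Conversely, a \<open>\<rat>\<close>-linear functional on \<open>\<complex>\<close> turns dependent eigenvectors of the
  \<open>A\<^sub>k\<^sup>l\<close> into rational vectors, hence characters, with such a relation for all multiples of \<open>l\<close>.
\<close>

section \<open>Skolem's theorem for rational matrices\<close>

text \<open>Skolem's theorem is usually proved with p-adic analytic functions; here everything stays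
  in the integers. If the matrix is invertible modulo p, some power \<open>A^l\<close> is congruent
  to 1 modulo \<open>p^2\<close>, and the values along a progression become series with terms
  \<open>(m choose i) * p^(2 i) * d i\<close>. One factor \<open>p^i\<close> pays for the powers of
  p in \<open>i!\<close>, the other makes the terms small, for p = 2 as well. Infinitely many zeros
  then make every value divisible by all powers of p. The exponent l of the criterion is the modulus
  of the progression. The offset r is absorbed by a vector that stays nonzero because surjectivity
  makes the dual matrices invertible. In the converse direction the eigenvalue may be irrational, so
  it cannot be pulled out of a rational functional. But the combination of the eigenvectors is zero
  before the functional is applied, and only rational matrices have to pass through it. Separation
  of points uses continuous functions only: equicontinuity replaces the completeness of a Hilbert
  space, and an eigenspace of a squared convolution, orthogonal to all characters, would be
  finite-dimensional and translation invariant and so contain a character.\<close>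

lemma fact_mult_add_prime_part:
  fixes p :: nat
  assumes "prime p" "r < p"
  shows "\<exists>u. \<not> p dvd u \<and> fact (p * k + r) = (fact (p * k) * u :: nat)"
  using assms(2)
proof (induction r)
  case 0
  show ?case using assms(1) by (intro exI[of _ 1]) (auto simp: prime_nat_iff)
next
  case (Suc r)
  then obtain u where u: "\<not> p dvd u" "fact (p * k + r) = (fact (p * k) * u :: nat)" by auto
  have "\<not> p dvd (p * k + Suc r)"
    using Suc.prems by (metis dvd_add_right_iff dvd_imp_le dvd_triv_left not_le zero_less_Suc)
  then have "\<not> p dvd u * (p * k + Suc r)"
    using u(1) assms(1) prime_dvd_mult_iff by blast
  then show ?case using u(2) by (intro exI[of _ "u * (p * k + Suc r)"]) (auto simp: algebra_simps)
qed

text \<open>The factors strictly between consecutive multiples of p are prime to p, and the k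
  multiples of p contribute \<open>p ^ k * fact k\<close>. The induction appends one block of p
  factors.\<close>

lemma fact_mult_prime_part:
  fixes p :: nat
  assumes "prime p"
  shows "\<exists>u. \<not> p dvd u \<and> fact (p * k) = (p ^ k * fact k * u :: nat)"
proof (induction k)
  case 0
  show ?case using assms by (intro exI[of _ 1]) (auto simp: prime_nat_iff)
next
  case (Suc k)
  then obtain u where u: "\<not> p dvd u" "fact (p * k) = (p ^ k * fact k * u :: nat)" by auto
  have p: "p > 0" using assms prime_gt_0_nat by blast
  obtain w where w: "\<not> p dvd w" "fact (p * k + (p - 1)) = (fact (p * k) * w :: nat)"
    using fact_mult_add_prime_part[OF assms, of "p - 1" k] p by auto
  have "p * Suc k = Suc (p * k + (p - 1))" using p by simp
  then have "fact (p * Suc k) = (p * Suc k) * (fact (p * k + (p - 1)) :: nat)"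
    by (metis fact_Suc of_nat_id)
  also have "\<dots> = p ^ Suc k * fact (Suc k) * (u * w)"
    using u w by (simp add: algebra_simps)
  finally show ?case using u w assms prime_dvd_mult_iff by blast
qed

text \<open>A weak form of Legendre's formula, by recursion to \<open>n div p\<close>. The bound
  \<open>a \<le> n\<close> is what lets a factor \<open>p ^ i\<close> cancel the p-part of
  \<open>i!\<close>.\<close>

lemma fact_prime_part:
  fixes p :: nat
  assumes "prime p"
  shows "\<exists>a u. a \<le> n \<and> \<not> p dvd u \<and> fact n = (p ^ a * u :: nat)"
proof (induction n rule: less_induct)
  case (less n)
  have p2: "p \<ge> 2" using assms prime_ge_2_nat by blast
  show ?case
  proof (cases "n = 0")
    case True
    then show ?thesis using assms by (intro exI[of _ 0] exI[of _ 1]) (auto simp: prime_nat_iff)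
  next
    case False
    define k where "k = n div p"
    have k: "k < n" unfolding k_def using False p2 by auto
    then obtain a u where au: "a \<le> k" "\<not> p dvd u" "fact k = (p ^ a * u :: nat)"
      using less by blast
    obtain u1 where u1: "\<not> p dvd u1" "fact (p * k) = (p ^ k * fact k * u1 :: nat)"
      using fact_mult_prime_part[OF assms] by blast
    obtain u2 where u2: "\<not> p dvd u2" "fact (p * k + n mod p) = (fact (p * k) * u2 :: nat)"
      using fact_mult_add_prime_part[OF assms, of "n mod p" k] p2 by auto
    have "p * k + n mod p = n" unfolding k_def by simp
    then have "fact n = p ^ (k + a) * (u * u1 * u2)"
      using u2(2) u1(2) au(3) by (simp add: power_add algebra_simps)
    moreover have "k + a \<le> n"
    proof -
      have "k + a \<le> 2 * k" using au by simp
      also have "\<dots> \<le> p * k" using p2 by simp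
      also have "\<dots> \<le> n" unfolding k_def by simp
      finally show ?thesis .
    qed
    moreover have "\<not> p dvd u * u1 * u2"
      using au u1 u2 assms prime_dvd_mult_iff by blast
    ultimately show ?thesis by blast
  qed
qed

section \<open>Binomial series with infinitely many zeros\<close>

text \<open>With subtraction in the integers the product contains the factor 0 when
  \<open>t < i\<close>, where the binomial coefficient is 0 too. Hence \<open>fact i\<close> times
  the binomial coefficient is the value of one integer polynomial at every natural t.\<close>

lemma falling_product_eq_fact_binomial:
  "(\<Prod>j<i. int t - int j) = fact i * int (t choose i)"
proof (induction i)
  case (Suc i)
  have *: "int (Suc i) * int (t choose Suc i) = (int t - int i) * int (t choose i)"
  proof (cases "i \<le> t")
    case True
    have "Suc i * (t choose Suc i) = (t - i) * (t choose i)"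
      using binomial_absorb_comp[of t i] binomial_absorption[of i t] by simp
    then have "int (Suc i * (t choose Suc i)) = int ((t - i) * (t choose i))" by (rule arg_cong)
    then show ?thesis using True by (simp only: of_nat_mult of_nat_diff)
  next
    case False
    then have "i = t \<or> t < i" by auto
    then show ?thesis by (auto simp: binomial_eq_0)
  qed
  have "(\<Prod>j<Suc i. int t - int j) = fact i * ((int t - int i) * int (t choose i))"
    using Suc by simp
  also have "\<dots> = fact (Suc i) * int (t choose Suc i)"
    unfolding *[symmetric] by (simp add: algebra_simps)
  finally show ?case .
qed auto

lemma smult_sum_right: "smult c (\<Sum>i\<in>S. f i) = (\<Sum>i\<in>S. smult c (f i))"
  by (induction S rule: infinite_finite_induct) (auto simp: smult_add_right)

text \<open>Dividing H by the monic polynomial W with zero set Z stays within integer coefficients;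
  pseudo-division is exact because the leading coefficient is 1. What remains of F besides
  \<open>q * W * Q\<close> has degree below \<open>card Z\<close> and vanishes on Z, so it is
  0.\<close>

lemma dvd_poly_of_many_zeros:
  fixes F G H :: "int poly"
  assumes F: "F = G + smult q H" and Z: "finite Z" "degree G < card Z"
    and zero: "\<And>z. z \<in> Z \<Longrightarrow> poly F z = 0"
  shows "q dvd poly F x"
proof -
  define W where "W = (\<Prod>z\<in>Z. [:-z, 1:])"
  have lead: "lead_coeff W = 1" unfolding W_def by (simp add: lead_coeff_prod)
  have deg: "degree W = card Z" unfolding W_def by (subst degree_prod_eq_sum_degree) auto
  have W0: "W \<noteq> 0" using lead by auto
  obtain Q R where QR: "pseudo_divmod H W = (Q, R)" by fastforce
  have H: "H = W * Q + R" using pseudo_divmod(1)[OF W0 QR] lead by simp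
  have R: "R = 0 \<or> degree R < degree W" using pseudo_divmod(2)[OF W0 QR] .
  define P where "P = G + smult q R"
  have FP: "F = smult q (W * Q) + P" unfolding F H P_def by (simp add: smult_add_right)
  have PZ: "poly P z = 0" if "z \<in> Z" for z
  proof -
    have "poly W z = 0" unfolding W_def poly_prod using that Z(1) by (auto simp: prod_zero_iff)
    then show ?thesis using zero[OF that] unfolding FP by simp
  qed
  have "P = 0"
  proof (rule ccontr)
    assume "P \<noteq> 0"
    have "card Z \<le> card {x. poly P x = 0}"
      using PZ by (intro card_mono poly_roots_finite \<open>P \<noteq> 0\<close>) auto
    also have "\<dots> \<le> degree P" by (rule card_poly_roots_bound[OF \<open>P \<noteq> 0\<close>])
    also have "degree P < card Z"
      unfolding P_def using Z(2) R deg by (intro degree_add_less) (auto intro: le_less_trans[OF degree_smult_le])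
    finally show False by simp
  qed
  then show ?thesis unfolding FP by simp
qed

text \<open>Multiplying the binomial expansion by the part of \<open>\<Prod> i!\<close> prime to \<open>p\<close> turns it into an
  integer polynomial whose coefficients from degree \<open>k\<close> on are divisible by \<open>p ^ k\<close>; it
  vanishes at \<open>k\<close> points, so all its values are divisible by \<open>p ^ k\<close>.\<close>

lemma binomial_series_infinitely_many_zeros:
  fixes d :: "nat \<Rightarrow> int" and p :: nat
  defines "b \<equiv> \<lambda>n. \<Sum>i\<le>n. int (n choose i) * int p ^ (2 * i) * d i"
  assumes p: "prime p" and inf: "infinite {n. b n = 0}"
  shows "b n = 0"
proof -
  have dvd: "int p ^ k dvd b n" if "k > 0" for k
  proof -
    obtain Z0 where Z0: "Z0 \<subseteq> {n. b n = 0}" "finite Z0" "card Z0 = k"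
      using inf infinite_arbitrarily_large by metis
    \<comment> \<open>A common truncation point: for \<open>t \<le> N\<close> the terms with
      \<open>i > t\<close> vanish, so a single polynomial represents \<open>b\<close> at n and at
      all the chosen zeros. The summand k ensures that the terms of index below k are all
      present.\<close>
    define N where "N = Max (insert n Z0) + k"
    have N: "t \<le> N" if "t \<in> insert n Z0" for t
      unfolding N_def using Max_ge[of "insert n Z0" t] that Z0(2) by (meson finite_insert trans_le_add1)
    have "\<forall>i. \<exists>a u. a \<le> i \<and> \<not> p dvd u \<and> fact i = (p ^ a * u :: nat)"
      using fact_prime_part[OF p] by blast
    then obtain a u where au: "\<And>i. a i \<le> i" "\<And>i. \<not> p dvd u i"
      "\<And>i. fact i = (p ^ a i * u i :: nat)" by metis
    define U where "U = (\<Prod>i\<le>N. int (u i))"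
    \<comment> \<open>This is the integer \<open>p^i * U / i!\<close>: the power
      \<open>p^(a i)\<close> is cancelled from \<open>p^i\<close>, the part \<open>u i\<close> prime
      to p from U. Of the original \<open>p^(2 i)\<close> a full \<open>p^i\<close> is left
      over.\<close>
    define g where "g i = int p ^ (i - a i) * (\<Prod>j\<in>{..N} - {i}. int (u j))" for i
    have g: "g i * fact i = int p ^ i * U" if "i \<le> N" for i
    proof -
      have "fact i = (int (fact i) :: int)" by simp
      also have "\<dots> = int p ^ a i * int (u i)" by (simp only: au(3) of_nat_mult of_nat_power)
      finally have "fact i = int p ^ a i * int (u i)" .
      moreover have "U = int (u i) * (\<Prod>j\<in>{..N} - {i}. int (u j))"
        unfolding U_def using that by (intro prod.remove) auto
      moreover have "int p ^ i = int p ^ (i - a i) * int p ^ a i"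
        using au(1)[of i] by (simp flip: power_add)
      ultimately show ?thesis unfolding g_def by simp
    qed
    define ff :: "nat \<Rightarrow> int poly" where "ff i = (\<Prod>j<i. [:- int j, 1:])" for i
    have degff: "degree (ff i) = i" for i
      unfolding ff_def by (subst degree_prod_eq_sum_degree) auto
    have pff: "poly (ff i) (int t) = fact i * int (t choose i)" for i t
      using falling_product_eq_fact_binomial[of t i] unfolding ff_def by (simp add: poly_prod)
    define F where "F = (\<Sum>i\<le>N. smult (d i * g i * int p ^ i) (ff i))"
    define G where "G = (\<Sum>i<k. smult (d i * g i * int p ^ i) (ff i))"
    define H where "H = (\<Sum>i\<in>{k..N}. smult (d i * g i * int p ^ (i - k)) (ff i))"
    have "{..N} = {..<k} \<union> {k..N}" unfolding N_def by auto
    then have "F = G + (\<Sum>i\<in>{k..N}. smult (d i * g i * int p ^ i) (ff i))"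
      unfolding F_def G_def by (simp only:) (rule sum.union_disjoint, auto)
    also have "(\<Sum>i\<in>{k..N}. smult (d i * g i * int p ^ i) (ff i)) = smult (int p ^ k) H"
      unfolding H_def smult_sum_right
    proof (intro sum.cong refl)
      fix i assume "i \<in> {k..N}"
      then have "int p ^ i = int p ^ k * int p ^ (i - k)" by (simp flip: power_add)
      then show "smult (d i * g i * int p ^ i) (ff i) = smult (int p ^ k) (smult (d i * g i * int p ^ (i - k)) (ff i))"
        by (simp add: mult_ac)
    qed
    finally have FGH: "F = G + smult (int p ^ k) H" .
    have Fb: "poly F (int t) = U * b t" if "t \<le> N" for t
    proof -
      have "poly F (int t) = (\<Sum>i\<le>N. d i * int p ^ i * (g i * fact i) * int (t choose i))"
        unfolding F_def by (simp add: poly_sum pff algebra_simps)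
      also have "\<dots> = (\<Sum>i\<le>N. U * (int (t choose i) * int p ^ (2 * i) * d i))"
        by (intro sum.cong) (auto simp: g mult_2 power_add)
      also have "\<dots> = (\<Sum>i\<le>t. U * (int (t choose i) * int p ^ (2 * i) * d i))"
        using that by (intro sum.mono_neutral_right) auto
      finally show ?thesis unfolding b_def by (simp add: sum_distrib_left)
    qed
    have "int p ^ k dvd poly F (int n)"
    proof (rule dvd_poly_of_many_zeros[OF FGH])
      show "finite (int ` Z0)" using Z0 by simp
      have "degree G < k" unfolding G_def using \<open>k > 0\<close>
        by (intro degree_sum_less) (auto intro!: le_less_trans[OF degree_smult_le] simp: degff)
      then show "degree G < card (int ` Z0)" using Z0 by (simp add: card_image)
      show "poly F z = 0" if "z \<in> int ` Z0" for z
        using that Fb N Z0 by auto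
    qed
    then have "int p ^ k dvd U * b n" using Fb[OF N, of n] by simp
    moreover have "coprime (int p ^ k) U"
    proof -
      have "coprime (int p) (int (u i))" for i
        using au(2)[of i] p by (simp add: prime_imp_coprime)
      then show ?thesis unfolding U_def by (intro prod_coprime_right) auto
    qed
    ultimately show ?thesis using coprime_dvd_mult_right_iff by blast
  qed
  show "b n = 0"
  proof (rule ccontr)
    assume "b n \<noteq> 0"
    \<comment> \<open>Large enough that \<open>p^k\<close> exceeds the absolute value of
      \<open>b n\<close>, which its nonzero multiple \<open>b n\<close> contradicts.\<close>
    define k where "k = Suc (nat \<bar>b n\<bar>)"
    have "int p ^ k \<le> \<bar>b n\<bar>" using dvd_imp_le_int[OF \<open>b n \<noteq> 0\<close> dvd[of k]]
      by (simp add: k_def power_abs)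
    moreover have "k < p ^ k"
      using power_gt_expt[of p k] prime_ge_2_nat[OF p] by simp
    then have "int k < int p ^ k" by (simp only: of_nat_less_iff flip: of_nat_power)
    ultimately show False unfolding k_def by auto
  qed
qed

section \<open>Powers of integer matrices modulo q\<close>

text \<open>Matrices indexed by an arbitrary type, so that pairs of a block and a coordinate serve
  as indices without being enumerated. Only the values of f on I are read.\<close>

definition act :: "'i set \<Rightarrow> ('i \<Rightarrow> 'i \<Rightarrow> 'c::comm_ring_1) \<Rightarrow> ('i \<Rightarrow> 'c) \<Rightarrow> 'i \<Rightarrow> 'c" where
  "act I a f = (\<lambda>x. \<Sum>y\<in>I. a x y * f y)"

lemma act_cong: "(\<And>y. y \<in> I \<Longrightarrow> f y = g y) \<Longrightarrow> act I a f = act I a g"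
  unfolding act_def by auto

lemma act_add: "act I a (\<lambda>x. f x + g x) = (\<lambda>x. act I a f x + act I a g x)"
  unfolding act_def by (simp add: algebra_simps sum.distrib)

lemma act_scale: "act I a (\<lambda>x. c * f x) = (\<lambda>x. c * act I a f x)"
  unfolding act_def by (simp add: algebra_simps sum_distrib_left)

lemma act_pow_cong:
  assumes "\<And>y. y \<in> I \<Longrightarrow> f y = g y" "x \<in> I"
  shows "(act I a ^^ n) f x = (act I a ^^ n) g x"
  using assms(2) by (induction n arbitrary: x) (auto simp: assms(1) cong: act_cong)

lemma act_pow_add: "(act I a ^^ n) (\<lambda>x. f x + g x) = (\<lambda>x. (act I a ^^ n) f x + (act I a ^^ n) g x)"
  by (induction n) (auto simp: act_add)

lemma act_pow_scale: "(act I a ^^ n) (\<lambda>x. c * f x) = (\<lambda>x. c * (act I a ^^ n) f x)"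
  by (induction n) (auto simp: act_scale)

lemma act_pow_expand:
  assumes "finite I" "x \<in> I"
  shows "(act I a ^^ n) f x = (\<Sum>y\<in>I. (act I a ^^ n) (\<lambda>z. if z = y then 1 else 0) x * f y)"
  using assms(2)
proof (induction n arbitrary: x)
  case 0
  then show ?case using assms(1) by (simp add: if_distrib[of "\<lambda>t. t * _"] cong: if_cong)
next
  case (Suc n)
  have "(act I a ^^ Suc n) f x = (\<Sum>z\<in>I. a x z * (act I a ^^ n) f z)"
    by (simp add: act_def)
  also have "\<dots> = (\<Sum>z\<in>I. \<Sum>y\<in>I. a x z * (act I a ^^ n) (\<lambda>z. if z = y then 1 else 0) z * f y)"
    using Suc.IH by (intro sum.cong refl) (simp add: sum_distrib_left mult.assoc)
  also have "\<dots> = (\<Sum>y\<in>I. (\<Sum>z\<in>I. a x z * (act I a ^^ n) (\<lambda>z. if z = y then 1 else 0) z) * f y)"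
    by (subst sum.swap) (simp add: sum_distrib_right)
  finally show ?case by (simp add: act_def[of I a "(act I a ^^ n) _"])
qed

lemma act_left_inverse:
  assumes "finite I" "\<And>x z. x \<in> I \<Longrightarrow> z \<in> I \<Longrightarrow> (\<Sum>y\<in>I. c x y * a y z) = (if x = z then N else 0)"
    and "x \<in> I"
  shows "act I c (act I a f) x = N * f x"
proof -
  have "act I c (act I a f) x = (\<Sum>y\<in>I. \<Sum>z\<in>I. c x y * a y z * f z)"
    unfolding act_def by (simp add: sum_distrib_left mult.assoc)
  also have "\<dots> = (\<Sum>z\<in>I. (\<Sum>y\<in>I. c x y * a y z) * f z)"
    by (subst sum.swap) (simp add: sum_distrib_right)
  also have "\<dots> = (\<Sum>z\<in>I. (if x = z then N else 0) * f z)"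
    using assms by (intro sum.cong) auto
  also have "\<dots> = N * f x" using assms by (simp add: if_distrib[of "\<lambda>t. t * _"] cong: if_cong)
  finally show ?thesis .
qed

text \<open>There are finitely many matrices modulo q, so two powers of a agree modulo q; a is
  invertible modulo q, so the smaller power can be cancelled. The inverse is given up to the factor
  N, since an integer matrix need not have an integer inverse.\<close>

lemma act_pow_congruent_one:
  fixes a c :: "'i \<Rightarrow> 'i \<Rightarrow> int"
  assumes I: "finite I"
    and inv: "\<And>x z. x \<in> I \<Longrightarrow> z \<in> I \<Longrightarrow> (\<Sum>y\<in>I. c x y * a y z) = (if x = z then N else 0)"
    and q: "q > 0" "coprime q N"
  shows "\<exists>l\<ge>1. \<forall>f. \<forall>x\<in>I. q dvd (act I a ^^ l) f x - f x"
proof -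
  let ?e = "\<lambda>y z. if z = y then 1 else (0::int)"
  \<comment> \<open>The entries of the n-th power modulo q, read off from its values on the standard
    basis.\<close>
  define st where "st n = (\<lambda>u\<in>I \<times> I. (act I a ^^ n) (?e (snd u)) (fst u) mod q)" for n
  have "st n \<in> (I \<times> I) \<rightarrow>\<^sub>E {0..<q}" for n
    unfolding st_def using q by auto
  then have "finite (range st)"
    using I by (meson finite_PiE finite_SigmaI finite_atLeastLessThan_int finite_subset image_subsetI)
  then obtain i j where ij: "i < j" "st i = st j"
    by (metis (no_types) infinite_UNIV_nat finite_imageD injI linorder_neqE_nat)
  have congr: "q dvd (act I a ^^ j) f x - (act I a ^^ i) f x" if x: "x \<in> I" for f x
  proof -
    have "q dvd (act I a ^^ j) (?e y) x - (act I a ^^ i) (?e y) x" if "y \<in> I" for y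
      using fun_cong[OF ij(2)[symmetric], of "(x, y)"] that x unfolding st_def by (simp add: mod_eq_dvd_iff)
    then have "q dvd (\<Sum>y\<in>I. ((act I a ^^ j) (?e y) x - (act I a ^^ i) (?e y) x) * f y)"
      by (intro dvd_sum dvd_mult2) auto
    then show ?thesis
      by (simp add: act_pow_expand[OF I x, where f = f] left_diff_distrib sum_subtractf)
  qed
  \<comment> \<open>Applying c undoes one step up to the factor N, which is a unit modulo q.\<close>
  have cancel: "q dvd h x" if "\<forall>x\<in>I. q dvd (act I a ^^ n) h x" "x \<in> I" for h n x
    using that
  proof (induction n arbitrary: x)
    case (Suc n)
    have "q dvd (act I a ^^ n) h x" if x: "x \<in> I" for x
    proof -
      have "q dvd act I c (act I a ((act I a ^^ n) h)) x"
        unfolding act_def[of I c] using Suc.prems by (intro dvd_sum dvd_mult) auto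
      then have "q dvd N * (act I a ^^ n) h x"
        using act_left_inverse[OF I inv x, of "(act I a ^^ n) h"] by simp
      then show ?thesis using q coprime_dvd_mult_right_iff by blast
    qed
    then show ?case using Suc by blast
  qed auto
  define l where "l = j - i"
  have "q dvd (act I a ^^ l) f x - f x" if x: "x \<in> I" for f x
  proof (rule cancel[of i "\<lambda>x. (act I a ^^ l) f x - f x", OF _ x])
    have "(act I a ^^ i) (\<lambda>x. (act I a ^^ l) f x - f x) y = (act I a ^^ j) f y - (act I a ^^ i) f y" for y
    proof -
      have "(act I a ^^ i) (\<lambda>x. (act I a ^^ l) f x + (- 1) * f x) y
        = (act I a ^^ i) ((act I a ^^ l) f) y + (- 1) * (act I a ^^ i) f y"
        by (simp only: act_pow_add act_pow_scale)
      moreover have "(act I a ^^ i) ((act I a ^^ l) f) = (act I a ^^ j) f"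
        using ij(1) unfolding l_def by (metis add_diff_inverse_nat comp_apply funpow_add less_imp_not_less)
      ultimately show ?thesis by simp
    qed
    then show "\<forall>y\<in>I. q dvd (act I a ^^ i) (\<lambda>x. (act I a ^^ l) f x - f x) y"
      using congr by simp
  qed
  then show ?thesis using ij(1) unfolding l_def by (intro exI[of _ "j - i"]) auto
qed

section \<open>From matrix powers to binomial series\<close>

text \<open>The binomial theorem for \<open>M = 1 + q B\<close>, with linearity asked of M alone
  because B will be a rounded quotient. The induction therefore writes \<open>M^(m+1) f\<close> as
  \<open>M^m (M f)\<close> and expands the inner \<open>M f\<close>; powers of B are only ever
  applied to f or to \<open>B f\<close>.\<close>

lemma pow_binomial_expansion:
  fixes M B :: "('i \<Rightarrow> int) \<Rightarrow> 'i \<Rightarrow> int"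
  assumes add: "\<And>f g. M (\<lambda>x. f x + g x) = (\<lambda>x. M f x + M g x)"
    and scale: "\<And>c f. M (\<lambda>x. c * f x) = (\<lambda>x. c * M f x)"
    and cong: "\<And>f g x. (\<And>y. y \<in> I \<Longrightarrow> f y = g y) \<Longrightarrow> x \<in> I \<Longrightarrow> M f x = M g x"
    and B: "\<And>f x. x \<in> I \<Longrightarrow> M f x = f x + q * B f x"
    and x: "x \<in> I"
  shows "(M ^^ m) f x = (\<Sum>i\<le>m. int (m choose i) * q ^ i * (B ^^ i) f x)"
proof -
  have add': "(M ^^ m) (\<lambda>x. f x + g x) = (\<lambda>x. (M ^^ m) f x + (M ^^ m) g x)" for f g m
    by (induction m) (auto simp: add)
  have scale': "(M ^^ m) (\<lambda>x. c * f x) = (\<lambda>x. c * (M ^^ m) f x)" for f c m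
    by (induction m) (auto simp: scale)
  have cong': "(M ^^ m) f x = (M ^^ m) g x" if "\<And>y. y \<in> I \<Longrightarrow> f y = g y" "x \<in> I" for f g x m
    using that(2) by (induction m arbitrary: x) (auto simp: that(1) intro: cong)
  show ?thesis
  proof (induction m arbitrary: f)
    case (Suc m)
    let ?t = "\<lambda>i. q ^ i * (B ^^ i) f x"
    have "(M ^^ Suc m) f x = (M ^^ m) (M f) x" by (simp only: funpow_Suc_right comp_apply)
    also have "\<dots> = (M ^^ m) (\<lambda>x. f x + q * B f x) x"
      by (rule cong') (auto simp: B x)
    also have "\<dots> = (M ^^ m) f x + q * (M ^^ m) (B f) x" by (simp add: add' scale')
    also have "\<dots> = (\<Sum>i\<le>m. int (m choose i) * ?t i) + (\<Sum>i\<le>m. int (m choose i) * ?t (Suc i))"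
      unfolding Suc by (simp add: sum_distrib_left algebra_simps funpow_swap1)
    also have "(\<Sum>i\<le>m. int (m choose i) * ?t i) = (\<Sum>i\<le>Suc m. int (m choose i) * ?t i)"
      by simp
    also have "\<dots> = ?t 0 + (\<Sum>i\<le>m. int (m choose Suc i) * ?t (Suc i))"
      by (subst sum.atMost_Suc_shift) simp
    also have "?t 0 + (\<Sum>i\<le>m. int (m choose Suc i) * ?t (Suc i)) + (\<Sum>i\<le>m. int (m choose i) * ?t (Suc i))
      = ?t 0 + (\<Sum>i\<le>m. int (Suc m choose Suc i) * ?t (Suc i))"
      by (simp only: add.assoc sum.distrib[symmetric]) (simp add: algebra_simps)
    also have "\<dots> = (\<Sum>i\<le>Suc m. int (Suc m choose i) * ?t i)"
      by (subst sum.atMost_Suc_shift) simp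
    finally show ?case by (simp only: mult.assoc)
  qed auto
qed

lemma infinite_residue_class:
  fixes S :: "nat set" and l :: nat
  assumes "infinite S" "l \<ge> 1"
  shows "\<exists>r. infinite {m. l * m + r \<in> S}"
proof (rule ccontr)
  assume "\<not> ?thesis"
  then have "finite (\<Union>r<l. (\<lambda>m. l * m + r) ` {m. l * m + r \<in> S})" by auto
  moreover have "S \<subseteq> (\<Union>r<l. (\<lambda>m. l * m + r) ` {m. l * m + r \<in> S})"
  proof
    fix n assume "n \<in> S"
    then show "n \<in> (\<Union>r<l. (\<lambda>m. l * m + r) ` {m. l * m + r \<in> S})"
      using assms(2) by (intro UN_I[of "n mod l"] image_eqI[of _ _ "n div l"]) auto
  qed
  ultimately show False using assms(1) finite_subset by blast
qed

text \<open>Along a residue class modulo l that contains infinitely many of the common zeros, each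
  linear functional of the orbit is a binomial series as treated above, hence identically zero. The
  class is chosen before t, so one progression serves all functionals.\<close>

lemma skolem_int:
  fixes a c :: "'i \<Rightarrow> 'i \<Rightarrow> int"
  assumes I: "finite I" and N: "N \<noteq> 0"
    and inv: "\<And>x z. x \<in> I \<Longrightarrow> z \<in> I \<Longrightarrow> (\<Sum>y\<in>I. c x y * a y z) = (if x = z then N else 0)"
    and inf: "infinite {n. \<forall>t\<in>J. (\<Sum>x\<in>I. \<rho> t x * (act I a ^^ n) v x) = 0}"
  shows "\<exists>l\<ge>1. \<exists>r. \<forall>m. \<forall>t\<in>J. (\<Sum>x\<in>I. \<rho> t x * (act I a ^^ (l * m + r)) v x) = 0"
proof -
  \<comment> \<open>A prime above the absolute value of the nonzero N does not divide N, so a is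
    invertible modulo \<open>p^2\<close>.\<close>
  obtain p where p: "prime p" "nat \<bar>N\<bar> < p" using bigger_prime by blast
  have "\<not> int p dvd N"
    using p(2) N by (metis dvd_imp_le_int less_le_not_le nat_less_iff abs_ge_zero abs_of_nat)
  then have "coprime (int p ^ 2) N"
    using p(1) by (simp add: prime_imp_coprime)
  moreover have "int p ^ 2 > 0" using p(1) prime_gt_0_nat by simp
  ultimately obtain l where l: "l \<ge> 1" "\<And>f x. x \<in> I \<Longrightarrow> int p ^ 2 dvd (act I a ^^ l) f x - f x"
    using act_pow_congruent_one[OF I inv, of "int p ^ 2"] by blast
  obtain r where r: "infinite {m. l * m + r \<in> {n. \<forall>t\<in>J. (\<Sum>x\<in>I. \<rho> t x * (act I a ^^ n) v x) = 0}}"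
    using infinite_residue_class[OF inf l(1)] by blast
  define M where "M = act I a ^^ l"
  \<comment> \<open>The division is exact on I; off I the rounding is harmless, because only values
    on I enter.\<close>
  define B where "B f = (\<lambda>x. (M f x - f x) div int p ^ 2)" for f
  define w where "w = (act I a ^^ r) v"
  have expand: "(act I a ^^ (l * m + r)) v x = (\<Sum>i\<le>m. int (m choose i) * (int p ^ 2) ^ i * (B ^^ i) w x)"
    if "x \<in> I" for m x
  proof -
    have "(act I a ^^ (l * m + r)) v x = (M ^^ m) w x"
      unfolding M_def w_def by (simp add: funpow_add funpow_mult)
    also have "(M ^^ m) w x = (\<Sum>i\<le>m. int (m choose i) * (int p ^ 2) ^ i * (B ^^ i) w x)"
      by (rule pow_binomial_expansion[where I = I])
        (use l(2) that in \<open>auto simp: M_def B_def act_pow_add act_pow_scale intro: act_pow_cong\<close>)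
    finally show ?thesis .
  qed
  define dd where "dd t i = (\<Sum>x\<in>I. \<rho> t x * (B ^^ i) w x)" for t i
  have sum: "(\<Sum>x\<in>I. \<rho> t x * (act I a ^^ (l * m + r)) v x)
    = (\<Sum>i\<le>m. int (m choose i) * int p ^ (2 * i) * dd t i)" for t m
  proof -
    have "(\<Sum>x\<in>I. \<rho> t x * (act I a ^^ (l * m + r)) v x)
      = (\<Sum>x\<in>I. \<Sum>i\<le>m. int (m choose i) * int p ^ (2 * i) * (\<rho> t x * (B ^^ i) w x))"
      by (intro sum.cong refl) (simp add: expand sum_distrib_left mult_ac flip: power_mult)
    also have "\<dots> = (\<Sum>i\<le>m. int (m choose i) * int p ^ (2 * i) * dd t i)"
      unfolding dd_def by (subst sum.swap) (simp add: sum_distrib_left)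
    finally show ?thesis .
  qed
  have "(\<Sum>x\<in>I. \<rho> t x * (act I a ^^ (l * m + r)) v x) = 0" if "t \<in> J" for t m
    unfolding sum
  proof (rule binomial_series_infinitely_many_zeros[OF p(1)])
    show "infinite {n. (\<Sum>i\<le>n. int (n choose i) * int p ^ (2 * i) * dd t i) = 0}"
      using r by (rule contrapos_nn) (auto elim!: rev_finite_subset simp: sum[symmetric] that)
  qed
  then show ?thesis using l(1) by blast
qed

section \<open>Clearing denominators\<close>

lemma common_denominator_set:
  fixes S :: "rat set"
  assumes "finite S"
  shows "\<exists>D::int. D > 0 \<and> (\<forall>q\<in>S. of_int D * q \<in> \<int>)"
  using assms
proof (induction S)
  case (insert q S)
  then obtain D :: int where D: "D > 0" "\<forall>q\<in>S. of_int D * q \<in> \<int>" by auto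
  obtain a b where ab: "quotient_of q = (a, b)" by fastforce
  have b: "b > 0" using ab by (rule quotient_of_denom_pos)
  have q: "q = of_int a / of_int b" using ab by (rule quotient_of_div)
  have "of_int (D * b) * q = of_int (D * a)" using b unfolding q by simp
  then have 1: "of_int (D * b) * q \<in> \<int>" by (metis Ints_of_int)
  have "of_int (D * b) * q' \<in> \<int>" if "q' \<in> S" for q'
  proof -
    have "of_int (D * b) * q' = of_int b * (of_int D * q')" by simp
    then show ?thesis using D(2) that by (metis Ints_mult Ints_of_int)
  qed
  then show ?case using 1 D b by (intro exI[of _ "D * b"]) auto
qed (auto intro: exI[of _ 1])

text \<open>Multiplying a, c and v by a common denominator D multiplies the n-th iterate by
  \<open>D^(n+1)\<close>, which does not affect zeros, and turns the inverse relation into one with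
  \<open>N = D * D\<close>.\<close>

theorem skolem_rat:
  fixes a c :: "'i \<Rightarrow> 'i \<Rightarrow> rat" and \<rho> :: "'t \<Rightarrow> 'i \<Rightarrow> rat"
  assumes I: "finite I"
    and inv: "\<And>x z. x \<in> I \<Longrightarrow> z \<in> I \<Longrightarrow> (\<Sum>y\<in>I. c x y * a y z) = (if x = z then 1 else 0)"
    and inf: "infinite {n. \<forall>t\<in>J. (\<Sum>x\<in>I. \<rho> t x * (act I a ^^ n) v x) = 0}"
  shows "\<exists>l\<ge>1. \<exists>r. \<forall>m. \<forall>t\<in>J. (\<Sum>x\<in>I. \<rho> t x * (act I a ^^ (l * m + r)) v x) = 0"
proof -
  define S where "S = (\<lambda>u. a (fst u) (snd u)) ` (I \<times> I) \<union> (\<lambda>u. c (fst u) (snd u)) ` (I \<times> I) \<union> v ` I"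
  have "finite S" unfolding S_def using I by auto
  then obtain D :: int where D: "D > 0" "\<And>q. q \<in> S \<Longrightarrow> of_int D * q \<in> \<int>"
    using common_denominator_set by blast
  \<comment> \<open>One denominator per functional, since J may be infinite.\<close>
  have "\<exists>E::int. E > 0 \<and> (\<forall>x\<in>I. of_int E * \<rho> t x \<in> \<int>)" for t
    using common_denominator_set[of "\<rho> t ` I"] I by auto
  then obtain E :: "'t \<Rightarrow> int" where E: "\<And>t. E t > 0" "\<And>t x. x \<in> I \<Longrightarrow> of_int (E t) * \<rho> t x \<in> \<int>"
    by metis
  define a' where "a' x y = \<lfloor>of_int D * a x y\<rfloor>" for x y
  define c' where "c' x y = \<lfloor>of_int D * c x y\<rfloor>" for x y
  define v' where "v' x = \<lfloor>of_int D * v x\<rfloor>" for x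
  define \<rho>' where "\<rho>' t x = \<lfloor>of_int (E t) * \<rho> t x\<rfloor>" for t x
  have a': "of_int (a' x y) = of_int D * a x y" if "x \<in> I" "y \<in> I" for x y
    unfolding a'_def using D(2)[of "a x y"] that by (force simp: S_def elim!: Ints_cases)
  have c': "of_int (c' x y) = of_int D * c x y" if "x \<in> I" "y \<in> I" for x y
    unfolding c'_def using D(2)[of "c x y"] that by (force simp: S_def elim!: Ints_cases)
  have v': "of_int (v' x) = of_int D * v x" if "x \<in> I" for x
    unfolding v'_def using D(2)[of "v x"] that by (force simp: S_def elim!: Ints_cases)
  have \<rho>': "of_int (\<rho>' t x) = of_int (E t) * \<rho> t x" if "x \<in> I" for t x
    unfolding \<rho>'_def using E(2)[OF that, of t] by (force elim!: Ints_cases)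
  have pow: "of_int ((act I a' ^^ n) v' x) = of_int D ^ Suc n * (act I a ^^ n) v x" if "x \<in> I" for n x
    using that
  proof (induction n arbitrary: x)
    case (Suc n)
    then show ?case by (simp add: act_def a' sum_distrib_left mult_ac)
  qed (simp add: v')
  have sum: "of_int (\<Sum>x\<in>I. \<rho>' t x * (act I a' ^^ n) v' x)
    = of_int (E t) * of_int D ^ Suc n * (\<Sum>x\<in>I. \<rho> t x * (act I a ^^ n) v x)" for t n
    by (simp add: sum_distrib_left pow \<rho>' mult_ac)
  have iff: "(\<Sum>x\<in>I. \<rho>' t x * (act I a' ^^ n) v' x) = 0 \<longleftrightarrow> (\<Sum>x\<in>I. \<rho> t x * (act I a ^^ n) v x) = 0" for t n
  proof -
    have "of_int (\<Sum>x\<in>I. \<rho>' t x * (act I a' ^^ n) v' x) = (0::rat) \<longleftrightarrow> (\<Sum>x\<in>I. \<rho> t x * (act I a ^^ n) v x) = 0"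
      unfolding sum using D(1) E(1)[of t] by auto
    then show ?thesis by (simp only: of_int_eq_0_iff)
  qed
  have "\<exists>l\<ge>1. \<exists>r. \<forall>m. \<forall>t\<in>J. (\<Sum>x\<in>I. \<rho>' t x * (act I a' ^^ (l * m + r)) v' x) = 0"
  proof (rule skolem_int[OF I, where c = c' and N = "D * D"])
    show "(\<Sum>y\<in>I. c' x y * a' y z) = (if x = z then D * D else 0)" if "x \<in> I" "z \<in> I" for x z
    proof -
      have "of_int (\<Sum>y\<in>I. c' x y * a' y z) = of_int D * of_int D * (\<Sum>y\<in>I. c x y * a y z)"
        using that by (simp add: a' c' sum_distrib_left mult_ac)
      also have "\<dots> = of_int (if x = z then D * D else 0)" using inv[OF that] by simp
      finally show ?thesis by (simp only: of_int_eq_iff)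
    qed
    show "infinite {n. \<forall>t\<in>J. (\<Sum>x\<in>I. \<rho>' t x * (act I a' ^^ n) v' x) = 0}"
      using inf by (simp add: iff)
  qed (use D in auto)
  then show ?thesis by (simp add: iff)
qed

section \<open>Eigenvectors\<close>

locale complex_vector_space = vector_space scale
  for scale :: "complex \<Rightarrow> 'v::ab_group_add \<Rightarrow> 'v" (infixr \<open>*\<^sub>C\<close> 75)
begin

definition poly_op :: "complex poly \<Rightarrow> ('v \<Rightarrow> 'v) \<Rightarrow> 'v \<Rightarrow> 'v" where
  "poly_op p L v = (\<Sum>i\<le>degree p. coeff p i *\<^sub>C (L ^^ i) v)"

lemma poly_op_eq:
  assumes "degree p \<le> n"
  shows "poly_op p L v = (\<Sum>i\<le>n. coeff p i *\<^sub>C (L ^^ i) v)"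
  unfolding poly_op_def using assms by (intro sum.mono_neutral_left) (auto simp: coeff_eq_0)

lemma poly_op_linear_factor:
  assumes L: "Vector_Spaces.linear scale scale L"
  shows "poly_op ([:- z, 1:] * q) L v = L (poly_op q L v) - z *\<^sub>C poly_op q L v"
proof -
  let ?n = "Suc (degree q)"
  have deg: "degree ([:- z, 1:] * q) \<le> ?n"
    using degree_mult_le[of "[:- z, 1:]" q] by simp
  interpret L: Vector_Spaces.linear scale scale L by (rule L)
  have "poly_op ([:- z, 1:] * q) L v = (\<Sum>i\<le>?n. (case i of 0 \<Rightarrow> 0 | Suc j \<Rightarrow> coeff q j) *\<^sub>C (L ^^ i) v)
      - (\<Sum>i\<le>?n. (z * coeff q i) *\<^sub>C (L ^^ i) v)"
    unfolding poly_op_eq[OF deg] sum_subtractf[symmetric]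
    by (intro sum.cong refl) (auto simp: coeff_pCons scale_left_diff_distrib split: nat.split)
  also have "(\<Sum>i\<le>?n. (case i of 0 \<Rightarrow> 0 | Suc j \<Rightarrow> coeff q j) *\<^sub>C (L ^^ i) v)
      = (\<Sum>i\<le>degree q. coeff q i *\<^sub>C (L ^^ Suc i) v)"
    by (subst sum.atMost_Suc_shift) simp
  also have "\<dots> = L (poly_op q L v)"
    unfolding poly_op_def by (simp add: L.sum L.scale)
  also have "(\<Sum>i\<le>?n. (z * coeff q i) *\<^sub>C (L ^^ i) v) = z *\<^sub>C poly_op q L v"
    unfolding poly_op_eq[OF le_SucI[OF order_refl], of q] by (simp only: scale_sum_right scale_scale)
  finally show ?thesis .
qed

text \<open>Split off a root z, \<open>p = (X - z) q\<close>. Either q still annihilates v and has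
  smaller degree, or \<open>q(L) v\<close> is an eigenvector to z. A nonzero constant cannot
  annihilate v, so the descent stops.\<close>

lemma poly_op_eigenvector:
  assumes L: "Vector_Spaces.linear scale scale L"
    and "p \<noteq> 0" "poly_op p L v = 0" "v \<noteq> 0"
  shows "\<exists>q z. poly_op q L v \<noteq> 0 \<and> L (poly_op q L v) = z *\<^sub>C poly_op q L v"
  using assms(2-)
proof (induction "degree p" arbitrary: p rule: less_induct)
  case less
  have "degree p \<noteq> 0"
  proof
    assume "degree p = 0"
    then have "coeff p 0 *\<^sub>C v = 0" "coeff p 0 \<noteq> 0"
      using less.prems leading_coeff_neq_0[of p] by (auto simp: poly_op_def)
    then show False using less.prems by simp
  qed
  then obtain z where "poly p z = 0"
    using Fundamental_Theorem_Algebra.fundamental_theorem_of_algebra[of p] Fundamental_Theorem_Algebra.constant_degree[of p] by auto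
  then obtain q where q: "p = [:- z, 1:] * q" by (auto simp: poly_eq_0_iff_dvd elim: dvdE)
  show ?case
  proof (cases "poly_op q L v = 0")
    case True
    have "q \<noteq> 0" using q less.prems by auto
    then have "degree q < degree p" unfolding q by (subst degree_mult_eq) auto
    then show ?thesis using less.hyps[of q] \<open>q \<noteq> 0\<close> True less.prems by blast
  next
    case False
    then show ?thesis using less.prems(2) unfolding q poly_op_linear_factor[OF L] by auto
  qed
qed

text \<open>The first \<open>card B + 1\<close> vectors of the orbit are dependent. If two of them
  coincide, dependence of the set of these vectors says too little, and \<open>X^j - X^i\<close> is
  taken instead.\<close>

lemma annihilating_polynomial:
  assumes "finite B" and orbit: "\<And>i. (L ^^ i) v \<in> span B"
  shows "\<exists>p. p \<noteq> 0 \<and> poly_op p L v = 0"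
proof (cases "inj_on (\<lambda>i. (L ^^ i) v) {..card B}")
  case True
  let ?S = "(\<lambda>i. (L ^^ i) v) ` {..card B}"
  have "card ?S = Suc (card B)" using True by (simp add: card_image)
  then have "dependent ?S"
    using independent_span_bound[OF assms(1), of ?S] orbit by auto
  then obtain u where u: "\<exists>x\<in>?S. u x \<noteq> 0" "(\<Sum>x\<in>?S. u x *\<^sub>C x) = 0"
    using dependent_finite[of ?S] by auto
  define p where "p = (\<Sum>i\<le>card B. monom (u ((L ^^ i) v)) i)"
  have cp: "coeff p i = (if i \<le> card B then u ((L ^^ i) v) else 0)" for i
    unfolding p_def by (simp add: coeff_sum)
  then have "degree p \<le> card B" by (intro degree_le) auto
  then have "poly_op p L v = (\<Sum>i\<le>card B. u ((L ^^ i) v) *\<^sub>C (L ^^ i) v)"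
    by (simp add: poly_op_eq cp)
  also have "\<dots> = 0" using u(2) True by (simp add: sum.reindex)
  finally have "poly_op p L v = 0" .
  moreover obtain i where "i \<le> card B" "u ((L ^^ i) v) \<noteq> 0" using u(1) by auto
  then have "coeff p i \<noteq> 0" by (simp only: cp if_True not_False_eq_True)
  then have "p \<noteq> 0" by auto
  ultimately show ?thesis by blast
next
  case False
  then obtain i j where ij: "i < j" "(L ^^ i) v = (L ^^ j) v"
    unfolding inj_on_def by (metis linorder_neqE_nat)
  define p where "p = monom (1::complex) j - monom 1 i"
  have cp: "coeff p k = (if k = j then 1 else if k = i then -1 else 0)" for k
    unfolding p_def using ij(1) by auto
  have "poly_op p L v = (\<Sum>k\<le>j. coeff p k *\<^sub>C (L ^^ k) v)"
    by (rule poly_op_eq, rule degree_le) (use ij(1) cp in auto)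
  also have "\<dots> = (\<Sum>k\<in>{i, j}. coeff p k *\<^sub>C (L ^^ k) v)"
    using ij(1) cp by (intro sum.mono_neutral_right) auto
  also have "\<dots> = 0" using ij cp by simp
  finally show ?thesis using cp[of j] by (intro exI[of _ p]) auto
qed

text \<open>The commuting family may be infinite, as the translations of a group are. If some
  \<open>L a\<close> has an eigenvector in W without being scalar on W, that eigenspace is smaller
  and invariant by commutation; otherwise every member of the family acts on W as a scalar.\<close>

lemma common_eigenvector:
  assumes B: "finite B"
    and L: "\<And>a. Vector_Spaces.linear scale scale (L a)"
    and comm: "\<And>a b f. L a (L b f) = L b (L a f)"
    and W: "subspace W" "W \<subseteq> span B" "\<And>a f. f \<in> W \<Longrightarrow> L a f \<in> W" "\<exists>f\<in>W. f \<noteq> 0"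
  shows "\<exists>f\<in>W. f \<noteq> 0 \<and> (\<forall>a. \<exists>c. L a f = c *\<^sub>C f)"
  using W
proof (induction "dim W" arbitrary: W rule: less_induct)
  case less
  obtain f where f: "f \<in> W" "f \<noteq> 0" using less.prems by auto
  show ?case
  proof (cases "\<exists>a z. (\<exists>u\<in>W. u \<noteq> 0 \<and> L a u = z *\<^sub>C u) \<and> \<not> (\<forall>u\<in>W. L a u = z *\<^sub>C u)")
    case True
    then obtain a z u g where u: "u \<in> W" "u \<noteq> 0" "L a u = z *\<^sub>C u" and g: "g \<in> W" "L a g \<noteq> z *\<^sub>C g" by blast
    define V where "V = {f \<in> W. L a f = z *\<^sub>C f}"
    interpret L: Vector_Spaces.linear scale scale "L b" for b by (rule L)
    have sub: "subspace V"
      using less.prems(1) unfolding subspace_def V_def by (auto simp: L.add L.scale scale_right_distrib scale_left_commute)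
    have "dim V < dim W"
    proof -
      obtain C where C: "C \<subseteq> V" "independent C" "V \<subseteq> span C" "card C = dim V" using basis_exists by metis
      have "C \<subseteq> span B" using C(1) less.prems(2) unfolding V_def by auto
      then have fC: "finite C" using independent_span_bound[OF B C(2)] by simp
      have "span C \<subseteq> V" using C(1) sub by (rule span_minimal)
      then have gC: "g \<notin> span C" using g unfolding V_def by auto
      obtain D where D: "D \<subseteq> W" "independent D" "W \<subseteq> span D" "card D = dim W" using basis_exists by metis
      have "D \<subseteq> span B" using D(1) less.prems(2) by auto
      then have fD: "finite D" using independent_span_bound[OF B D(2)] by simp
      have "card (insert g C) \<le> card D"
        using independent_span_bound[OF fD independent_insertI[OF gC C(2)]] C(1) D(3) g(1) unfolding V_def by auto
      moreover have "g \<notin> C" using gC span_base by blast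
      ultimately show ?thesis using fC C(4) D(4) by simp
    qed
    moreover have "V \<subseteq> span B" using less.prems(2) unfolding V_def by auto
    moreover have "L b f \<in> V" if "f \<in> V" for b f
      using that less.prems(3) comm[of a b f] unfolding V_def by (simp add: L.scale)
    moreover have "\<exists>f\<in>V. f \<noteq> 0" using u unfolding V_def by auto
    ultimately show ?thesis using less.hyps[of V] sub unfolding V_def by blast
  next
    case False
    have "\<exists>c. L a f = c *\<^sub>C f" for a
    proof -
      have orbit: "(L a ^^ i) f \<in> W" for i using f(1) less.prems(3) by (induction i) auto
      then have "(L a ^^ i) f \<in> span B" for i using less.prems(2) by (rule subsetD[rotated])
      from annihilating_polynomial[OF B this]
      obtain p where p: "p \<noteq> 0" "poly_op p (L a) f = 0" by auto
      from poly_op_eigenvector[OF L p f(2)]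
      obtain q z where qz: "poly_op q (L a) f \<noteq> 0" "L a (poly_op q (L a) f) = z *\<^sub>C poly_op q (L a) f"
        by auto
      have "poly_op q (L a) f \<in> W"
        unfolding poly_op_def using orbit less.prems(1) by (intro subspace_sum subspace_scale) auto
      with qz have "\<exists>u\<in>W. u \<noteq> 0 \<and> L a u = z *\<^sub>C u" by (intro bexI[of _ "poly_op q (L a) f"]) auto
      then have "\<forall>u\<in>W. L a u = z *\<^sub>C u" using False by metis
      then show ?thesis using f(1) by auto
    qed
    then show ?thesis using f by (intro bexI[of _ f]) auto
  qed
qed

end

section \<open>Spaces of complex functions and functionals over the rationals\<close>

definition fscale :: "'c::times \<Rightarrow> ('b \<Rightarrow> 'c) \<Rightarrow> 'b \<Rightarrow> 'c" where
  "fscale c f = (\<lambda>x. c * f x)"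

interpretation fun_space: complex_vector_space "fscale :: complex \<Rightarrow> ('b \<Rightarrow> complex) \<Rightarrow> 'b \<Rightarrow> complex"
  by unfold_locales (auto simp: fscale_def fun_eq_iff algebra_simps)

lemma sum_fun_apply: "(\<Sum>i\<in>S. f i) x = (\<Sum>i\<in>S. f i x)" for f :: "'i \<Rightarrow> 'b \<Rightarrow> 'c::comm_monoid_add"
  by (induction S rule: infinite_finite_induct) auto

text \<open>The coordinate of a in a Hamel basis of the complex numbers over the rationals that
  contains a.\<close>

lemma rational_functional:
  fixes a :: complex
  assumes "a \<noteq> 0"
  shows "\<exists>\<phi> :: complex \<Rightarrow> rat. (\<forall>x y. \<phi> (x + y) = \<phi> x + \<phi> y) \<and> (\<forall>q x. \<phi> (of_rat q * x) = q * \<phi> x) \<and> \<phi> a \<noteq> 0"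
proof -
  interpret vector_space "\<lambda>(q::rat) (x::complex). of_rat q * x"
    by unfold_locales (auto simp: of_rat_add of_rat_mult algebra_simps)
  have ind: "independent {a}" using assms by simp
  define E where "E = extend_basis {a}"
  have E: "independent E" "span E = UNIV" "a \<in> E"
    unfolding E_def using independent_extend_basis[OF ind] span_extend_basis[OF ind]
      extend_basis_superset[OF ind] by auto
  have "representation E (x + y) a = representation E x a + representation E y a" for x y
    using representation_add[OF E(1), of x y] E(2) by (simp add: add.commute)
  moreover have "representation E (of_rat q * x) a = q * representation E x a" for q x
    using representation_scale[OF E(1), of x q] E(2) by simp
  moreover have "representation E a a = 1"
    using representation_basis[OF E(1) E(3)] by simp
  ultimately show ?thesis by (intro exI[of _ "\<lambda>x. representation E x a"]) auto
qed

section \<open>Continuous functions on compact spaces\<close>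

lemma continuous_bounded_on_compact_space:
  fixes f :: "'a::topological_space \<Rightarrow> 'b::real_normed_vector"
  assumes "compact (UNIV :: 'a set)" "continuous_on UNIV f"
  shows "\<exists>B\<ge>0. \<forall>x. norm (f x) \<le> B"
proof -
  have "bounded (range f)" using assms by (intro compact_imp_bounded compact_continuous_image)
  then obtain B where "\<forall>x. norm (f x) \<le> B" unfolding bounded_iff by auto
  then show ?thesis by (intro exI[of _ "max B 0"]) (auto simp: max.coboundedI1)
qed

lemma integrable_continuous:
  fixes f :: "'a::topological_space \<Rightarrow> 'b::{banach, second_countable_topology}"
  assumes "compact (UNIV :: 'a set)" "finite_measure M" "sets M = sets borel" "continuous_on UNIV f"
  shows "integrable M f"
proof -
  obtain B where "\<forall>x. norm (f x) \<le> B" using continuous_bounded_on_compact_space[OF assms(1,4)] by auto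
  moreover have "f \<in> borel_measurable M"
    using borel_measurable_continuous_onI[OF assms(4)] measurable_cong_sets[OF assms(3) refl] by blast
  ultimately show ?thesis using assms(2)
    by (intro finite_measure.integrable_const_bound[of M f B]) auto
qed

lemma integral_close:
  fixes f g :: "'a \<Rightarrow> 'b::{banach, second_countable_topology}"
  assumes "finite_measure M" "integrable M f" "integrable M g" "\<And>x. norm (f x - g x) \<le> e"
  shows "norm (integral\<^sup>L M f - integral\<^sup>L M g) \<le> e * measure M (space M)"
proof -
  interpret finite_measure M by fact
  have "norm (integral\<^sup>L M f - integral\<^sup>L M g) = norm (\<integral>x. f x - g x \<partial>M)"
    using assms by simp
  also have "\<dots> \<le> (\<integral>x. norm (f x - g x) \<partial>M)" by (rule integral_norm_bound)
  also have "\<dots> \<le> (\<integral>x. e \<partial>M)" using assms by (intro integral_mono) auto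
  finally show ?thesis by (simp add: mult.commute)
qed

lemma continuous_on_section:
  assumes "continuous_on UNIV F"
  shows "continuous_on UNIV (\<lambda>y. F (x, y))" "continuous_on UNIV (\<lambda>x. F (x, y))"
  by (rule continuous_on_compose2[OF assms]; auto intro!: continuous_intros)+

text \<open>Compactness in the second variable makes \<open>F (x, y)\<close> uniformly close to
  \<open>F (x0, y)\<close> for x near x0, so that no domination argument is involved.\<close>

lemma continuous_on_parametric_integral:
  fixes F :: "'a::topological_space \<times> 'b::topological_space \<Rightarrow> 'c::{banach, second_countable_topology}"
  assumes N: "compact (UNIV :: 'b set)" "finite_measure N" "sets N = sets borel"
    and F: "continuous_on UNIV F"
  shows "continuous_on UNIV (\<lambda>x. \<integral>y. F (x, y) \<partial>N)"
  unfolding continuous_on_def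
proof (intro ballI tendstoI)
  fix x0 and e :: real assume e: "e > 0"
  let ?c = "measure N (space N)"
  have int: "integrable N (\<lambda>y. F (x, y))" for x
    by (rule integrable_continuous[OF N continuous_on_section(1)[OF F]])
  have F': "continuous_on (UNIV \<times> UNIV) F" using F by simp
  \<comment> \<open>The summand 1 keeps the denominator positive when N is the zero measure.\<close>
  have e': "e / (?c + 1) > 0" using e by (auto intro!: divide_pos_pos add_nonneg_pos)
  obtain X0 where X0: "x0 \<in> X0" "open X0" "\<forall>x\<in>X0 \<inter> UNIV. \<forall>t\<in>UNIV. dist (F (x, t)) (F (x0, t)) \<le> e / (?c + 1)"
    by (rule continuous_on_prod_compactE[OF F' N(1) UNIV_I e'])
  have "dist (\<integral>y. F (x, y) \<partial>N) (\<integral>y. F (x0, y) \<partial>N) < e" if "x \<in> X0" for x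
  proof -
    have "norm ((\<integral>y. F (x, y) \<partial>N) - (\<integral>y. F (x0, y) \<partial>N)) \<le> e / (?c + 1) * ?c"
      using X0(3) that by (intro integral_close[OF N(2) int int]) (auto simp: dist_norm)
    also have "\<dots> < e"
    proof -
      have "?c + 1 > 0" by (simp add: add_nonneg_pos)
      then show ?thesis using e by (simp add: field_simps)
    qed
    finally show ?thesis by (simp add: dist_norm)
  qed
  then show "\<forall>\<^sub>F x in at x0 within UNIV. dist (\<integral>y. F (x, y) \<partial>N) (\<integral>y. F (x0, y) \<partial>N) < e"
    using X0(1,2) unfolding eventually_at_topological by auto
qed

lemma compact_space_Urysohn:
  fixes K U :: "'a::t2_space set"
  assumes "compact (UNIV :: 'a set)" "closed K" "open U" "K \<subseteq> U"
  shows "\<exists>h :: 'a \<Rightarrow> real. continuous_on UNIV h \<and> (\<forall>x. 0 \<le> h x \<and> h x \<le> 1) \<and>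
    (\<forall>x\<in>K. h x = 1) \<and> (\<forall>x. x \<notin> U \<longrightarrow> h x = 0)"
proof -
  have "normal_space (euclidean :: 'a topology)"
    using assms(1) separation_t2[where 'a = 'a]
    by (intro compact_Hausdorff_or_regular_imp_normal_space disjI1)
      (auto simp: compact_space_def Hausdorff_space_def disjnt_def)
  moreover have "closedin euclidean (- U)" "closedin euclidean K" "disjnt (- U) K"
    using assms by (auto simp: disjnt_def)
  ultimately obtain h where "continuous_map euclidean (top_of_set {0..1::real}) h"
    "h ` (- U) \<subseteq> {0}" "h ` K \<subseteq> {1}"
    using Urysohn_lemma[of euclidean "- U" K 0 "1::real"] by auto
  then show ?thesis
    by (intro exI[of _ h]) (auto simp: continuous_map_in_subtopology)
qed

section \<open>Interchanging integrals of continuous functions\<close>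

inductive_set tensor_functions :: "('a::topological_space \<times> 'b::topological_space \<Rightarrow> real) set" where
  tensor: "continuous_on UNIV f \<Longrightarrow> continuous_on UNIV g \<Longrightarrow> (\<lambda>z. f (fst z) * g (snd z)) \<in> tensor_functions"
| tensor_add: "F \<in> tensor_functions \<Longrightarrow> G \<in> tensor_functions \<Longrightarrow> (\<lambda>z. F z + G z) \<in> tensor_functions"

lemma tensor_functions_continuous: "F \<in> tensor_functions \<Longrightarrow> continuous_on UNIV F"
  by (induction rule: tensor_functions.induct)
    (auto intro!: continuous_intros elim: continuous_on_compose2)

lemma tensor_functions_mult:
  assumes "F \<in> tensor_functions" "G \<in> tensor_functions"
  shows "(\<lambda>z. F z * G z) \<in> tensor_functions"
  using assms(1)
proof (induction rule: tensor_functions.induct)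
  case (tensor f g)
  show ?case using assms(2)
  proof (induction rule: tensor_functions.induct)
    case (tensor f' g')
    have "(\<lambda>z. (f (fst z) * f' (fst z)) * (g (snd z) * g' (snd z))) \<in> tensor_functions"
      using tensor \<open>continuous_on UNIV f\<close> \<open>continuous_on UNIV g\<close>
      by (intro tensor_functions.tensor continuous_on_mult)
    then show ?case by (simp add: mult_ac)
  next
    case (tensor_add F G)
    then show ?case
      using tensor_functions.tensor_add[OF tensor_add.IH] by (simp add: distrib_left)
  qed
next
  case (tensor_add F1 F2)
  then show ?case
    using tensor_functions.tensor_add[OF tensor_add.IH] by (simp add: distrib_right)
qed

text \<open>On non-metrizable spaces a continuous function on the product need not be measurable for
  the product \<open>\<sigma>\<close>-algebra; Stone--Weierstrass replaces the Fubini theorem of the library.\<close>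

lemma Fubini_continuous:
  fixes F :: "'a::t2_space \<times> 'b::t2_space \<Rightarrow> real"
  assumes M: "compact (UNIV :: 'a set)" "finite_measure M" "sets M = sets borel"
    and N: "compact (UNIV :: 'b set)" "finite_measure N" "sets N = sets borel"
    and F: "continuous_on UNIV F"
  shows "(\<integral>x. (\<integral>y. F (x, y) \<partial>N) \<partial>M) = (\<integral>y. (\<integral>x. F (x, y) \<partial>M) \<partial>N)"
proof -
  define I1 where "I1 F = (\<integral>x. (\<integral>y. F (x, y) \<partial>N) \<partial>M)" for F :: "'a \<times> 'b \<Rightarrow> real"
  define I2 where "I2 F = (\<integral>y. (\<integral>x. F (x, y) \<partial>M) \<partial>N)" for F :: "'a \<times> 'b \<Rightarrow> real"
  have swap: "continuous_on UNIV (\<lambda>z. F (snd z, fst z))" if "continuous_on UNIV F" for F :: "'a \<times> 'b \<Rightarrow> real"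
    by (rule continuous_on_compose2[OF that]) (auto intro!: continuous_intros)
  have in1: "integrable N (\<lambda>y. F (x, y))" if "continuous_on UNIV F" for F :: "'a \<times> 'b \<Rightarrow> real" and x
    by (rule integrable_continuous[OF N continuous_on_section(1)[OF that]])
  have in2: "integrable M (\<lambda>x. F (x, y))" if "continuous_on UNIV F" for F :: "'a \<times> 'b \<Rightarrow> real" and y
    by (rule integrable_continuous[OF M continuous_on_section(2)[OF that]])
  have out1: "integrable M (\<lambda>x. \<integral>y. F (x, y) \<partial>N)" if "continuous_on UNIV F" for F :: "'a \<times> 'b \<Rightarrow> real"
    by (rule integrable_continuous[OF M continuous_on_parametric_integral[OF N that]])
  have out2: "integrable N (\<lambda>y. \<integral>x. F (x, y) \<partial>M)" if "continuous_on UNIV F" for F :: "'a \<times> 'b \<Rightarrow> real"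
    using integrable_continuous[OF N continuous_on_parametric_integral[OF M swap[OF that]]] by simp
  let ?m = "measure M (space M)" and ?n = "measure N (space N)"
  have eq: "I1 G = I2 G" if "G \<in> tensor_functions" for G
    using that
  proof (induction rule: tensor_functions.induct)
    case (tensor f g)
    then show ?case unfolding I1_def I2_def by simp
  next
    case (tensor_add F G)
    then have c: "continuous_on UNIV F" "continuous_on UNIV G" using tensor_functions_continuous by auto
    show ?case using tensor_add.IH c unfolding I1_def I2_def by (simp add: in1 in2 out1 out2)
  qed
  have "\<bar>I1 F - I2 F\<bar> \<le> e" if e: "e > 0" for e
  proof -
    \<comment> \<open>Approximating F by G costs at most \<open>e' * ?m * ?n\<close> in each of the
      two iterated integrals; the summand 1 again excludes a zero denominator.\<close>
    define e' where "e' = e / (2 * (?m * ?n + 1))"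
    have mn: "?m * ?n \<ge> 0" by simp
    have e': "e' > 0" unfolding e'_def using e mn by (intro divide_pos_pos mult_pos_pos add_nonneg_pos) auto
    interpret function_ring_on "tensor_functions :: ('a \<times> 'b \<Rightarrow> real) set" UNIV
    proof
      show "compact (UNIV :: ('a \<times> 'b) set)" using compact_Times[OF M(1) N(1)] by simp
      show "(\<lambda>_. c) \<in> tensor_functions" for c :: real
        using tensor_functions.tensor[of "\<lambda>_. c" "\<lambda>_. 1"] by simp
      fix z w :: "'a \<times> 'b" assume "z \<noteq> w"
      then consider "fst z \<noteq> fst w" | "snd z \<noteq> snd w" by (auto simp: prod_eq_iff)
      then show "\<exists>f\<in>tensor_functions. f z \<noteq> f w"
      proof cases
        case 1
        obtain h :: "'a \<Rightarrow> real" where "continuous_on UNIV h" "\<forall>x\<in>{fst z}. h x = 1" "\<forall>x. x \<notin> - {fst w} \<longrightarrow> h x = 0"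
          using compact_space_Urysohn[OF M(1), of "{fst z}" "- {fst w}"] 1 by auto
        then show ?thesis using tensor_functions.tensor[of h "\<lambda>_. 1"] by (intro bexI[of _ "\<lambda>z. h (fst z)"]) auto
      next
        case 2
        obtain h :: "'b \<Rightarrow> real" where "continuous_on UNIV h" "\<forall>x\<in>{snd z}. h x = 1" "\<forall>x. x \<notin> - {snd w} \<longrightarrow> h x = 0"
          using compact_space_Urysohn[OF N(1), of "{snd z}" "- {snd w}"] 2 by auto
        then show ?thesis using tensor_functions.tensor[of "\<lambda>_. 1" h] by (intro bexI[of _ "\<lambda>z. h (snd z)"]) auto
      qed
    qed (auto intro: tensor_functions_continuous tensor_functions.tensor_add tensor_functions_mult)
    obtain G where G: "G \<in> tensor_functions" "\<forall>z. \<bar>F z - G z\<bar> < e'"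
      using Stone_Weierstrass_basic[OF F e'] by auto
    have cG: "continuous_on UNIV G" using G(1) by (rule tensor_functions_continuous)
    have "norm (I1 F - I1 G) \<le> (e' * ?n) * ?m"
      unfolding I1_def
    proof (rule integral_close[OF M(2) out1[OF F] out1[OF cG]])
      show "norm ((\<integral>y. F (x, y) \<partial>N) - (\<integral>y. G (x, y) \<partial>N)) \<le> e' * ?n" for x
        using G(2) by (intro integral_close[OF N(2) in1[OF F] in1[OF cG]]) (auto intro: less_imp_le)
    qed
    moreover have "norm (I2 F - I2 G) \<le> (e' * ?m) * ?n"
      unfolding I2_def
    proof (rule integral_close[OF N(2) out2[OF F] out2[OF cG]])
      show "norm ((\<integral>x. F (x, y) \<partial>M) - (\<integral>x. G (x, y) \<partial>M)) \<le> e' * ?m" for y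
        using G(2) by (intro integral_close[OF M(2) in2[OF F] in2[OF cG]]) (auto intro: less_imp_le)
    qed
    ultimately have "\<bar>I1 F - I2 F\<bar> \<le> 2 * e' * (?m * ?n)"
      using eq[OF G(1)] by (simp add: mult_ac)
    also have "\<dots> \<le> 2 * e' * (?m * ?n + 1)" using e' by simp
    also have "\<dots> = e" unfolding e'_def using mn by (simp add: field_simps add_nonneg_eq_0_iff)
    finally show ?thesis .
  qed
  then have "\<bar>I1 F - I2 F\<bar> \<le> 0" by (rule field_le_epsilon) simp
  then show ?thesis unfolding I1_def I2_def by simp
qed

section \<open>Characters of compact abelian groups separate points\<close>

locale compact_haar =
  fixes m :: "'a::{topological_ab_group_add, t2_space} measure"
  assumes compact_UNIV: "compact (UNIV :: 'a set)" and haar: "normalized_haar_measure m"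
begin

section \<open>Invariance and positivity of Haar measure\<close>

lemma sets_m [simp, measurable_cong]: "sets m = sets borel"
  using haar unfolding normalized_haar_measure_def by simp

lemma space_m [simp]: "space m = UNIV"
  using sets_eq_imp_space_eq[OF sets_m] by simp

lemma emeasure_UNIV [simp]: "emeasure m UNIV = 1"
  using haar unfolding normalized_haar_measure_def by simp

sublocale finite_measure m
  by (intro finite_measureI) simp

lemma measure_UNIV [simp]: "measure m UNIV = 1"
  by (simp add: measure_def)

lemmas m_facts = compact_UNIV finite_measure_axioms sets_m

lemma integrable_cont [intro]:
  fixes f :: "'a \<Rightarrow> 'b::{banach, second_countable_topology}"
  shows "continuous_on UNIV f \<Longrightarrow> integrable m f"
  by (rule integrable_continuous[OF m_facts])

lemma continuous_translate: "continuous_on UNIV f \<Longrightarrow> continuous_on UNIV (\<lambda>x::'a. f (a + x))"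
  by (rule continuous_on_compose2[of UNIV]) (auto intro!: continuous_intros)

lemma measurable_translate: "(\<lambda>x. a + x) \<in> measurable m m"
  unfolding measurable_cong_sets[OF sets_m sets_m]
  by (intro borel_measurable_continuous_onI continuous_intros)

lemma haar_translate: "B \<in> sets borel \<Longrightarrow> emeasure m ((\<lambda>y. x + y) ` B) = emeasure m B"
  using haar unfolding normalized_haar_measure_def by blast

lemma distr_translate: "distr m m (\<lambda>x. a + x) = m"
proof (rule measure_eqI)
  fix B assume "B \<in> sets (distr m m (\<lambda>x. a + x))"
  then have B: "B \<in> sets borel" by simp
  have "(\<lambda>x. a + x) -` B = (\<lambda>y. - a + y) ` B"
    by (auto simp: image_iff intro!: bexI[of _ "a + _"])
  then have "emeasure m ((\<lambda>x. a + x) -` B) = emeasure m B"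
    by (simp only: haar_translate[OF B])
  then show "emeasure (distr m m (\<lambda>x. a + x)) B = emeasure m B"
    using B by (simp add: emeasure_distr[OF measurable_translate])
qed simp

lemma integral_translate:
  fixes f :: "'a \<Rightarrow> 'b::{banach, second_countable_topology}"
  assumes "f \<in> borel_measurable m"
  shows "(\<integral>x. f (a + x) \<partial>m) = (\<integral>x. f x \<partial>m)"
  using integral_distr[OF measurable_translate assms, of a] by (simp add: distr_translate)

lemma measurable_cont:
  fixes f :: "'a \<Rightarrow> 'b::{banach, second_countable_topology}"
  shows "continuous_on UNIV f \<Longrightarrow> f \<in> borel_measurable m"
  by (intro borel_measurable_integrable integrable_cont)

lemma integral_translate_cont:
  fixes f :: "'a \<Rightarrow> 'b::{banach, second_countable_topology}"
  shows "continuous_on UNIV f \<Longrightarrow> (\<integral>x. f (a + x) \<partial>m) = (\<integral>x. f x \<partial>m)"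
  by (intro integral_translate measurable_cont)

text \<open>Finitely many translates of U cover the compact group; if U were null, so would be the
  whole group.\<close>

lemma open_measure_pos:
  assumes "open U" "U \<noteq> {}"
  shows "measure m U > 0"
proof (rule ccontr)
  assume "\<not> measure m U > 0"
  then have 0: "emeasure m U = 0" by (simp add: emeasure_eq_measure zero_less_measure_iff measure_nonneg not_less measure_le_0_iff)
  obtain x where x: "x \<in> U" using assms by auto
  let ?V = "\<lambda>a. (\<lambda>y. a + y) -` U"
  have V: "open (?V a)" for a using assms(1) by (intro open_vimage) (auto intro!: continuous_intros)
  have "UNIV \<subseteq> (\<Union>a\<in>UNIV. ?V a)"
  proof
    fix z show "z \<in> (\<Union>a\<in>UNIV. ?V a)" using x by (intro UN_I[of "x - z"]) auto
  qed
  then obtain C where C: "finite C" "UNIV \<subseteq> (\<Union>a\<in>C. ?V a)"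
    using compactE_image[OF compact_UNIV, of UNIV ?V] V by (metis (no_types, lifting))
  have "emeasure m (?V a) = 0" for a
    using emeasure_distr[OF measurable_translate, of U a] 0 assms(1) by (simp add: distr_translate)
  then have "?V a \<in> null_sets m" for a using V[of a] by (auto intro!: null_setsI)
  then have "(\<Union>a\<in>C. ?V a) \<in> null_sets m" using C(1) by (intro null_sets_UN') (auto intro: countable_finite)
  then have "UNIV \<in> null_sets m" using C(2) by (metis top.extremum_uniqueI)
  then show False by auto
qed

lemma integral_cont_pos:
  fixes f :: "'a \<Rightarrow> real"
  assumes f: "continuous_on UNIV f" "\<And>x. f x \<ge> 0" "f x0 > 0"
  shows "(\<integral>x. f x \<partial>m) > 0"
proof -
  let ?U = "{x. f x > f x0 / 2}"
  have U: "open ?U" "?U \<noteq> {}"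
    using f open_Collect_less[of "\<lambda>_. f x0 / 2" f] by (auto intro!: exI[of _ x0])
  have "0 < f x0 / 2 * measure m ?U" using open_measure_pos[OF U] f(3) by simp
  also have "\<dots> = (\<integral>x. f x0 / 2 * indicator ?U x \<partial>m)" using U(1) by simp
  also have "\<dots> \<le> (\<integral>x. f x \<partial>m)"
  proof (rule integral_mono)
    show "integrable m (\<lambda>x. f x0 / 2 * indicat_real ?U x)"
      using U(1) by (intro integrable_mult_right) (auto simp: emeasure_eq_measure intro!: integrable_real_indicator)
    show "f x0 / 2 * indicat_real ?U x \<le> f x" for x
      using f(2)[of x] by (auto simp: indicator_def)
  qed (use f in auto)
  finally show ?thesis .
qed


section \<open>The inner product of continuous functions\<close>

text \<open>The \<open>L2\<close> inner product, taken on real functions; characters enter through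
  their real and imaginary parts. Used on continuous functions it is definite, so no quotient by
  null functions is formed.\<close>

definition ip :: "('a \<Rightarrow> real) \<Rightarrow> ('a \<Rightarrow> real) \<Rightarrow> real" where
  "ip f g = (\<integral>x. f x * g x \<partial>m)"

lemma ip_commute: "ip f g = ip g f"
  unfolding ip_def by (simp add: mult.commute)

lemma integrable_mult_cont:
  fixes f g :: "'a \<Rightarrow> real"
  shows "continuous_on UNIV f \<Longrightarrow> continuous_on UNIV g \<Longrightarrow> integrable m (\<lambda>x. f x * g x)"
  by (intro integrable_cont continuous_intros)

lemma ip_add:
  assumes "continuous_on UNIV f" "continuous_on UNIV g" "continuous_on UNIV h"
  shows "ip (\<lambda>x. f x + g x) h = ip f h + ip g h"
  unfolding ip_def using assms by (simp add: distrib_right integrable_mult_cont)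

lemma ip_diff:
  assumes "continuous_on UNIV f" "continuous_on UNIV g" "continuous_on UNIV h"
  shows "ip (\<lambda>x. f x - g x) h = ip f h - ip g h"
  unfolding ip_def using assms by (simp add: left_diff_distrib integrable_mult_cont)

lemma ip_scale: "ip (\<lambda>x. c * f x) h = c * ip f h"
  unfolding ip_def by (simp add: mult.assoc)

lemma ip_scale_right: "ip h (\<lambda>x. c * f x) = c * ip h f"
  unfolding ip_def by (simp add: mult.left_commute)

lemma ip_diff_right:
  assumes "continuous_on UNIV f" "continuous_on UNIV g" "continuous_on UNIV h"
  shows "ip h (\<lambda>x. f x - g x) = ip h f - ip h g"
  unfolding ip_def using assms by (simp add: right_diff_distrib integrable_mult_cont)

lemma ip_lincomb:
  assumes "continuous_on UNIV f" "continuous_on UNIV g" "continuous_on UNIV h"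
  shows "ip (\<lambda>x. a * f x + b * g x) h = a * ip f h + b * ip g h"
  unfolding ip_def using assms by (simp add: distrib_right mult.assoc integrable_mult_cont)

lemma ip_sum:
  assumes "\<And>e. e \<in> S \<Longrightarrow> continuous_on UNIV (f e)" "continuous_on UNIV h"
  shows "ip (\<lambda>x. \<Sum>e\<in>S. f e x) h = (\<Sum>e\<in>S. ip (f e) h)"
proof (cases "finite S")
  case True
  then show ?thesis using assms(1)
  proof (induction S)
    case (insert e S)
    then show ?case by (simp add: ip_add assms(2) continuous_on_sum)
  qed (simp add: ip_def)
qed (simp add: ip_def)

lemma ip_nonneg: "ip f f \<ge> 0"
  unfolding ip_def by simp

lemma ip_self_pos:
  assumes "continuous_on UNIV f" "f x \<noteq> 0"
  shows "ip f f > 0"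
  unfolding ip_def using assms by (intro integral_cont_pos[where ?x0.0 = x] continuous_intros) (auto simp: zero_less_mult_iff linorder_neq_iff)

text \<open>The variance of \<bar>f\<bar> under a probability measure is nonnegative.\<close>

lemma abs_integral_le_sqrt_ip:
  assumes f: "continuous_on UNIV f"
  shows "(\<integral>x. \<bar>f x\<bar> \<partial>m) \<le> sqrt (ip f f)"
proof -
  let ?c = "\<integral>x. \<bar>f x\<bar> \<partial>m"
  have i: "integrable m (\<lambda>x. \<bar>f x\<bar>)" "integrable m (\<lambda>x. f x * f x)"
    using f by (auto intro!: integrable_cont continuous_intros)
  have "0 \<le> (\<integral>x. (\<bar>f x\<bar> - ?c)\<^sup>2 \<partial>m)" by simp
  also have "\<dots> = (\<integral>x. f x * f x - 2 * ?c * \<bar>f x\<bar> + ?c\<^sup>2 \<partial>m)"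
    by (intro Bochner_Integration.integral_cong) (auto simp: power2_eq_square algebra_simps)
  also have "\<dots> = ip f f - ?c\<^sup>2"
    using i by (simp add: ip_def power2_eq_square)
  finally show ?thesis by (simp add: real_le_rsqrt)
qed

lemma integral_mult_bound:
  assumes f: "continuous_on UNIV f" and g: "continuous_on UNIV g" "\<And>x. \<bar>g x\<bar> \<le> e"
  shows "\<bar>\<integral>x. g x * f x \<partial>m\<bar> \<le> e * sqrt (ip f f)"
proof -
  have e: "e \<ge> 0" using g(2) abs_ge_zero order_trans by blast
  have "\<bar>\<integral>x. g x * f x \<partial>m\<bar> \<le> (\<integral>x. \<bar>g x * f x\<bar> \<partial>m)"
    by (rule integral_abs_bound)
  also have "\<dots> \<le> (\<integral>x. e * \<bar>f x\<bar> \<partial>m)"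
    using f g by (intro integral_mono integrable_cont continuous_intros) (auto simp: abs_mult intro: mult_right_mono)
  also have "\<dots> \<le> e * sqrt (ip f f)"
    using abs_integral_le_sqrt_ip[OF f] e by (simp add: mult_left_mono)
  finally show ?thesis .
qed

lemma integral_uniform_limit:
  fixes h :: "nat \<Rightarrow> 'a \<Rightarrow> real"
  assumes "uniform_limit UNIV h g sequentially" "\<And>n. continuous_on UNIV (h n)" "continuous_on UNIV g"
  shows "(\<lambda>n. \<integral>x. h n x \<partial>m) \<longlonglongrightarrow> (\<integral>x. g x \<partial>m)"
proof (rule tendstoI)
  fix e :: real assume e: "e > 0"
  have "\<forall>\<^sub>F n in sequentially. \<forall>x\<in>UNIV. dist (h n x) (g x) < e / 2"
    using uniform_limitD[OF assms(1), of "e / 2"] e by simp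
  then show "\<forall>\<^sub>F n in sequentially. dist (\<integral>x. h n x \<partial>m) (\<integral>x. g x \<partial>m) < e"
  proof eventually_elim
    case (elim n)
    have "norm ((\<integral>x. h n x \<partial>m) - (\<integral>x. g x \<partial>m)) \<le> e / 2 * measure m (space m)"
      using elim assms by (intro integral_close integrable_cont) (auto simp: dist_norm finite_measure_axioms intro: less_imp_le)
    then show ?case using e by (simp add: dist_norm)
  qed
qed

lemma ip_uniform_limit:
  assumes "uniform_limit UNIV h g sequentially" "\<And>n. continuous_on UNIV (h n)" "continuous_on UNIV g"
    and "uniform_limit UNIV h' g' sequentially" "\<And>n. continuous_on UNIV (h' n)" "continuous_on UNIV g'"
  shows "(\<lambda>n. ip (h n) (h' n)) \<longlonglongrightarrow> ip g g'"
  unfolding ip_def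
proof (rule integral_uniform_limit)
  have "bounded (range g)" "bounded (range g')"
    using assms compact_UNIV by (auto intro!: compact_imp_bounded compact_continuous_image)
  then show "uniform_limit UNIV (\<lambda>n x. h n x * h' n x) (\<lambda>x. g x * g' x) sequentially"
    by (intro uniform_lim_mult assms)
qed (intro continuous_intros assms)+

section \<open>Convolution operators\<close>

definition conv :: "('a \<Rightarrow> real) \<Rightarrow> ('a \<Rightarrow> real) \<Rightarrow> 'a \<Rightarrow> real" where
  "conv \<phi> f x = (\<integral>y. \<phi> (x - y) * f y \<partial>m)"

lemma continuous_reflect: "continuous_on UNIV \<phi> \<Longrightarrow> continuous_on UNIV (\<lambda>y. \<phi> (x - y :: 'a))"
  by (rule continuous_on_compose2[of UNIV]) (auto intro!: continuous_intros)

lemma conv_kernel_cont: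
  fixes \<phi> f :: "'a \<Rightarrow> real"
  assumes "continuous_on UNIV \<phi>" "continuous_on UNIV f"
  shows "continuous_on UNIV (\<lambda>z. \<phi> (fst z - snd z) * f (snd z))"
  by (intro continuous_on_mult continuous_on_compose2[OF assms(1)] continuous_on_compose2[OF assms(2)])
    (auto intro!: continuous_intros)

lemma conv_cont:
  assumes "continuous_on UNIV \<phi>" "continuous_on UNIV f"
  shows "continuous_on UNIV (conv \<phi> f)"
  using continuous_on_parametric_integral[OF m_facts conv_kernel_cont[OF assms]]
  unfolding conv_def[abs_def] by simp

lemma conv_bound:
  assumes "continuous_on UNIV \<phi>" "continuous_on UNIV f" "\<And>x. \<bar>\<phi> x\<bar> \<le> C"
  shows "\<bar>conv \<phi> f x\<bar> \<le> C * sqrt (ip f f)"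
  unfolding conv_def using assms by (intro integral_mult_bound continuous_reflect)

lemma conv_diff_bound:
  assumes "continuous_on UNIV \<phi>" "continuous_on UNIV f" "\<And>t. \<bar>\<phi> (x - t) - \<phi> (x' - t)\<bar> \<le> e"
  shows "\<bar>conv \<phi> f x - conv \<phi> f x'\<bar> \<le> e * sqrt (ip f f)"
proof -
  have "conv \<phi> f x - conv \<phi> f x' = (\<integral>y. (\<phi> (x - y) - \<phi> (x' - y)) * f y \<partial>m)"
    unfolding conv_def using assms
    by (simp add: left_diff_distrib integrable_mult_cont continuous_reflect)
  then show ?thesis
    using assms integral_mult_bound[of f "\<lambda>y. \<phi> (x - y) - \<phi> (x' - y)" e]
    by (simp add: continuous_reflect continuous_on_diff)
qed

text \<open>Evenness of \<phi> makes the kernel \<open>\<phi> (x - y)\<close> symmetric, and the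
  integrals may be interchanged.\<close>

lemma conv_self_adjoint:
  assumes "continuous_on UNIV \<phi>" "\<And>x. \<phi> (- x) = \<phi> x" "continuous_on UNIV f" "continuous_on UNIV g"
  shows "ip (conv \<phi> f) g = ip f (conv \<phi> g)"
proof -
  let ?F = "\<lambda>z::'a \<times> 'a. \<phi> (fst z - snd z) * f (snd z) * g (fst z)"
  have F: "continuous_on UNIV ?F"
    by (intro continuous_on_mult[OF conv_kernel_cont] assms continuous_on_compose2[OF assms(4)])
      (auto intro!: continuous_intros)
  have "ip (conv \<phi> f) g = (\<integral>x. (\<integral>y. ?F (x, y) \<partial>m) \<partial>m)"
    unfolding ip_def conv_def by simp
  also have "\<dots> = (\<integral>y. (\<integral>x. ?F (x, y) \<partial>m) \<partial>m)"
    by (rule Fubini_continuous[OF m_facts m_facts F])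
  also have "\<dots> = (\<integral>y. (\<integral>x. f y * (\<phi> (y - x) * g x) \<partial>m) \<partial>m)"
  proof -
    have "\<phi> (x - y) = \<phi> (y - x)" for x y using assms(2)[of "x - y"] by simp
    then show ?thesis by (simp add: mult_ac)
  qed
  also have "\<dots> = ip f (conv \<phi> g)"
    unfolding ip_def conv_def by simp
  finally show ?thesis .
qed

text \<open>Substituting \<open>a + y\<close> in the integral leaves the argument of the kernel
  unchanged. This commutation makes the eigenspaces of convolution translation invariant.\<close>

lemma conv_translate:
  assumes "continuous_on UNIV \<phi>" "continuous_on UNIV f"
  shows "conv \<phi> (\<lambda>y. f (a + y)) x = conv \<phi> f (a + x)"
proof -
  have "conv \<phi> f (a + x) = (\<integral>y. \<phi> (a + x - (a + y)) * f (a + y) \<partial>m)"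
    unfolding conv_def
    by (rule integral_translate_cont[symmetric]) (intro continuous_on_mult continuous_reflect assms)
  then show ?thesis by (simp add: conv_def)
qed

lemma conv_add:
  assumes "continuous_on UNIV \<phi>" "continuous_on UNIV f" "continuous_on UNIV g"
  shows "conv \<phi> (\<lambda>x. f x + g x) x = conv \<phi> f x + conv \<phi> g x"
  unfolding conv_def using assms by (simp add: distrib_left integrable_mult_cont continuous_reflect)

lemma conv_scale: "conv \<phi> (\<lambda>x. c * f x) x = c * conv \<phi> f x"
  unfolding conv_def by (simp add: mult.left_commute)

lemma conv_diff:
  assumes "continuous_on UNIV \<phi>" "continuous_on UNIV f" "continuous_on UNIV g"
  shows "conv \<phi> (\<lambda>x. f x - g x) x = conv \<phi> f x - conv \<phi> g x"
  unfolding conv_def using assms by (simp add: right_diff_distrib integrable_mult_cont continuous_reflect)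

section \<open>Functions orthogonal to all characters\<close>

definition perp :: "('a \<Rightarrow> real) \<Rightarrow> bool" where
  "perp f \<longleftrightarrow> (\<forall>\<chi>\<in>characters. ip f (\<lambda>x. Re (\<chi> x)) = 0 \<and> ip f (\<lambda>x. Im (\<chi> x)) = 0)"

lemma characters_cont:
  "\<chi> \<in> characters \<Longrightarrow> continuous_on UNIV \<chi>"
  "\<chi> \<in> characters \<Longrightarrow> continuous_on UNIV (\<lambda>x. Re (\<chi> x))"
  "\<chi> \<in> characters \<Longrightarrow> continuous_on UNIV (\<lambda>x. Im (\<chi> x))"
  by (auto simp: characters_def intro!: continuous_intros)

lemma perp_lincomb:
  assumes "continuous_on UNIV f" "perp f" "continuous_on UNIV g" "perp g"
  shows "perp (\<lambda>x. a * f x + b * g x)"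
  using assms unfolding perp_def by (simp add: ip_lincomb characters_cont)

lemma perp_scale: "perp f \<Longrightarrow> perp (\<lambda>x. c * f x)"
  unfolding perp_def by (simp add: ip_scale)

text \<open>The translation moves over to \<chi>, which is only multiplied by the constant
  \<open>\<chi> (- a)\<close>. Its real and imaginary parts get mixed, but the products of both with
  f are zero.\<close>

lemma perp_translate:
  assumes f: "continuous_on UNIV f" "perp f"
  shows "perp (\<lambda>x. f (a + x))"
  unfolding perp_def
proof
  fix \<chi> :: "'a \<Rightarrow> complex" assume c: "\<chi> \<in> characters"
  have mult: "\<chi> (- a + x) = \<chi> (- a) * \<chi> x" for x using c unfolding characters_def by blast
  have tr: "ip (\<lambda>x. f (a + x)) u = ip f (\<lambda>x. u (- a + x))" if "continuous_on UNIV u" for u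
  proof -
    have "ip f (\<lambda>x. u (- a + x)) = (\<integral>x. f (a + x) * u (- a + (a + x)) \<partial>m)"
      unfolding ip_def
      by (rule integral_translate_cont[symmetric]) (intro continuous_on_mult f continuous_translate that)
    then show ?thesis by (simp add: ip_def flip: add.assoc)
  qed
  have z: "ip (\<lambda>x. Re (\<chi> x)) f = 0" "ip (\<lambda>x. Im (\<chi> x)) f = 0"
    using f c unfolding perp_def ip_commute[of _ f] by auto
  have "ip f (\<lambda>x. Re (\<chi> (- a + x))) = 0"
    unfolding mult ip_commute[of f] using z characters_cont[OF c] f
    by (simp add: ip_diff ip_scale continuous_on_mult_left)
  moreover have "ip f (\<lambda>x. Im (\<chi> (- a + x))) = 0"
    unfolding mult ip_commute[of f] using z characters_cont[OF c] f
    by (simp add: ip_add ip_scale continuous_on_mult_left)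
  ultimately show "ip (\<lambda>x. f (a + x)) (\<lambda>x. Re (\<chi> x)) = 0 \<and> ip (\<lambda>x. f (a + x)) (\<lambda>x. Im (\<chi> x)) = 0"
    by (simp only: tr[OF characters_cont(2)[OF c]] tr[OF characters_cont(3)[OF c]])
qed

text \<open>Every character is an eigenfunction of convolution, and convolution is
  self-adjoint.\<close>

lemma perp_conv:
  assumes p: "continuous_on UNIV \<phi>" "\<And>x. \<phi> (- x) = \<phi> x" and f: "continuous_on UNIV f" "perp f"
  shows "perp (conv \<phi> f)"
  unfolding perp_def
proof
  fix \<chi> :: "'a \<Rightarrow> complex" assume c: "\<chi> \<in> characters"
  have mult: "\<chi> (x + y) = \<chi> x * \<chi> y" for x y using c unfolding characters_def by blast
  note cc = characters_cont[OF c]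
  \<comment> \<open>In complex notation the eigenvalue on \<chi> is \<alpha> + i \<beta>; the
    identities \<open>re\<close> and \<open>im\<close> below are its real and imaginary
    parts.\<close>
  define \<alpha> where "\<alpha> = (\<integral>y. \<phi> y * Re (\<chi> y) \<partial>m)"
  define \<beta> where "\<beta> = (\<integral>y. \<phi> y * Im (\<chi> y) \<partial>m)"
  have sh: "conv \<phi> u x = (\<integral>y. \<phi> y * u (x + y) \<partial>m)" if "continuous_on UNIV u" for u x
  proof -
    have "conv \<phi> u x = (\<integral>y. \<phi> (x - (x + y)) * u (x + y) \<partial>m)"
      unfolding conv_def
      by (rule integral_translate_cont[symmetric]) (intro continuous_on_mult continuous_reflect p that)
    then show ?thesis by (simp add: p(2))
  qed
  have i: "integrable m (\<lambda>y. \<phi> y * Re (\<chi> y))" "integrable m (\<lambda>y. \<phi> y * Im (\<chi> y))"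
    using p cc by (auto intro: integrable_mult_cont)
  have re: "conv \<phi> (\<lambda>x. Re (\<chi> x)) = (\<lambda>x. \<alpha> * Re (\<chi> x) - \<beta> * Im (\<chi> x))"
  proof
    fix x
    have "conv \<phi> (\<lambda>x. Re (\<chi> x)) x = (\<integral>y. Re (\<chi> x) * (\<phi> y * Re (\<chi> y)) - Im (\<chi> x) * (\<phi> y * Im (\<chi> y)) \<partial>m)"
      unfolding sh[OF cc(2)] mult by (simp add: algebra_simps)
    then show "conv \<phi> (\<lambda>x. Re (\<chi> x)) x = \<alpha> * Re (\<chi> x) - \<beta> * Im (\<chi> x)"
      using i unfolding \<alpha>_def \<beta>_def by simp
  qed
  have im: "conv \<phi> (\<lambda>x. Im (\<chi> x)) = (\<lambda>x. \<alpha> * Im (\<chi> x) + \<beta> * Re (\<chi> x))"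
  proof
    fix x
    have "conv \<phi> (\<lambda>x. Im (\<chi> x)) x = (\<integral>y. Im (\<chi> x) * (\<phi> y * Re (\<chi> y)) + Re (\<chi> x) * (\<phi> y * Im (\<chi> y)) \<partial>m)"
      unfolding sh[OF cc(3)] mult by (simp add: algebra_simps)
    then show "conv \<phi> (\<lambda>x. Im (\<chi> x)) x = \<alpha> * Im (\<chi> x) + \<beta> * Re (\<chi> x)"
      using i unfolding \<alpha>_def \<beta>_def by simp
  qed
  have z: "ip (\<lambda>x. Re (\<chi> x)) f = 0" "ip (\<lambda>x. Im (\<chi> x)) f = 0"
    using f c unfolding perp_def ip_commute[of _ f] by auto
  have "ip (conv \<phi> f) (\<lambda>x. Re (\<chi> x)) = 0"
    unfolding conv_self_adjoint[OF p f(1) cc(2)] re ip_commute[of f]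
    using z cc f by (simp add: ip_diff ip_scale continuous_on_mult_left)
  moreover have "ip (conv \<phi> f) (\<lambda>x. Im (\<chi> x)) = 0"
    unfolding conv_self_adjoint[OF p f(1) cc(3)] im ip_commute[of f]
    using z cc f by (simp add: ip_add ip_scale continuous_on_mult_left)
  ultimately show "ip (conv \<phi> f) (\<lambda>x. Re (\<chi> x)) = 0 \<and> ip (conv \<phi> f) (\<lambda>x. Im (\<chi> x)) = 0" by simp
qed

section \<open>Compactness of convolution and its largest eigenvalue\<close>

text \<open>In the absence of a metric a finite set of representatives, obtained from a finite
  subcover, replaces the modulus of continuity.\<close>

lemma conv_equicontinuous:
  fixes \<phi> :: "'a \<Rightarrow> real"
  assumes p: "continuous_on UNIV \<phi>" and e: "e > 0"
  shows "\<exists>C. finite C \<and> (\<forall>x. \<exists>c\<in>C. \<forall>t. \<bar>\<phi> (x - t) - \<phi> (c - t)\<bar> \<le> e)"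
proof -
  have F: "continuous_on (UNIV \<times> UNIV) (\<lambda>z. \<phi> (fst z - snd z))"
    by (rule continuous_on_compose2[OF p]) (auto intro!: continuous_intros)
  have "\<exists>X0. c \<in> X0 \<and> open X0 \<and> (\<forall>x\<in>X0. \<forall>t. \<bar>\<phi> (x - t) - \<phi> (c - t)\<bar> \<le> e)" for c
  proof -
    obtain X0 where "c \<in> X0" "open X0"
      "\<forall>x\<in>X0 \<inter> UNIV. \<forall>t\<in>UNIV. dist (\<phi> (fst (x, t) - snd (x, t))) (\<phi> (fst (c, t) - snd (c, t))) \<le> e"
      by (rule continuous_on_prod_compactE[OF F compact_UNIV UNIV_I e])
    then show ?thesis by (auto simp: dist_real_def)
  qed
  then obtain X0 where X0: "\<And>c. c \<in> X0 c" "\<And>c. open (X0 c)"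
    "\<And>c x t. x \<in> X0 c \<Longrightarrow> \<bar>\<phi> (x - t) - \<phi> (c - t)\<bar> \<le> e" by metis
  obtain C where "finite C" "UNIV \<subseteq> (\<Union>c\<in>C. X0 c)"
    using compactE_image[OF compact_UNIV, of UNIV X0] X0(1,2) by (metis UN_I UNIV_I subsetI)
  then show ?thesis using X0(3) by (intro exI[of _ C]) (metis UN_E UNIV_I subsetD)
qed

text \<open>The Arzela-Ascoli argument: a diagonal subsequence converges on the countable union of
  the finite sets of representatives for the precisions \<open>1 / (j + 1)\<close>, and
  equicontinuity carries the Cauchy property to all points, uniformly. The bound on
  \<open>ip (f n) (f n)\<close> gives both boundedness and equicontinuity of the
  convolutions.\<close>

lemma conv_compact:
  fixes \<phi> :: "'a \<Rightarrow> real" and f :: "nat \<Rightarrow> 'a \<Rightarrow> real"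
  assumes p: "continuous_on UNIV \<phi>" and f: "\<And>n. continuous_on UNIV (f n)" "\<And>n. ip (f n) (f n) \<le> 1"
  shows "\<exists>k g. strict_mono (k :: nat \<Rightarrow> nat) \<and> continuous_on UNIV g \<and>
    uniform_limit UNIV (\<lambda>n. conv \<phi> (f (k n))) g sequentially"
proof -
  obtain C where C: "C \<ge> 0" "\<And>x. \<bar>\<phi> x\<bar> \<le> C"
    using continuous_bounded_on_compact_space[OF compact_UNIV p] by auto
  have s: "sqrt (ip (f n) (f n)) \<le> 1" for n using f(2)[of n] by simp
  have bound: "norm (conv \<phi> (f n) x) \<le> C" for n x
    using conv_bound[OF p f(1) C(2), of n x] mult_left_le[OF s[of n] C(1)] by simp
  have "\<exists>P. \<forall>j. finite (P j) \<and> (\<forall>x. \<exists>c\<in>P j. \<forall>t. \<bar>\<phi> (x - t) - \<phi> (c - t)\<bar> \<le> 1 / real (Suc j))"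
    by (intro choice allI conv_equicontinuous[OF p]) simp
  then obtain P where P: "\<And>j. finite (P j)"
    "\<And>j x. \<exists>c\<in>P j. \<forall>t. \<bar>\<phi> (x - t) - \<phi> (c - t)\<bar> \<le> 1 / real (Suc j)" by blast
  have "countable (\<Union>j. P j)" using P(1) by (auto intro: countable_finite)
  then obtain k :: "nat \<Rightarrow> nat" where k: "strict_mono k"
    "\<And>x. x \<in> (\<Union>j. P j) \<Longrightarrow> \<exists>l. (\<lambda>n. conv \<phi> (f (k n)) x) \<longlonglongrightarrow> l"
    using function_convergent_subsequence[of "\<Union>j. P j" "\<lambda>n. conv \<phi> (f n)" C] bound by metis
  have "uniformly_Cauchy_on UNIV (\<lambda>n. conv \<phi> (f (k n)))"
  proof (rule uniformly_Cauchy_onI)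
    fix e :: real assume e: "e > 0"
    obtain j where j: "1 / real (Suc j) < e / 3" using nat_approx_posE[of "e / 3"] e by auto
    have "\<exists>N. \<forall>a\<ge>N. \<forall>b\<ge>N. dist (conv \<phi> (f (k a)) c) (conv \<phi> (f (k b)) c) < e / 3" if "c \<in> P j" for c
    proof -
      have "Cauchy (\<lambda>n. conv \<phi> (f (k n)) c)" using k(2) that by (auto intro: LIMSEQ_imp_Cauchy)
      then show ?thesis using e unfolding Cauchy_def by (metis divide_pos_pos zero_less_numeral)
    qed
    then obtain N where N: "\<And>c a b. c \<in> P j \<Longrightarrow> a \<ge> N c \<Longrightarrow> b \<ge> N c \<Longrightarrow>
      dist (conv \<phi> (f (k a)) c) (conv \<phi> (f (k b)) c) < e / 3" by metis
    define M where "M = Max (insert 0 (N ` P j))"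
    have M: "N c \<le> M" if "c \<in> P j" for c unfolding M_def using P(1) that by (intro Max_ge) auto
    have "dist (conv \<phi> (f (k a)) x) (conv \<phi> (f (k b)) x) < e" if ab: "a \<ge> M" "b \<ge> M" for a b x
    proof -
      obtain c where c: "c \<in> P j" "\<And>t. \<bar>\<phi> (x - t) - \<phi> (c - t)\<bar> \<le> 1 / real (Suc j)" using P(2) by metis
      have near: "\<bar>conv \<phi> (f n) x - conv \<phi> (f n) c\<bar> < e / 3" for n
      proof -
        have "\<bar>conv \<phi> (f n) x - conv \<phi> (f n) c\<bar> \<le> 1 / real (Suc j) * sqrt (ip (f n) (f n))"
          by (rule conv_diff_bound[OF p f(1) c(2)])
        also have "\<dots> \<le> 1 / real (Suc j)" using s[of n] by (intro mult_left_le) auto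
        finally show ?thesis using j by simp
      qed
      have "\<bar>conv \<phi> (f (k a)) c - conv \<phi> (f (k b)) c\<bar> < e / 3"
        using N[OF c(1), of a b] M[OF c(1)] ab by (simp add: dist_real_def)
      then show ?thesis using near[of "k a"] near[of "k b"] by (simp add: dist_real_def abs_if split: if_splits)
    qed
    then show "\<exists>M. \<forall>x\<in>UNIV. \<forall>a\<ge>M. \<forall>b\<ge>M. dist (conv \<phi> (f (k a)) x) (conv \<phi> (f (k b)) x) < e" by blast
  qed
  then obtain g where g: "uniform_limit UNIV (\<lambda>n. conv \<phi> (f (k n))) g sequentially"
    using Cauchy_uniformly_convergent unfolding uniformly_convergent_on_def by blast
  moreover have "continuous_on UNIV g"
    by (rule uniform_limit_theorem[OF _ g]) (auto intro!: always_eventually conv_cont p f)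
  ultimately show ?thesis using k(1) by blast
qed

text \<open>Evaluation at x after two convolutions is the inner product with a fixed continuous
  function. Thus convergence and bounds in the inner product become pointwise statements.\<close>

lemma conv_square_eq_ip:
  assumes p: "continuous_on UNIV \<phi>" "\<And>x. \<phi> (- x) = \<phi> x" and f: "continuous_on UNIV f"
  shows "conv \<phi> (conv \<phi> f) x = ip (conv \<phi> (\<lambda>y. \<phi> (x - y))) f"
proof -
  have "conv \<phi> (conv \<phi> f) x = ip (\<lambda>y. \<phi> (x - y)) (conv \<phi> f)"
    unfolding conv_def[of \<phi> "conv \<phi> f"] ip_def ..
  then show ?thesis using conv_self_adjoint[OF p continuous_reflect[OF p(1)] f] by simp
qed

lemma ip_zero_imp_zero: "continuous_on UNIV f \<Longrightarrow> ip f f = 0 \<Longrightarrow> f x = 0"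
  using ip_self_pos[of f x] by fastforce

text \<open>The largest value \<open>\<mu>\<close> of \<open>\<parallel>\<phi> * f\<parallel>\<^sup>2\<close> on the unit ball of the orthogonal complement of the
  characters is an eigenvalue of the square of the convolution operator: for a maximizing sequence
  \<open>f n\<close>, \<open>\<parallel>\<phi> * \<phi> * f n - \<mu> f n\<parallel>\<^sup>2 \<le> \<mu>\<^sup>2 - \<mu> \<parallel>\<phi> * f n\<parallel>\<^sup>2\<close> tends to 0.\<close>

lemma conv_square_eigenfunction:
  assumes p: "continuous_on UNIV \<phi>" "\<And>x. \<phi> (- x) = \<phi> x"
    and f0: "continuous_on UNIV f0" "perp f0" "conv \<phi> f0 x0 \<noteq> 0"
  shows "\<exists>g \<mu>. continuous_on UNIV g \<and> perp g \<and> \<mu> > 0 \<and> (\<exists>x. g x \<noteq> 0) \<and>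
    (\<forall>x. conv \<phi> (conv \<phi> g) x = \<mu> * g x)"
proof -
  let ?K = "conv \<phi>"
  obtain C where C: "C \<ge> 0" "\<And>x. \<bar>\<phi> x\<bar> \<le> C"
    using continuous_bounded_on_compact_space[OF compact_UNIV p(1)] by auto
  note Kc = conv_cont[OF p(1)]
  define S where "S = {ip (?K f) (?K f) | f. continuous_on UNIV f \<and> perp f \<and> ip f f \<le> 1}"
  have Kbound: "ip (?K f) (?K f) \<le> C\<^sup>2 * ip f f" if f: "continuous_on UNIV f" for f
  proof -
    have b: "\<bar>?K f x\<bar> \<le> C * sqrt (ip f f)" for x by (rule conv_bound[OF p(1) f C(2)])
    have "ip (?K f) (?K f) \<le> (\<integral>x. (C * sqrt (ip f f))\<^sup>2 \<partial>m)"
      unfolding ip_def[of "?K f"]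
    proof (intro integral_mono integrable_cont continuous_intros Kc f)
      fix x show "?K f x * ?K f x \<le> (C * sqrt (ip f f))\<^sup>2"
        using power_mono[OF b[of x] abs_ge_zero, of 2] by (simp add: power2_eq_square)
    qed
    then show ?thesis by (simp add: power_mult_distrib ip_nonneg)
  qed
  have bdd: "bdd_above S"
  proof (rule bdd_aboveI)
    fix s assume "s \<in> S"
    then obtain f where "continuous_on UNIV f" "ip f f \<le> 1" "s = ip (?K f) (?K f)" unfolding S_def by auto
    then show "s \<le> C\<^sup>2" using Kbound[of f] mult_left_le[of "ip f f" "C\<^sup>2"] by simp
  qed
  define \<mu> where "\<mu> = Sup S"
  have normalize: "ip (?K f) (?K f) \<le> \<mu> * ip f f" if f: "continuous_on UNIV f" "perp f" for f
  proof (cases "ip f f = 0")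
    case True
    then have "?K f = (\<lambda>_. 0)" using ip_zero_imp_zero[OF f(1) True] unfolding conv_def[abs_def] by simp
    then show ?thesis using True by (simp add: ip_def)
  next
    case False
    then have pos: "ip f f > 0" using ip_nonneg[of f] by simp
    \<comment> \<open>Scaling to norm 1 puts f into the set whose supremum is \<mu>; a function of
      norm 0 is zero by continuity and was treated apart.\<close>
    define c where "c = 1 / sqrt (ip f f)"
    have cc: "c * c * ip f f = 1" unfolding c_def using pos by (simp add: field_simps)
    let ?f = "\<lambda>x. c * f x"
    have "ip ?f ?f = c * c * ip f f" by (simp add: ip_scale ip_scale_right)
    moreover have K: "?K ?f = (\<lambda>x. c * ?K f x)" by (rule ext) (rule conv_scale)
    have "ip (?K ?f) (?K ?f) = c * c * ip (?K f) (?K f)" unfolding K by (simp add: ip_scale ip_scale_right)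
    ultimately have "c * c * ip (?K f) (?K f) \<in> S"
      unfolding S_def using cc by (intro CollectI exI[of _ ?f] conjI continuous_on_mult_left f perp_scale) auto
    then have "c * c * ip (?K f) (?K f) \<le> \<mu>" unfolding \<mu>_def using bdd by (rule cSup_upper)
    then have "c * c * ip (?K f) (?K f) * ip f f \<le> \<mu> * ip f f" using pos by (intro mult_right_mono) auto
    moreover have "c * c * ip (?K f) (?K f) * ip f f = ip (?K f) (?K f) * (c * c * ip f f)" by simp
    ultimately show ?thesis unfolding cc by simp
  qed
  have "ip (?K f0) (?K f0) > 0" by (rule ip_self_pos[OF Kc[OF f0(1)] f0(3)])
  then have "\<mu> * ip f0 f0 > 0" using normalize[OF f0(1,2)] by simp
  then have mu: "\<mu> > 0" using ip_nonneg[of f0] by (simp add: zero_less_mult_iff)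
  have ne: "S \<noteq> {}" unfolding S_def using f0 perp_scale[OF f0(2), of 0] by (auto intro!: exI[of _ "\<lambda>_. 0"] simp: ip_def)
  have "\<exists>f. continuous_on UNIV f \<and> perp f \<and> ip f f \<le> 1 \<and> \<mu> - 1 / real (Suc n) < ip (?K f) (?K f)" for n
  proof -
    have "\<mu> - 1 / real (Suc n) < Sup S" unfolding \<mu>_def by simp
    then obtain s where "s \<in> S" "\<mu> - 1 / real (Suc n) < s" using less_cSup_iff[OF ne bdd] by auto
    then show ?thesis unfolding S_def by auto
  qed
  then obtain f where f: "\<And>n. continuous_on UNIV (f n)" "\<And>n. perp (f n)" "\<And>n. ip (f n) (f n) \<le> 1"
    "\<And>n. \<mu> - 1 / real (Suc n) < ip (?K (f n)) (?K (f n))" by metis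
  from conv_compact[where f = f, OF p(1) f(1,3)]
  obtain k g where kg: "strict_mono (k :: nat \<Rightarrow> nat)" "continuous_on UNIV g"
    "uniform_limit UNIV (\<lambda>n. ?K (f (k n))) g sequentially"
    by (elim exE conjE)
  define h where "h n = ?K (f (k n))" for n
  have h: "continuous_on UNIV (h n)" "perp (h n)" for n
    unfolding h_def using Kc[OF f(1)[of "k n"]] perp_conv[OF p f(1,2)[of "k n"]] by auto
  have hg: "uniform_limit UNIV h g sequentially" using kg(3) unfolding h_def .
  have lim_ip: "(\<lambda>n. ip (h n) u) \<longlonglongrightarrow> ip g u" if "continuous_on UNIV u" for u
    using ip_uniform_limit[OF hg h(1) kg(2), of "\<lambda>_. u" u] that by (simp add: uniform_limit_const)
  have "perp g"
    unfolding perp_def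
  proof
    fix \<chi> :: "'a \<Rightarrow> complex" assume c: "\<chi> \<in> characters"
    have "ip (h n) (\<lambda>x. Re (\<chi> x)) = 0" "ip (h n) (\<lambda>x. Im (\<chi> x)) = 0" for n
      using h(2)[of n] c unfolding perp_def by auto
    then show "ip g (\<lambda>x. Re (\<chi> x)) = 0 \<and> ip g (\<lambda>x. Im (\<chi> x)) = 0"
      using lim_ip[OF characters_cont(2)[OF c]] lim_ip[OF characters_cont(3)[OF c]]
      by (simp add: LIMSEQ_const_iff)
  qed
  have up: "ip (h n) (h n) \<le> \<mu>" for n
    using normalize[OF f(1,2)] mult_left_le[OF f(3)] mu unfolding h_def by (meson less_imp_le order_trans)
  have lo: "\<mu> - 1 / real (Suc n) \<le> ip (h n) (h n)" for n
  proof -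
    have "\<mu> - 1 / real (Suc n) \<le> \<mu> - 1 / real (Suc (k n))"
      using seq_suble[OF kg(1), of n] by (simp add: frac_le)
    then show ?thesis using f(4)[of "k n"] unfolding h_def by simp
  qed
  have inv: "(\<lambda>n. 1 / real (Suc n)) \<longlonglongrightarrow> 0" using LIMSEQ_inverse_real_of_nat by (simp add: inverse_eq_divide)
  have hh: "(\<lambda>n. ip (h n) (h n)) \<longlonglongrightarrow> \<mu>"
  proof (rule tendsto_sandwich[OF _ _ _ tendsto_const])
    show "(\<lambda>n. \<mu> - 1 / real (Suc n)) \<longlonglongrightarrow> \<mu>" using tendsto_diff[OF tendsto_const inv] by simp
  qed (use lo up in auto)
  have "ip g g = \<mu>"
    by (rule LIMSEQ_unique[OF ip_uniform_limit[OF hg h(1) kg(2) hg h(1) kg(2)] hh])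
  have gne: "\<exists>x. g x \<noteq> 0"
  proof (rule ccontr)
    assume "\<not> ?thesis"
    then have "g = (\<lambda>_. 0)" by auto
    then show False using \<open>ip g g = \<mu>\<close> mu by (simp add: ip_def)
  qed
  have "conv \<phi> (conv \<phi> g) x = \<mu> * g x" for x
  proof -
    define \<psi> where "\<psi> = ?K (\<lambda>y. \<phi> (x - y))"
    have psi: "continuous_on UNIV \<psi>" unfolding \<psi>_def by (intro Kc continuous_reflect p)
    have sq: "?K (?K u) x = ip \<psi> u" if "continuous_on UNIV u" for u
      unfolding \<psi>_def by (rule conv_square_eq_ip[OF p that])
    have l1: "(\<lambda>n. ?K (?K (h n)) x) \<longlonglongrightarrow> ?K (?K g) x"
      unfolding sq[OF h(1)] sq[OF kg(2)] ip_commute[of \<psi>] by (rule lim_ip[OF psi])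
    have "(\<lambda>n. h n x) \<longlonglongrightarrow> g x" using hg by (rule tendsto_uniform_limitI) simp
    then have l2: "(\<lambda>n. \<mu> * h n x) \<longlonglongrightarrow> \<mu> * g x" by (rule tendsto_mult_left)
    \<comment> \<open>As \<open>h n\<close> is the convolution of \<phi> with
      \<open>f (k n)\<close>, the difference is \<phi> convolved with
      \<open>u = ?K (h n) - \<mu> * f (k n)\<close>. This last convolution turns smallness of u in
      norm into smallness at the point x.\<close>
    have bnd: "norm (?K (?K (h n)) x - \<mu> * h n x) \<le> C * sqrt (\<mu> * (1 / real (Suc n)))" for n
    proof -
      let ?f = "f (k n)"
      define u where "u = (\<lambda>x. ?K (h n) x - \<mu> * ?f x)"
      have u: "continuous_on UNIV u" unfolding u_def by (intro continuous_intros Kc h f)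
      have Ku: "?K u x = ?K (?K (h n)) x - \<mu> * h n x"
        unfolding u_def h_def using conv_diff[OF p(1) Kc[OF h(1)[of n]] continuous_on_mult_left[OF f(1)[of "k n"]], of \<mu> x]
        by (simp add: conv_scale h_def)
      have "ip u u = ip (?K (h n)) (?K (h n)) - 2 * \<mu> * ip (?K (h n)) ?f + \<mu> * \<mu> * ip ?f ?f"
      proof -
        have cs: "continuous_on UNIV (\<lambda>x. \<mu> * ?f x)" "continuous_on UNIV (?K (h n))"
          by (intro continuous_intros Kc h f)+
        have "ip u u = ip (?K (h n)) u - \<mu> * ip ?f u"
          using ip_diff[OF cs(2,1) u] unfolding u_def ip_scale .
        also have "ip (?K (h n)) u = ip (?K (h n)) (?K (h n)) - \<mu> * ip (?K (h n)) ?f"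
          using ip_diff_right[OF cs(2,1) cs(2)] unfolding u_def ip_scale_right .
        also have "ip ?f u = ip ?f (?K (h n)) - \<mu> * ip ?f ?f"
          using ip_diff_right[OF cs(2,1) f(1)[of "k n"]] unfolding u_def ip_scale_right .
        also have "ip ?f (?K (h n)) = ip (?K (h n)) ?f" by (rule ip_commute)
        finally show ?thesis by (simp add: algebra_simps)
      qed
      also have "ip (?K (h n)) ?f = ip (h n) (h n)"
        using conv_self_adjoint[OF p h(1)[of n] f(1)[of "k n"]] unfolding h_def .
      also have "ip (?K (h n)) (?K (h n)) - 2 * \<mu> * ip (h n) (h n) + \<mu> * \<mu> * ip ?f ?f
        \<le> \<mu> * ip (h n) (h n) - 2 * \<mu> * ip (h n) (h n) + \<mu> * \<mu> * 1"
        using normalize[OF h] f(3) mu by (intro add_mono diff_right_mono mult_left_mono) auto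
      also have "\<dots> = \<mu> * (\<mu> - ip (h n) (h n))" by (simp add: algebra_simps)
      also have "\<dots> \<le> \<mu> * (1 / real (Suc n))" using lo[of n] mu by (intro mult_left_mono) auto
      finally have "ip u u \<le> \<mu> * (1 / real (Suc n))" .
      then have "C * sqrt (ip u u) \<le> C * sqrt (\<mu> * (1 / real (Suc n)))" using C(1) by (intro mult_left_mono) auto
      then show ?thesis using conv_bound[OF p(1) u C(2), of x] unfolding Ku by simp
    qed
    have "(\<lambda>n. C * sqrt (\<mu> * (1 / real (Suc n)))) \<longlonglongrightarrow> C * sqrt (\<mu> * 0)"
      by (intro tendsto_intros inv)
    then have "(\<lambda>n. C * sqrt (\<mu> * (1 / real (Suc n)))) \<longlonglongrightarrow> 0" by simp
    with always_eventually[OF allI[OF bnd]]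
    have "(\<lambda>n. ?K (?K (h n)) x - \<mu> * h n x) \<longlonglongrightarrow> 0"
      by (rule Lim_null_comparison)
    moreover have "(\<lambda>n. ?K (?K (h n)) x - \<mu> * h n x) \<longlonglongrightarrow> ?K (?K g) x - \<mu> * g x"
      by (intro tendsto_diff l1 l2)
    ultimately have "?K (?K g) x - \<mu> * g x = 0" by (rule LIMSEQ_unique[rotated])
    then show ?thesis by simp
  qed
  then show ?thesis using kg(2) \<open>perp g\<close> mu gne by blast
qed

lemma conv_lincomb:
  assumes "continuous_on UNIV \<phi>" "continuous_on UNIV f" "continuous_on UNIV g"
  shows "conv \<phi> (\<lambda>x. a * f x + b * g x) = (\<lambda>x. a * conv \<phi> f x + b * conv \<phi> g x)"
proof
  fix x show "conv \<phi> (\<lambda>x. a * f x + b * g x) x = a * conv \<phi> f x + b * conv \<phi> g x"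
    using conv_add[OF assms(1) continuous_on_mult_left[OF assms(2)] continuous_on_mult_left[OF assms(3)]]
    by (simp add: conv_scale)
qed

section \<open>Orthonormal systems\<close>

definition orthonormal :: "('a \<Rightarrow> real) set \<Rightarrow> bool" where
  "orthonormal S \<longleftrightarrow> (\<forall>e\<in>S. continuous_on UNIV e) \<and> (\<forall>e\<in>S. \<forall>e'\<in>S. ip e e' = (if e = e' then 1 else 0))"

lemma ip_orthonormal_sum:
  assumes "finite S" "orthonormal S" "e \<in> S"
  shows "ip (\<lambda>x. \<Sum>e'\<in>S. c e' * e' x) e = c e"
proof -
  have "ip (\<lambda>x. \<Sum>e'\<in>S. c e' * e' x) e = (\<Sum>e'\<in>S. c e' * ip e' e)"
    using assms unfolding orthonormal_def by (subst ip_sum) (auto intro!: continuous_intros simp: ip_scale)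
  also have "\<dots> = (\<Sum>e'\<in>S. if e' = e then c e else 0)"
    using assms unfolding orthonormal_def by (intro sum.cong) auto
  finally show ?thesis using assms by simp
qed

lemma Bessel_inequality:
  assumes S: "finite S" "orthonormal S" and u: "continuous_on UNIV u"
  shows "(\<Sum>e\<in>S. (ip u e)\<^sup>2) \<le> ip u u"
proof -
  define w where "w = (\<lambda>x. \<Sum>e\<in>S. ip u e * e x)"
  have w: "continuous_on UNIV w"
    unfolding w_def using S unfolding orthonormal_def by (intro continuous_intros) auto
  have we: "ip w v = (\<Sum>e\<in>S. ip u e * ip e v)" if "continuous_on UNIV v" for v
    unfolding w_def using S that unfolding orthonormal_def
    by (subst ip_sum) (auto intro!: continuous_intros simp: ip_scale)
  have wu: "ip w u = (\<Sum>e\<in>S. (ip u e)\<^sup>2)"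
    unfolding we[OF u] by (simp add: power2_eq_square ip_commute)
  have "ip e w = ip u e" if "e \<in> S" for e
    unfolding ip_commute[of e w] unfolding w_def by (rule ip_orthonormal_sum[OF S that])
  then have ww: "ip w w = (\<Sum>e\<in>S. (ip u e)\<^sup>2)"
    unfolding we[OF w] by (simp add: power2_eq_square)
  have uw: "continuous_on UNIV (\<lambda>x. u x - w x)" using u w by (intro continuous_intros)
  have "0 \<le> ip (\<lambda>x. u x - w x) (\<lambda>x. u x - w x)" by (rule ip_nonneg)
  also have "\<dots> = ip u u - ip u w - (ip w u - ip w w)"
    by (simp only: ip_diff[OF u w uw] ip_diff_right[OF u w u] ip_diff_right[OF u w w])
  also have "\<dots> = ip u u - (\<Sum>e\<in>S. (ip u e)\<^sup>2)"
    using wu ww ip_commute[of u w] by simp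
  finally show ?thesis by simp
qed

section \<open>Translation-invariant spaces and separation of points\<close>

lemma translation_linear:
  "Vector_Spaces.linear fscale fscale (\<lambda>(f :: 'a \<Rightarrow> complex) x. f (a + x))"
  by unfold_locales (auto simp: fscale_def fun_eq_iff algebra_simps)

text \<open>The eigenvalue of translation by a is \<open>f a / f 0\<close>, whence multiplicativity.
  At a point z where \<bar>\<chi>\<bar> is maximal,
  \<open>\<chi> (a + z) = \<chi> a * \<chi> z\<close> gives \<bar>\<chi> a\<bar> \<le> 1; the same
  for - a, together with \<open>\<chi> a * \<chi> (- a) = 1\<close>, gives modulus 1.\<close>

lemma translation_eigenfunction_character:
  fixes f :: "'a \<Rightarrow> complex"
  assumes f: "continuous_on UNIV f" "f x0 \<noteq> 0" and ev: "\<And>a. \<exists>c. \<forall>x. f (a + x) = c * f x"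
  shows "f 0 \<noteq> 0" "(\<lambda>x. f x / f 0) \<in> characters"
proof -
  obtain c where c: "\<And>a x. f (a + x) = c a * f x" using ev by metis
  show f0: "f 0 \<noteq> 0" using c[of x0 0] f(2) by auto
  define \<chi> where "\<chi> = (\<lambda>x. f x / f 0)"
  have c_eq: "c a = \<chi> a" for a using c[of a 0] f0 unfolding \<chi>_def by simp
  have mult: "\<chi> (x + y) = \<chi> x * \<chi> y" for x y
    unfolding \<chi>_def[of ] using c[of x y] c_eq[of x] f0 by (simp add: \<chi>_def)
  have cont: "continuous_on UNIV \<chi>" unfolding \<chi>_def using f f0 by (intro continuous_intros) auto
  then have "continuous_on UNIV (\<lambda>x. cmod (\<chi> x))" by (intro continuous_intros)
  then obtain z where z: "\<And>x. cmod (\<chi> x) \<le> cmod (\<chi> z)"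
    using continuous_attains_sup[OF compact_UNIV, of "\<lambda>x. cmod (\<chi> x)"] by auto
  have "\<chi> 0 = 1" unfolding \<chi>_def using f0 by simp
  have zpos: "cmod (\<chi> z) > 0" using z[of 0] \<open>\<chi> 0 = 1\<close> by (smt (verit) norm_one)
  have le: "cmod (\<chi> a) \<le> 1" for a
    using z[of "a + z"] zpos unfolding mult norm_mult by simp
  have "cmod (\<chi> a) = 1" for a
  proof -
    have "cmod (\<chi> a) * cmod (\<chi> (- a)) = 1"
      using mult[of a "- a"] \<open>\<chi> 0 = 1\<close> by (simp flip: norm_mult)
    then show ?thesis using le[of a] le[of "- a"]
      by (smt (verit) mult_left_le norm_ge_zero)
  qed
  then show "(\<lambda>x. f x / f 0) \<in> characters"
    using cont mult unfolding characters_def \<chi>_def by auto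
qed

text \<open>Otherwise the eigenspace E of the squared convolution among the functions orthogonal to
  all characters is nonzero. It is translation invariant and finite-dimensional, so the commuting
  translations have a common eigenvector in its complexification. This is a multiple of a character,
  which would be orthogonal to itself.\<close>

lemma conv_perp_zero:
  assumes p: "continuous_on UNIV \<phi>" "\<And>x. \<phi> (- x) = \<phi> x"
    and f0: "continuous_on UNIV f0" "perp f0"
  shows "conv \<phi> f0 x0 = 0"
proof (rule ccontr)
  assume "conv \<phi> f0 x0 \<noteq> 0"
  then obtain g \<mu> where g: "continuous_on UNIV g" "perp g" "\<mu> > 0" "\<exists>x. g x \<noteq> 0"
    "\<And>x. conv \<phi> (conv \<phi> g) x = \<mu> * g x"
    using conv_square_eigenfunction[OF p f0] by blast
  define E where "E = {f. continuous_on UNIV f \<and> perp f \<and> (\<forall>x. conv \<phi> (conv \<phi> f) x = \<mu> * f x)}"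
  have Ec: "f \<in> E \<Longrightarrow> continuous_on UNIV f" for f unfolding E_def by simp
  note Kc = conv_cont[OF p(1)]
  have E_lin: "(\<lambda>x. a * f x + b * h x) \<in> E" if "f \<in> E" "h \<in> E" for a b f h
  proof -
    have c: "continuous_on UNIV f" "continuous_on UNIV h" using that Ec by auto
    have "conv \<phi> (conv \<phi> (\<lambda>x. a * f x + b * h x)) = (\<lambda>x. a * conv \<phi> (conv \<phi> f) x + b * conv \<phi> (conv \<phi> h) x)"
      by (simp add: conv_lincomb p c Kc)
    then show ?thesis
      using that c unfolding E_def by (auto intro!: perp_lincomb continuous_intros simp: algebra_simps)
  qed
  have gE: "g \<in> E" using g unfolding E_def by auto
  have E_0: "(\<lambda>_. 0) \<in> E" using E_lin[OF gE gE, of 0 0] by simp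
  have E_sum: "(\<lambda>x. \<Sum>e\<in>S. c e * e x) \<in> E" if "S \<subseteq> E" "finite S" for S c
    using that(2,1)
  proof (induction S)
    case (insert e S)
    then show ?case using E_lin[of e "\<lambda>x. \<Sum>e\<in>S. c e * e x" "c e" 1] by simp
  qed (simp add: E_0)
  have E_tr: "(\<lambda>x. f (a + x)) \<in> E" if "f \<in> E" for f a
  proof -
    have c: "continuous_on UNIV f" "perp f" using that unfolding E_def by auto
    have "conv \<phi> (\<lambda>x. f (a + x)) = (\<lambda>x. conv \<phi> f (a + x))"
      by (rule ext) (rule conv_translate[OF p(1) c(1)])
    then have "conv \<phi> (conv \<phi> (\<lambda>x. f (a + x))) x = conv \<phi> (conv \<phi> f) (a + x)" for x
      using conv_translate[OF p(1) Kc[OF c(1)]] by simp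
    then show ?thesis using that c unfolding E_def by (auto intro!: perp_translate continuous_translate)
  qed
  obtain C where C: "C \<ge> 0" "\<And>x. \<bar>\<phi> x\<bar> \<le> C"
    using continuous_bounded_on_compact_space[OF compact_UNIV p(1)] by auto
  define ON where "ON S \<longleftrightarrow> finite S \<and> S \<subseteq> E \<and> orthonormal S" for S
  define D where "D = (C * C)\<^sup>2"
  \<comment> \<open>For the function \<psi> that evaluates the squared convolution at x,
    \<open>ip \<psi> e = \<mu> * e x\<close> on E. Bessel's inequality bounds the sum of the squares
    of these numbers by D, uniformly in x, and integrating over x counts the elements of S.\<close>
  have card: "\<mu>\<^sup>2 * real (card S) \<le> D" if S: "ON S" for S
  proof -
    have fS: "finite S" "orthonormal S" and SE: "S \<subseteq> E" using S unfolding ON_def by auto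
    have pt: "(\<Sum>e\<in>S. \<mu>\<^sup>2 * (e x * e x)) \<le> D" for x
    proof -
      define \<psi> where "\<psi> = conv \<phi> (\<lambda>y. \<phi> (x - y))"
      have cr: "continuous_on UNIV (\<lambda>y. \<phi> (x - y))" by (rule continuous_reflect[OF p(1)])
      have psi: "continuous_on UNIV \<psi>" unfolding \<psi>_def by (intro Kc cr)
      have "ip (\<lambda>y. \<phi> (x - y)) (\<lambda>y. \<phi> (x - y)) \<le> (\<integral>y. C\<^sup>2 \<partial>m)"
        unfolding ip_def
      proof (intro integral_mono integrable_cont continuous_intros cr)
        fix y show "\<phi> (x - y) * \<phi> (x - y) \<le> C\<^sup>2"
          using power_mono[OF C(2)[of "x - y"] abs_ge_zero, of 2] by (simp add: power2_eq_square)
      qed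
      then have "sqrt (ip (\<lambda>y. \<phi> (x - y)) (\<lambda>y. \<phi> (x - y))) \<le> C" using C(1) by (intro real_le_lsqrt) (auto simp: ip_nonneg)
      then have b: "\<bar>\<psi> z\<bar> \<le> C * C" for z
        unfolding \<psi>_def using conv_bound[OF p(1) cr C(2), of z] C(1) by (meson mult_left_mono order_trans)
      have "(\<Sum>e\<in>S. (ip \<psi> e)\<^sup>2) \<le> ip \<psi> \<psi>" by (rule Bessel_inequality[OF fS psi])
      also have "\<dots> \<le> (\<integral>y. D \<partial>m)"
        unfolding ip_def
      proof (intro integral_mono integrable_cont continuous_intros psi)
        fix y show "\<psi> y * \<psi> y \<le> D"
          using power_mono[OF b[of y] abs_ge_zero, of 2] by (simp add: power2_eq_square D_def)
      qed
      finally have "(\<Sum>e\<in>S. (ip \<psi> e)\<^sup>2) \<le> D" by simp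
      moreover have "ip \<psi> e = \<mu> * e x" if "e \<in> S" for e
        using conv_square_eq_ip[OF p, of e x] SE that unfolding \<psi>_def E_def by auto
      ultimately show ?thesis by (simp add: power_mult_distrib power2_eq_square mult_ac)
    qed
    have ci: "integrable m (\<lambda>x. \<mu>\<^sup>2 * (e x * e x))" if "e \<in> S" for e
      using SE that Ec by (intro integrable_cont continuous_intros) auto
    have "(\<Sum>e\<in>S. \<mu>\<^sup>2 * ip e e) = (\<integral>x. (\<Sum>e\<in>S. \<mu>\<^sup>2 * (e x * e x)) \<partial>m)"
      unfolding ip_def using ci by (subst Bochner_Integration.integral_sum) auto
    also have "\<dots> \<le> (\<integral>x. D \<partial>m)"
      using ci pt by (intro integral_mono) auto
    finally have "(\<Sum>e\<in>S. \<mu>\<^sup>2 * ip e e) \<le> D" by simp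
    moreover have "(\<Sum>e\<in>S. \<mu>\<^sup>2 * ip e e) = (\<Sum>e\<in>S. \<mu>\<^sup>2)"
      using fS unfolding orthonormal_def by (intro sum.cong) auto
    ultimately show ?thesis by (simp add: mult.commute)
  qed
  have "\<exists>S. ON S \<and> (\<forall>S'. ON S' \<longrightarrow> card S' \<le> card S)"
  proof (rule Lattices_Big.ex_has_greatest_nat[of ON "{}" card "Suc (nat \<lceil>D / \<mu>\<^sup>2\<rceil>)"])
    show "ON {}" unfolding ON_def orthonormal_def by simp
    show "\<forall>S. ON S \<longrightarrow> card S < Suc (nat \<lceil>D / \<mu>\<^sup>2\<rceil>)"
    proof (intro allI impI)
      fix S assume "ON S"
      then have "real (card S) \<le> D / \<mu>\<^sup>2" using card[of S] g(3) by (simp add: field_simps)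
      then show "card S < Suc (nat \<lceil>D / \<mu>\<^sup>2\<rceil>)" by linarith
    qed
  qed
  then obtain S where S: "ON S" "\<And>S'. ON S' \<Longrightarrow> card S' \<le> card S" by blast
  have fS: "finite S" "orthonormal S" and SE: "S \<subseteq> E" using S(1) unfolding ON_def by auto
  \<comment> \<open>S is an orthonormal subset of E of maximal size; a nonzero remainder,
    normalized, would enlarge it.\<close>
  have expand: "f x = (\<Sum>e\<in>S. ip f e * e x)" if f: "f \<in> E" for f x
  proof (rule ccontr)
    assume ne: "f x \<noteq> (\<Sum>e\<in>S. ip f e * e x)"
    define w where "w = (\<lambda>x. \<Sum>e\<in>S. ip f e * e x)"
    define r where "r = (\<lambda>x. f x - w x)"
    have wE: "w \<in> E" unfolding w_def by (rule E_sum[OF SE fS(1)])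
    have rE: "r \<in> E" unfolding r_def using E_lin[OF f wE, of 1 "-1"] by simp
    have re: "ip r e = 0" if "e \<in> S" for e
      unfolding r_def using ip_diff[OF Ec[OF f] Ec[OF wE], of e] Ec that SE
        ip_orthonormal_sum[OF fS that, of "ip f"] unfolding w_def by auto
    have pos: "ip r r > 0" by (rule ip_self_pos[OF Ec[OF rE], of x]) (use ne in \<open>simp add: r_def w_def\<close>)
    define e0 where "e0 = (\<lambda>x. (1 / sqrt (ip r r)) * r x)"
    have e0E: "e0 \<in> E" unfolding e0_def using E_lin[OF rE E_0, of "1 / sqrt (ip r r)" 1] by simp
    have 1: "ip e0 e0 = 1" unfolding e0_def ip_scale ip_scale_right using pos by (simp add: field_simps)
    have 2: "ip e0 e = 0" if "e \<in> S" for e unfolding e0_def ip_scale using re[OF that] by simp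
    have 3: "ip e e0 = 0" if "e \<in> S" for e using 2[OF that] by (simp only: ip_commute)
    have "e0 \<notin> S" using 1 2 by auto
    have "ON (insert e0 S)"
      using fS SE e0E 1 2 3 Ec[OF e0E] \<open>e0 \<notin> S\<close> unfolding ON_def orthonormal_def by simp metis
    then show False using S(2)[of "insert e0 S"] \<open>e0 \<notin> S\<close> fS(1) by simp
  qed
  \<comment> \<open>The complexification of E, since the eigenvalues of translations are
    complex.\<close>
  define EC where "EC = {f :: 'a \<Rightarrow> complex. (\<lambda>x. Re (f x)) \<in> E \<and> (\<lambda>x. Im (f x)) \<in> E}"
  define B where "B = (\<lambda>e x. complex_of_real (e x)) ` S"
  define L where "L a f = (\<lambda>x. f (a + x))" for a and f :: "'a \<Rightarrow> complex"
  have "\<exists>f\<in>EC. f \<noteq> 0 \<and> (\<forall>a. \<exists>c. L a f = fscale c f)"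
  proof (rule fun_space.common_eigenvector[of B])
    show "finite B" unfolding B_def using fS by simp
    show "Vector_Spaces.linear fscale fscale (L a)" for a
      using translation_linear[of a] unfolding L_def[abs_def] .
    show "L a (L b f) = L b (L a f)" for a b f
      unfolding L_def by (simp add: add.left_commute)
    show "fun_space.subspace EC"
      unfolding fun_space.subspace_def
    proof (intro conjI ballI allI)
      show "0 \<in> EC" unfolding EC_def using E_0 by simp
      show "f + h \<in> EC" if "f \<in> EC" "h \<in> EC" for f h
        using that E_lin[of _ _ 1 1] unfolding EC_def by simp
      show "fscale c f \<in> EC" if "f \<in> EC" for c f
        using that E_lin[of "\<lambda>x. Re (f x)" "\<lambda>x. Im (f x)" "Re c" "- Im c"]
          E_lin[of "\<lambda>x. Re (f x)" "\<lambda>x. Im (f x)" "Im c" "Re c"]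
        unfolding EC_def fscale_def by (simp add: add.commute)
    qed
    show "EC \<subseteq> fun_space.span B"
    proof
      fix f assume f: "f \<in> EC"
      let ?c = "\<lambda>e. Complex (ip (\<lambda>x. Re (f x)) e) (ip (\<lambda>x. Im (f x)) e)"
      have "f = (\<Sum>e\<in>S. fscale (?c e) (\<lambda>x. complex_of_real (e x)))"
      proof
        fix x
        have "Re (f x) = (\<Sum>e\<in>S. ip (\<lambda>x. Re (f x)) e * e x)" "Im (f x) = (\<Sum>e\<in>S. ip (\<lambda>x. Im (f x)) e * e x)"
          using f expand unfolding EC_def by auto
        then show "f x = (\<Sum>e\<in>S. fscale (?c e) (\<lambda>x. complex_of_real (e x))) x"
          by (simp add: sum_fun_apply fscale_def complex_eq_iff)
      qed
      also have "\<dots> \<in> fun_space.span B"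
        unfolding B_def by (intro fun_space.span_sum fun_space.span_scale fun_space.span_base) auto
      finally show "f \<in> fun_space.span B" .
    qed
    show "L a f \<in> EC" if "f \<in> EC" for a f
      using that E_tr unfolding EC_def L_def by auto
    obtain x where "g x \<noteq> 0" using g by auto
    then have "(\<lambda>x. complex_of_real (g x)) \<noteq> 0" by (auto simp: fun_eq_iff)
    then show "\<exists>f\<in>EC. f \<noteq> 0" using gE E_0 unfolding EC_def by (intro bexI[of _ "\<lambda>x. complex_of_real (g x)"]) auto
  qed
  then obtain f where f: "f \<in> EC" "f \<noteq> 0" "\<And>a. \<exists>c. L a f = fscale c f" by blast
  obtain x where "f x \<noteq> 0" using f(2) by (auto simp: fun_eq_iff)
  have fRI: "(\<lambda>x. Re (f x)) \<in> E" "(\<lambda>x. Im (f x)) \<in> E" using f(1) unfolding EC_def by auto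
  have "continuous_on UNIV f"
    using continuous_on_Complex[OF Ec[OF fRI(1)] Ec[OF fRI(2)]] by simp
  have "\<exists>c. \<forall>x. f (a + x) = c * f x" for a
    using f(3)[of a] unfolding L_def fscale_def by (auto simp: fun_eq_iff)
  note \<chi> = translation_eigenfunction_character[OF \<open>continuous_on UNIV f\<close> \<open>f x \<noteq> 0\<close> this]
  define \<chi> where "\<chi> = (\<lambda>x. f x / f 0)"
  have chi: "\<chi> \<in> characters" using \<chi>(2) unfolding \<chi>_def .
  define c where "c = 1 / f 0"
  have chi_eq: "\<chi> x = c * f x" for x unfolding \<chi>_def c_def by simp
  have "(\<lambda>x. Re (\<chi> x)) \<in> E" "(\<lambda>x. Im (\<chi> x)) \<in> E"
    using E_lin[OF fRI, of "Re c" "- Im c"] E_lin[OF fRI, of "Im c" "Re c"]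
    unfolding chi_eq by (simp_all add: add.commute)
  then have z: "ip (\<lambda>x. Re (\<chi> x)) (\<lambda>x. Re (\<chi> x)) = 0" "ip (\<lambda>x. Im (\<chi> x)) (\<lambda>x. Im (\<chi> x)) = 0"
    using chi unfolding E_def perp_def by auto
  have "\<chi> 0 = 0"
    using ip_zero_imp_zero[OF characters_cont(2)[OF chi] z(1), of 0]
      ip_zero_imp_zero[OF characters_cont(3)[OF chi] z(2), of 0] by (simp add: complex_eq_iff)
  moreover have "cmod (\<chi> 0) = 1" using chi unfolding characters_def by auto
  ultimately show False by simp
qed

text \<open>If \<open>f x > 0\<close>, an even bump function supported near 0 averages f around x to
  a positive number, whereas all such convolutions vanish. The same applies to - f.\<close>

lemma perp_zero:
  assumes f: "continuous_on UNIV f" "perp f"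
  shows "f x = 0"
proof -
  have nonpos: "f x \<le> 0" if f: "continuous_on UNIV f" "perp f" for f
  proof (rule ccontr)
    assume "\<not> f x \<le> 0"
    then have pos: "f x > 0" by simp
    define U where "U = {u. f (x - u) > 0}"
    have U: "open U" "{0} \<subseteq> U" "0 \<in> U"
      unfolding U_def using pos open_Collect_less[OF continuous_on_const continuous_reflect[OF f(1)]] by auto
    obtain h :: "'a \<Rightarrow> real" where h: "continuous_on UNIV h" "\<And>y. 0 \<le> h y" "h 0 = 1" "\<And>y. y \<notin> U \<Longrightarrow> h y = 0"
      using compact_space_Urysohn[OF compact_UNIV closed_singleton U(1,2)] by auto
    \<comment> \<open>Multiplying by the reflected function makes the bump even without enlarging
      its support.\<close>
    define \<phi> where "\<phi> = (\<lambda>y. h y * h (- y))"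
    have "continuous_on UNIV (\<lambda>y. h (- y))"
      by (rule continuous_on_compose2[OF h(1)]) (auto intro!: continuous_intros)
    then have phi: "continuous_on UNIV \<phi>" unfolding \<phi>_def by (intro continuous_intros h)
    have "conv \<phi> f x > 0"
      unfolding conv_def
    proof (rule integral_cont_pos)
      show "continuous_on UNIV (\<lambda>y. \<phi> (x - y) * f y)"
        by (intro continuous_on_mult continuous_reflect phi f)
      show "0 \<le> \<phi> (x - y) * f y" for y
      proof (cases "x - y \<in> U")
        case True
        then have "f y > 0" unfolding U_def by simp
        then show ?thesis unfolding \<phi>_def using h(2) by simp
      next
        case False
        then show ?thesis unfolding \<phi>_def using h(4) by simp
      qed
      show "0 < \<phi> (x - x) * f x" unfolding \<phi>_def using h(3) pos by simp
    qed
    moreover have "conv \<phi> f x = 0"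
      by (rule conv_perp_zero[OF phi _ f]) (simp add: \<phi>_def mult.commute)
    ultimately show False by simp
  qed
  have "continuous_on UNIV (\<lambda>x. - f x)" "perp (\<lambda>x. - f x)"
    using f perp_scale[OF f(2), of "-1"] by (auto intro!: continuous_intros)
  then show ?thesis using nonpos[OF f] nonpos[of "\<lambda>x. - f x"] by simp
qed

text \<open>If no character distinguishes a from b, all are invariant under translation by
  \<open>c = b - a\<close>. Then the difference of h and its translate by c is orthogonal to every
  character, hence zero, although h differs at a and b.\<close>

theorem characters_separate_points:
  assumes "a \<noteq> b"
  shows "\<exists>\<chi>\<in>characters. \<chi> a \<noteq> \<chi> (b :: 'a)"
proof (rule ccontr)
  assume "\<not> ?thesis"
  then have eq: "\<chi> a = \<chi> b" if "\<chi> \<in> characters" for \<chi> :: "'a \<Rightarrow> complex" using that by blast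
  obtain h :: "'a \<Rightarrow> real" where h: "continuous_on UNIV h" "h a = 1" "h b = 0"
    using compact_space_Urysohn[OF compact_UNIV closed_singleton, of "- {b}" a] assms by auto
  define c where "c = b - a"
  have c1: "\<chi> (c + x) = \<chi> x" if "\<chi> \<in> characters" for \<chi> x
  proof -
    have mult: "\<chi> (x + y) = \<chi> x * \<chi> y" and n: "cmod (\<chi> x) = 1" for x y using that unfolding characters_def by auto
    have "\<chi> a * \<chi> c = \<chi> a" using mult[of a c] eq[OF that] unfolding c_def by simp
    moreover have "\<chi> a \<noteq> 0" using n[of a] by auto
    ultimately show ?thesis unfolding mult by simp
  qed
  let ?f = "\<lambda>x. h x - h (c + x)"
  have ch: "continuous_on UNIV (\<lambda>x. h (c + x))" by (rule continuous_translate[OF h(1)])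
  have tr: "ip (\<lambda>x. h (c + x)) u = ip h u" if "continuous_on UNIV u" "\<And>x. u (c + x) = u x" for u
    using integral_translate_cont[OF continuous_on_mult[OF h(1) that(1)], of c] unfolding ip_def that(2) .
  have "perp ?f"
    unfolding perp_def
  proof
    fix \<chi> :: "'a \<Rightarrow> complex" assume \<chi>: "\<chi> \<in> characters"
    note cc = characters_cont[OF \<chi>]
    show "ip ?f (\<lambda>x. Re (\<chi> x)) = 0 \<and> ip ?f (\<lambda>x. Im (\<chi> x)) = 0"
      using ip_diff[OF h(1) ch cc(2)] ip_diff[OF h(1) ch cc(3)] tr[OF cc(2)] tr[OF cc(3)] c1[OF \<chi>] by simp
  qed
  then have "?f a = 0" using h ch by (intro perp_zero continuous_on_diff)
  then show False using h unfolding c_def by simp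
qed

section \<open>Trigonometric polynomials and epimorphisms\<close>

inductive trig_poly :: "('a \<Rightarrow> complex) \<Rightarrow> bool" where
  trig_char: "\<chi> \<in> characters \<Longrightarrow> trig_poly \<chi>"
| trig_add: "trig_poly f \<Longrightarrow> trig_poly g \<Longrightarrow> trig_poly (\<lambda>x. f x + g x)"
| trig_scale: "trig_poly f \<Longrightarrow> trig_poly (\<lambda>x. c * f x)"

lemma trig_poly_cont: "trig_poly f \<Longrightarrow> continuous_on UNIV f"
  by (induction rule: trig_poly.induct) (auto intro: continuous_intros characters_cont(1))

lemma trig_poly_mult:
  assumes "trig_poly f" "trig_poly g"
  shows "trig_poly (\<lambda>x. f x * g x)"
  using assms(1)
proof (induction rule: trig_poly.induct)
  case (trig_char \<chi>)
  show ?case using assms(2)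
  proof (induction rule: trig_poly.induct)
    case (trig_char \<psi>)
    then show ?case using \<open>\<chi> \<in> characters\<close> by (intro trig_poly.trig_char characters_mult)
  next
    case (trig_add f g)
    then show ?case using trig_poly.trig_add[OF trig_add.IH] by (simp add: distrib_left)
  next
    case (trig_scale f c)
    then show ?case using trig_poly.trig_scale[OF trig_scale.IH, of c] by (simp add: mult_ac)
  qed
next
  case (trig_add f1 f2)
  then show ?case using trig_poly.trig_add[OF trig_add.IH] by (simp add: distrib_right)
next
  case (trig_scale f c)
  then show ?case using trig_poly.trig_scale[OF trig_scale.IH, of c] by (simp add: mult_ac)
qed

lemma trig_poly_Re_Im:
  assumes "\<chi> \<in> characters"
  shows "trig_poly (\<lambda>x. of_real (Re (\<chi> x)))" "trig_poly (\<lambda>x. of_real (Im (\<chi> x)))"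
proof -
  have c: "trig_poly \<chi>" "trig_poly (\<lambda>x. cnj (\<chi> x))"
    using assms characters_cnj by (auto intro: trig_poly.intros)
  have "trig_poly (\<lambda>x. (1/2) * (\<chi> x + cnj (\<chi> x)))" by (intro trig_poly.trig_scale trig_poly.trig_add c)
  moreover have "(1/2) * (\<chi> x + cnj (\<chi> x)) = of_real (Re (\<chi> x))" for x by (simp add: complex_eq_iff)
  ultimately show "trig_poly (\<lambda>x. of_real (Re (\<chi> x)))" by simp
  have "trig_poly (\<lambda>x. (- \<i>/2) * (\<chi> x + (-1) * cnj (\<chi> x)))" by (intro trig_poly.trig_scale trig_poly.trig_add c)
  moreover have "(- \<i>/2) * (\<chi> x + (-1) * cnj (\<chi> x)) = of_real (Im (\<chi> x))" for x by (simp add: complex_eq_iff)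
  ultimately show "trig_poly (\<lambda>x. of_real (Im (\<chi> x)))" by simp
qed

text \<open>Stone-Weierstrass for the real algebra of functions that are trigonometric polynomials
  when read as complex. Two points separated by a character are separated by its real or imaginary
  part.\<close>

lemma trig_poly_dense:
  fixes h :: "'a \<Rightarrow> real"
  assumes h: "continuous_on UNIV h" and e: "e > 0"
  shows "\<exists>p. trig_poly p \<and> (\<forall>x. cmod (of_real (h x) - p x) < e)"
proof -
  let ?R = "{f :: 'a \<Rightarrow> real. trig_poly (\<lambda>x. of_real (f x))}"
  interpret function_ring_on ?R UNIV
  proof
    show "compact (UNIV :: 'a set)" by (rule compact_UNIV)
    show "continuous_on UNIV f" if "f \<in> ?R" for f
      using continuous_on_Re[OF trig_poly_cont, of "\<lambda>x. of_real (f x)"] that by simp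
    show "(\<lambda>x. f x + g x) \<in> ?R" if "f \<in> ?R" "g \<in> ?R" for f g
      using that trig_poly.trig_add[of "\<lambda>x. of_real (f x)" "\<lambda>x. of_real (g x)"] by simp
    show "(\<lambda>x. f x * g x) \<in> ?R" if "f \<in> ?R" "g \<in> ?R" for f g
      using that trig_poly_mult[of "\<lambda>x. of_real (f x)" "\<lambda>x. of_real (g x)"] by simp
    show "(\<lambda>_. c) \<in> ?R" for c
      using trig_poly.trig_scale[OF trig_poly.trig_char[OF characters_one], of "of_real c"] by simp
    show "\<exists>f\<in>?R. f x \<noteq> f y" if xy: "x \<noteq> y" for x y
    proof -
      obtain \<chi> where chi: "\<chi> \<in> characters" "\<chi> x \<noteq> \<chi> y" using characters_separate_points[OF xy] by blast
      then consider "Re (\<chi> x) \<noteq> Re (\<chi> y)" | "Im (\<chi> x) \<noteq> Im (\<chi> y)" by (auto simp: complex_eq_iff)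
      then show ?thesis
      proof cases
        case 1
        then show ?thesis using trig_poly_Re_Im(1)[OF chi(1)] by (intro bexI[of _ "\<lambda>x. Re (\<chi> x)"]) auto
      next
        case 2
        then show ?thesis using trig_poly_Re_Im(2)[OF chi(1)] by (intro bexI[of _ "\<lambda>x. Im (\<chi> x)"]) auto
      qed
    qed
  qed
  obtain g where g: "g \<in> ?R" "\<forall>x. \<bar>h x - g x\<bar> < e" using Stone_Weierstrass_basic[OF h e] by auto
  have "cmod (of_real (h x) - of_real (g x)) = \<bar>h x - g x\<bar>" for x
    by (metis norm_of_real of_real_diff)
  then show ?thesis using g by (intro exI[of _ "\<lambda>x. of_real (g x)"]) auto
qed

text \<open>Translation by some a with \<open>\<chi> a \<noteq> 1\<close> multiplies the integral by
  \<open>\<chi> a\<close> and leaves it unchanged.\<close>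

lemma integral_character:
  assumes "\<chi> \<in> characters"
  shows "(\<integral>x. \<chi> x \<partial>m) = (if \<chi> = (\<lambda>_. 1) then 1 else 0)"
proof (cases "\<chi> = (\<lambda>_. 1)")
  case False
  then obtain a where a: "\<chi> a \<noteq> 1" by auto
  have "(\<integral>x. \<chi> (a + x) \<partial>m) = (\<integral>x. \<chi> x \<partial>m)"
    by (rule integral_translate_cont[OF characters_cont(1)[OF assms]])
  moreover have "\<chi> (a + x) = \<chi> a * \<chi> x" for x using assms unfolding characters_def by auto
  ultimately have "(\<chi> a - 1) * (\<integral>x. \<chi> x \<partial>m) = 0" by (simp add: left_diff_distrib)
  then show ?thesis using a False by simp
qed simp

section \<open>Epimorphisms preserve Haar measure\<close>

lemma epimorphism_cont: "epimorphism T \<Longrightarrow> continuous_on UNIV T"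
  unfolding epimorphism_def continuous_endomorphism_def by simp

lemma cont_epimorphism: "continuous_on UNIV f \<Longrightarrow> epimorphism T \<Longrightarrow> continuous_on UNIV (\<lambda>x. f (T x :: 'a))"
  by (rule continuous_on_compose2[of UNIV]) (auto intro: epimorphism_cont)

text \<open>Surjectivity makes \<open>\<chi> \<circ> T\<close> trivial only if \<chi> is, and the
  integral of a character depends on nothing else.\<close>

lemma integral_trig_epimorphism:
  assumes T: "epimorphism T" and f: "trig_poly f"
  shows "(\<integral>x. f (T x) \<partial>m) = (\<integral>x. f x \<partial>m)"
  using f
proof (induction rule: trig_poly.induct)
  case (trig_char \<chi>)
  have "surj T" using T unfolding epimorphism_def by simp
  then have "\<chi> \<circ> T = (\<lambda>_. 1) \<longleftrightarrow> \<chi> = (\<lambda>_. 1)" by (metis comp_apply surj_def ext)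
  then show ?case
    using integral_character[OF trig_char] integral_character[OF characters_comp[OF _ trig_char], of T] T
    unfolding epimorphism_def comp_def by simp
next
  case (trig_add f g)
  then show ?case
    by (simp add: integrable_cont trig_poly_cont cont_epimorphism[OF trig_poly_cont T])
qed simp

lemma integral_epimorphism:
  fixes h :: "'a \<Rightarrow> real"
  assumes T: "epimorphism T" and h: "continuous_on UNIV h"
  shows "(\<integral>x. h (T x) \<partial>m) = (\<integral>x. h x \<partial>m)"
proof -
  have "\<bar>(\<integral>x. h (T x) \<partial>m) - (\<integral>x. h x \<partial>m)\<bar> \<le> 0 + e" if e: "e > 0" for e
  proof -
    obtain p where p: "trig_poly p" "\<And>x. cmod (of_real (h x) - p x) < e / 2"
      using trig_poly_dense[OF h, of "e / 2"] e by auto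
    have ch: "continuous_on UNIV (\<lambda>x. complex_of_real (h x))" using h by (intro continuous_intros)
    note cT = cont_epimorphism[OF ch T] cont_epimorphism[OF trig_poly_cont[OF p(1)] T]
    have 1: "norm ((\<integral>x. of_real (h (T x)) \<partial>m) - (\<integral>x. p (T x) \<partial>m)) \<le> e / 2 * measure m (space m)"
      using p(2) by (intro integral_close integrable_cont cT finite_measure_axioms less_imp_le)
    have 2: "norm ((\<integral>x. of_real (h x) \<partial>m) - (\<integral>x. p x \<partial>m)) \<le> e / 2 * measure m (space m)"
      using p by (intro integral_close integrable_cont ch trig_poly_cont finite_measure_axioms less_imp_le)
    have "cmod (of_real ((\<integral>x. h (T x) \<partial>m) - (\<integral>x. h x \<partial>m)))
      = norm (((\<integral>x. of_real (h (T x)) \<partial>m) - (\<integral>x. p (T x) \<partial>m)) - ((\<integral>x. of_real (h x) \<partial>m) - (\<integral>x. p x \<partial>m)))"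
      by (simp add: integral_trig_epimorphism[OF T p(1)])
    also have "\<dots> \<le> e / 2 + e / 2"
      using norm_triangle_le_diff 1 2 by (smt (verit) measure_UNIV norm_triangle_ineq4 space_m mult_cancel_left2)
    finally show ?thesis unfolding norm_of_real by simp
  qed
  then have "\<bar>(\<integral>x. h (T x) \<partial>m) - (\<integral>x. h x \<partial>m)\<bar> \<le> 0" by (rule field_le_epsilon)
  then show ?thesis by simp
qed

lemma inner_regular:
  assumes "B \<in> sets borel" "e > 0"
  shows "\<exists>K. compact K \<and> K \<subseteq> B \<and> measure m B < measure m K + e"
proof -
  have eq: "emeasure m B = (SUP K\<in>{K. compact K \<and> K \<subseteq> B}. emeasure m K)"
    using haar assms(1) unfolding normalized_haar_measure_def by blast
  show ?thesis
  proof (cases "measure m B < e")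
    case True
    then show ?thesis using measure_nonneg[of m] by (intro exI[of _ "{}"]) auto
  next
    case False
    have "ennreal (measure m B - e) < emeasure m B"
      unfolding emeasure_eq_measure using assms(2) False by (intro ennreal_lessI) auto
    then obtain K where K: "compact K" "K \<subseteq> B" "ennreal (measure m B - e) < emeasure m K"
      unfolding eq less_SUP_iff by auto
    then have "measure m B - e < measure m K"
      unfolding emeasure_eq_measure using False by (simp add: ennreal_less_iff)
    then show ?thesis using K by (intro exI[of _ K]) auto
  qed
qed

lemma outer_regular:
  assumes "B \<in> sets borel" "e > 0"
  shows "\<exists>U. open U \<and> B \<subseteq> U \<and> measure m U < measure m B + e"
proof -
  obtain K where K: "compact K" "K \<subseteq> - B" "measure m (- B) < measure m K + e"
    using inner_regular[of "- B" e] assms by auto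
  have cl: "closed K" using K(1) by (rule compact_imp_closed)
  have "measure m (- B) = 1 - measure m B" "measure m (- K) = 1 - measure m K"
    using finite_measure_compl[of B] finite_measure_compl[of K] assms(1) cl by (simp_all add: Compl_eq_Diff_UNIV)
  then show ?thesis using K cl by (intro exI[of _ "- K"]) auto
qed

lemma measurable_cont_fun: "continuous_on UNIV T \<Longrightarrow> T \<in> measurable m m"
  unfolding measurable_cong_sets[OF sets_m sets_m] by (rule borel_measurable_continuous_onI)

lemma integral_between:
  fixes h :: "'a \<Rightarrow> real"
  assumes h: "continuous_on UNIV h" "\<And>x. 0 \<le> h x" "\<And>x. h x \<le> 1"
  shows "A \<in> sets borel \<Longrightarrow> (\<And>x. x \<in> A \<Longrightarrow> h x = 1) \<Longrightarrow> measure m A \<le> (\<integral>x. h x \<partial>m)"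
    and "A \<in> sets borel \<Longrightarrow> (\<And>x. x \<notin> A \<Longrightarrow> h x = 0) \<Longrightarrow> (\<integral>x. h x \<partial>m) \<le> measure m A"
proof -
  have i: "integrable m (indicator A :: 'a \<Rightarrow> real)" if "A \<in> sets borel" for A
    using that by (intro integrable_real_indicator) (auto simp: emeasure_eq_measure)
  have ie: "measure m A = (\<integral>x. indicator A x \<partial>m)" for A by simp
  show "measure m A \<le> (\<integral>x. h x \<partial>m)" if "A \<in> sets borel" "\<And>x. x \<in> A \<Longrightarrow> h x = 1"
    unfolding ie[of A] using that h by (intro integral_mono i integrable_cont) (auto simp: indicator_def)
  show "(\<integral>x. h x \<partial>m) \<le> measure m A" if "A \<in> sets borel" "\<And>x. x \<notin> A \<Longrightarrow> h x = 0"
    unfolding ie[of A] using that h by (intro integral_mono i integrable_cont) (auto simp: indicator_def)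
qed

text \<open>A Urysohn function between a compact set and U compares the measures, as its integral is
  invariant under T. For the upper bound on the preimage the compact set K lies in
  \<open>T -\<close> U\<open>, and the function is taken between\<close>T \<open>K\<close> and
  U.\<close>

lemma epimorphism_open_measure:
  assumes T: "epimorphism T" and U: "open U"
  shows "measure m (T -` U) = measure m U"
proof (rule antisym)
  have c: "continuous_on UNIV T" using T by (rule epimorphism_cont)
  have TU: "open (T -` U)" using U c by (simp add: open_vimage)
  have Us: "U \<in> sets borel" "T -` U \<in> sets borel" using U TU by auto
  show "measure m U \<le> measure m (T -` U)"
  proof (rule field_le_epsilon)
    fix e :: real assume "e > 0"
    then obtain K where K: "compact K" "K \<subseteq> U" "measure m U < measure m K + e"
      using inner_regular[OF Us(1)] by blast
    have cl: "closed K" using K(1) by (rule compact_imp_closed)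
    obtain h :: "'a \<Rightarrow> real" where h: "continuous_on UNIV h" "\<And>x. 0 \<le> h x" "\<And>x. h x \<le> 1"
      "\<And>x. x \<in> K \<Longrightarrow> h x = 1" "\<And>x. x \<notin> U \<Longrightarrow> h x = 0"
      using compact_space_Urysohn[OF compact_UNIV cl U K(2)] by blast
    have "measure m K \<le> (\<integral>x. h x \<partial>m)" using h cl by (intro integral_between) auto
    also have "\<dots> = (\<integral>x. h (T x) \<partial>m)" by (rule integral_epimorphism[OF T h(1), symmetric])
    also have "\<dots> \<le> measure m (T -` U)" using integral_between(2)[OF cont_epimorphism[OF h(1) T], of "T -` U"] h Us by auto
    finally show "measure m U \<le> measure m (T -` U) + e" using K(3) by simp
  qed
  show "measure m (T -` U) \<le> measure m U"
  proof (rule field_le_epsilon)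
    fix e :: real assume "e > 0"
    then obtain K where K: "compact K" "K \<subseteq> T -` U" "measure m (T -` U) < measure m K + e"
      using inner_regular[OF Us(2)] by blast
    have "compact (T ` K)" using K(1) c by (intro compact_continuous_image) (auto intro: continuous_on_subset)
    then have cl: "closed (T ` K)" "closed K" using K(1) compact_imp_closed by auto
    have KU: "T ` K \<subseteq> U" using K(2) by auto
    obtain h :: "'a \<Rightarrow> real" where h: "continuous_on UNIV h" "\<And>x. 0 \<le> h x" "\<And>x. h x \<le> 1"
      "\<And>x. x \<in> T ` K \<Longrightarrow> h x = 1" "\<And>x. x \<notin> U \<Longrightarrow> h x = 0"
      using compact_space_Urysohn[OF compact_UNIV cl(1) U KU] by auto
    have "measure m K \<le> (\<integral>x. h (T x) \<partial>m)" using integral_between(1)[OF cont_epimorphism[OF h(1) T], of K] h cl by auto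
    also have "\<dots> = (\<integral>x. h x \<partial>m)" by (rule integral_epimorphism[OF T h(1)])
    also have "\<dots> \<le> measure m U" using h Us by (intro integral_between) auto
    finally show "measure m (T -` U) \<le> measure m U + e" using K(3) by simp
  qed
qed

lemma distr_epimorphism:
  assumes T: "epimorphism T"
  shows "distr m m T = m"
proof (rule measure_eqI_generator_eq[where E = "Collect open" and \<Omega> = UNIV and A = "\<lambda>_. UNIV"])
  note T' = measurable_cont_fun[OF epimorphism_cont[OF T]]
  show "Int_stable (Collect open :: 'a set set)" by (auto intro!: Int_stableI)
  show "emeasure (distr m m T) X = emeasure m X" if "X \<in> Collect open" for X
    using that epimorphism_open_measure[OF T, of X]
    by (subst emeasure_distr[OF T']) (auto simp: emeasure_eq_measure)
  show "sets (distr m m T) = sigma_sets UNIV (Collect open)" "sets m = sigma_sets UNIV (Collect open)"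
    by (simp_all add: borel_def)
  show "emeasure (distr m m T) UNIV \<noteq> \<infinity>" by (subst emeasure_distr[OF T']) auto
qed auto

lemma epimorphism_pow: "epimorphism (T :: 'a \<Rightarrow> 'a) \<Longrightarrow> epimorphism (T ^^ n)"
proof (induction n)
  case 0
  then show ?case by (auto simp: epimorphism_def continuous_endomorphism_def)
next
  case (Suc n)
  have "continuous_on UNIV (T \<circ> T ^^ n)"
    using Suc by (intro continuous_on_compose continuous_on_subset[OF epimorphism_cont[OF Suc.prems]] epimorphism_cont) auto
  moreover have "surj (T \<circ> T ^^ n)" using Suc unfolding epimorphism_def by (intro comp_surj) auto
  ultimately show ?case using Suc unfolding epimorphism_def continuous_endomorphism_def by simp
qed

lemma indicator_trig_approx:
  assumes B: "B \<in> sets borel" and e: "e > 0"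
  shows "\<exists>g. trig_poly g \<and> (\<forall>x. cmod (g x) \<le> 2) \<and> (\<integral>x. cmod (indicator B x - g x) \<partial>m) < e"
proof -
  obtain K where K: "compact K" "K \<subseteq> B" "measure m B < measure m K + e / 4"
    using inner_regular[OF B, of "e / 4"] e by auto
  obtain U where U: "open U" "B \<subseteq> U" "measure m U < measure m B + e / 4"
    using outer_regular[OF B, of "e / 4"] e by auto
  have cl: "closed K" using K(1) by (rule compact_imp_closed)
  have KU: "K \<subseteq> U" using K(2) U(2) by auto
  obtain h :: "'a \<Rightarrow> real" where h: "continuous_on UNIV h" "\<And>x. 0 \<le> h x" "\<And>x. h x \<le> 1"
    "\<And>x. x \<in> K \<Longrightarrow> h x = 1" "\<And>x. x \<notin> U \<Longrightarrow> h x = 0"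
    using compact_space_Urysohn[OF compact_UNIV cl U(1) KU] by blast
  \<comment> \<open>One half of e goes here, the other half to the measure of \<open>U - K\<close>.
    The cap 1, added to the bound 1 of h, gives the bound 2 of the lemma.\<close>
  define e' where "e' = min (e / 2) 1"
  have e': "e' > 0" "e' \<le> e / 2" "e' \<le> 1" using e unfolding e'_def by auto
  obtain p where p: "trig_poly p" "\<And>x. cmod (of_real (h x) - p x) < e'"
    using trig_poly_dense[OF h(1) e'(1)] by auto
  have "cmod (p x) \<le> 2" for x
  proof -
    have "cmod (p x) \<le> cmod (of_real (h x)) + cmod (of_real (h x) - p x)"
      by (metis norm_minus_commute norm_triangle_sub)
    also have "\<dots> \<le> 1 + 1" using h(2,3)[of x] p(2)[of x] e' by (intro add_mono) auto
    finally show ?thesis by simp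
  qed
  moreover have "(\<integral>x. cmod (indicator B x - p x) \<partial>m) < e"
  proof -
    have sets: "U - K \<in> sets borel" using U(1) cl by auto
    have pt: "cmod (indicator B x - p x) \<le> indicator (U - K) x + e'" for x
    proof -
      have "cmod (indicator B x - p x) \<le> cmod (indicator B x - of_real (h x)) + cmod (of_real (h x) - p x)"
        using norm_triangle_ineq[of "indicator B x - of_real (h x)" "of_real (h x) - p x"] by simp
      moreover have "cmod (indicator B x - of_real (h x)) \<le> indicator (U - K) x"
      proof -
        have "cmod (indicator B x - of_real (h x)) = \<bar>indicator B x - h x\<bar>"
          by (metis norm_of_real of_real_diff of_real_indicator)
        also have "\<dots> \<le> indicator (U - K) x" using h(2,3)[of x] h(4,5) K(2) U(2) by (auto simp: indicator_def)
        finally show ?thesis .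
      qed
      ultimately show ?thesis using p(2)[of x] by linarith
    qed
    have "(\<integral>x. cmod (indicator B x - p x) \<partial>m) \<le> (\<integral>x. indicator (U - K) x + e' \<partial>m)"
    proof (rule integral_mono)
      show "integrable m (\<lambda>x. indicat_real (U - K) x + e')"
        using sets by (intro Bochner_Integration.integrable_add integrable_real_indicator) (auto simp: emeasure_eq_measure)
      have "integrable m (\<lambda>x. complex_of_real (indicator B x))"
        using B by (intro integrable_of_real integrable_real_indicator) (auto simp: emeasure_eq_measure)
      then have "integrable m (\<lambda>x. indicator B x :: complex)" by (simp add: of_real_indicator)
      then have "integrable m (\<lambda>x. indicator B x - p x)"
        by (intro Bochner_Integration.integrable_diff integrable_cont[OF trig_poly_cont[OF p(1)]])
      then show "integrable m (\<lambda>x. cmod (indicator B x - p x))" by (rule integrable_norm)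
    qed (rule pt)
    also have "\<dots> = measure m (U - K) + e'"
      using sets by (subst Bochner_Integration.integral_add) (auto simp: emeasure_eq_measure)
    also have "measure m (U - K) = measure m U - measure m K"
      using U(1) cl KU by (intro finite_measure_Diff) auto
    finally show ?thesis using K(3) U(3) e'(2) e by linarith
  qed
  ultimately show ?thesis using p(1) by blast
qed

end

section \<open>Mixing and relations between characters\<close>

locale epimorphism_family = compact_haar m
  for m :: "'a::{topological_ab_group_add, t2_space} measure" +
  fixes I :: "'k set" and T :: "'k \<Rightarrow> 'a \<Rightarrow> 'a"
  assumes finite_I: "finite I" and epi: "k \<in> I \<Longrightarrow> epimorphism (T k)"
begin

section \<open>Correlations along the iterates\<close>

text \<open>For indicator functions this is the difference of the two sides in the definition of
  mixing.\<close>

definition corr :: "('k \<Rightarrow> 'a \<Rightarrow> complex) \<Rightarrow> nat \<Rightarrow> complex" where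
  "corr f n = (\<integral>x. (\<Prod>k\<in>I. f k ((T k ^^ n) x)) \<partial>m) - (\<Prod>k\<in>I. \<integral>x. f k x \<partial>m)"

text \<open>A class that contains indicators of Borel sets as well as trigonometric polynomials and
  is closed under products and composition with the iterates, so that all integrals in
  \<open>corr\<close> exist.\<close>

definition admissible :: "('a \<Rightarrow> complex) \<Rightarrow> bool" where
  "admissible g \<longleftrightarrow> g \<in> borel_measurable m \<and> (\<exists>C. \<forall>x. cmod (g x) \<le> C)"

lemma admissible_integrable: "admissible g \<Longrightarrow> integrable m g"
  unfolding admissible_def by (auto intro!: integrable_const_bound)

lemma admissible_cont: "continuous_on UNIV g \<Longrightarrow> admissible g"
  unfolding admissible_def
  using continuous_bounded_on_compact_space[OF compact_UNIV] measurable_cont by blast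

lemma admissible_comp: "admissible g \<Longrightarrow> k \<in> I \<Longrightarrow> admissible (\<lambda>x. g ((T k ^^ n) x))"
  unfolding admissible_def
  using measurable_compose[OF measurable_cont_fun[OF epimorphism_cont[OF epimorphism_pow[OF epi]]], of k g borel n] by blast

lemma admissible_mult:
  assumes "admissible f" "admissible g"
  shows "admissible (\<lambda>x. f x * g x)"
proof -
  obtain C D where "\<And>x. cmod (f x) \<le> C" "\<And>x. cmod (g x) \<le> D" using assms unfolding admissible_def by auto
  then have "cmod (f x * g x) \<le> C * D" for x
    unfolding norm_mult by (intro mult_mono) (auto intro: order_trans[OF norm_ge_zero])
  then show ?thesis using assms unfolding admissible_def by auto
qed

lemma admissible_prod: "(\<And>k. k \<in> S \<Longrightarrow> admissible (f k)) \<Longrightarrow> admissible (\<lambda>x. \<Prod>k\<in>S. f k x)"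
proof (induction S rule: infinite_finite_induct)
  case (insert k S)
  then show ?case using admissible_mult[of "f k" "\<lambda>x. \<Prod>k\<in>S. f k x"] by simp
qed (simp_all add: admissible_cont)

lemma admissible_prod_comp:
  "(\<And>k. k \<in> S \<Longrightarrow> admissible (f k)) \<Longrightarrow> S \<subseteq> I \<Longrightarrow> admissible (\<lambda>x. \<Prod>k\<in>S. f k ((T k ^^ n) x))"
  by (rule admissible_prod, rule admissible_comp) auto

lemma integral_comp:
  fixes g :: "'a \<Rightarrow> 'b::{banach, second_countable_topology}"
  shows "g \<in> borel_measurable m \<Longrightarrow> k \<in> I \<Longrightarrow> (\<integral>x. g ((T k ^^ n) x) \<partial>m) = (\<integral>x. g x \<partial>m)"
  using integral_distr[OF measurable_cont_fun[OF epimorphism_cont[OF epimorphism_pow[OF epi]]], of k g n]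
  by (simp add: distr_epimorphism epimorphism_pow epi)

lemma corr_remove:
  assumes "j \<in> I"
  shows "corr (f(j := g)) n = (\<integral>x. g ((T j ^^ n) x) * (\<Prod>k\<in>I - {j}. f k ((T k ^^ n) x)) \<partial>m)
    - (\<integral>x. g x \<partial>m) * (\<Prod>k\<in>I - {j}. \<integral>x. f k x \<partial>m)"
  unfolding corr_def using assms by (simp add: prod.remove[OF finite_I assms] cong: prod.cong_simp)

lemma corr_add:
  assumes j: "j \<in> I" and f: "\<And>k. k \<in> I - {j} \<Longrightarrow> admissible (f k)" and g: "admissible g" "admissible h"
  shows "corr (f(j := (\<lambda>x. g x + h x))) n = corr (f(j := g)) n + corr (f(j := h)) n"
proof -
  let ?R = "\<lambda>x. \<Prod>k\<in>I - {j}. f k ((T k ^^ n) x)"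
  have R: "admissible ?R" using f by (intro admissible_prod_comp) auto
  have i: "integrable m (\<lambda>x. u ((T j ^^ n) x) * ?R x)" if "admissible u" for u
    by (intro admissible_integrable admissible_mult admissible_comp[OF that j] R)
  show ?thesis
    unfolding corr_remove[OF j] using i[OF g(1)] i[OF g(2)] admissible_integrable[OF g(1)] admissible_integrable[OF g(2)]
    by (simp add: distrib_right)
qed

lemma corr_scale:
  assumes j: "j \<in> I"
  shows "corr (f(j := (\<lambda>x. c * g x))) n = c * corr (f(j := g)) n"
  unfolding corr_remove[OF j] by (simp add: mult.assoc right_diff_distrib)

lemma corr_trig:
  assumes j: "j \<in> I" and f: "\<And>k. k \<in> I - {j} \<Longrightarrow> admissible (f k)" and g: "trig_poly g"
    and base: "\<And>\<chi>. \<chi> \<in> characters \<Longrightarrow> corr (f(j := \<chi>)) \<longlonglongrightarrow> 0"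
  shows "corr (f(j := g)) \<longlonglongrightarrow> 0"
  using g
proof (induction rule: trig_poly.induct)
  case (trig_add g h)
  have eq: "corr (f(j := (\<lambda>x. g x + h x))) = (\<lambda>n. corr (f(j := g)) n + corr (f(j := h)) n)"
    using trig_add.hyps by (intro ext corr_add j f admissible_cont trig_poly_cont)
  show ?case using tendsto_add[OF trig_add.IH] unfolding eq add_0 .
next
  case (trig_scale g c)
  have eq: "corr (f(j := (\<lambda>x. c * g x))) = (\<lambda>n. c * corr (f(j := g)) n)"
    by (intro ext corr_scale j)
  show ?case using tendsto_mult_left[OF trig_scale.IH, of c] unfolding eq mult_zero_right .
qed (rule base)

text \<open>The bound does not depend on n because the iterates preserve m. Exchanging one factor
  changes both terms of \<open>corr\<close>, and in each the remaining factors contribute at most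
  \<open>2 ^ card I\<close>; hence the exponent \<open>Suc (card I)\<close>.\<close>

lemma corr_close:
  assumes j: "j \<in> I" and f: "\<And>k. k \<in> I \<Longrightarrow> f k \<in> borel_measurable m" "\<And>k x. k \<in> I \<Longrightarrow> cmod (f k x) \<le> 2"
    and g: "admissible g"
  shows "cmod (corr f n - corr (f(j := g)) n) \<le> 2 ^ Suc (card I) * (\<integral>x. cmod (f j x - g x) \<partial>m)"
proof -
  let ?R = "\<lambda>x. \<Prod>k\<in>I - {j}. f k ((T k ^^ n) x)"
  let ?P = "\<Prod>k\<in>I - {j}. \<integral>x. f k x \<partial>m"
  let ?D = "\<integral>x. cmod (f j x - g x) \<partial>m"
  have adm: "admissible (f k)" if "k \<in> I" for k using f that unfolding admissible_def by auto
  have R: "admissible ?R" using adm by (intro admissible_prod_comp) auto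
  have pow: "2 ^ card (I - {j}) \<le> (2::real) ^ card I" by (intro power_increasing card_mono finite_I) auto
  have Rb: "cmod (?R x) \<le> 2 ^ card I" for x
  proof -
    have "cmod (?R x) \<le> (\<Prod>k\<in>I - {j}. 2)"
      unfolding prod_norm[symmetric] using f by (intro prod_mono) auto
    also have "\<dots> = 2 ^ card (I - {j})" by (rule prod_constant)
    finally show ?thesis using pow by (rule order_trans)
  qed
  have Pb: "cmod ?P \<le> 2 ^ card I"
  proof -
    have "cmod (\<integral>x. f k x \<partial>m) \<le> 2" if "k \<in> I" for k
    proof -
      have "cmod (\<integral>x. f k x \<partial>m) \<le> (\<integral>x. cmod (f k x) \<partial>m)" by (rule integral_norm_bound)
      also have "\<dots> \<le> (\<integral>x. 2 \<partial>m)"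
        using f that admissible_integrable[OF adm[OF that]] by (intro integral_mono) auto
      finally show ?thesis by simp
    qed
    then have "cmod ?P \<le> (\<Prod>k\<in>I - {j}. 2)"
      unfolding prod_norm[symmetric] by (intro prod_mono) auto
    also have "\<dots> = 2 ^ card (I - {j})" by (rule prod_constant)
    finally show ?thesis using pow by (rule order_trans)
  qed
  define d where "d x = f j x - g x" for x
  have d: "admissible d"
  proof -
    obtain C where C: "\<And>x. cmod (g x) \<le> C" using g unfolding admissible_def by auto
    have "cmod (d x) \<le> 2 + C" for x
      unfolding d_def using norm_triangle_ineq4[of "f j x" "g x"] f(2)[OF j, of x] C[of x] by linarith
    then show ?thesis using f(1)[OF j] g unfolding admissible_def d_def[abs_def] by auto
  qed
  have dj: "admissible (\<lambda>x. d ((T j ^^ n) x))" by (rule admissible_comp[OF d j])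
  have i: "integrable m (\<lambda>x. u ((T j ^^ n) x) * ?R x)" if "admissible u" for u
    by (intro admissible_integrable admissible_mult admissible_comp[OF that j] R)
  have "corr f n - corr (f(j := g)) n = corr (f(j := f j)) n - corr (f(j := g)) n" by simp
  also have "\<dots> = (\<integral>x. d ((T j ^^ n) x) * ?R x \<partial>m) - (\<integral>x. d x \<partial>m) * ?P"
    unfolding corr_remove[OF j] d_def
    using i[OF adm[OF j]] i[OF g] admissible_integrable[OF adm[OF j]] admissible_integrable[OF g]
    by (simp add: left_diff_distrib)
  finally have eq: "corr f n - corr (f(j := g)) n = (\<integral>x. d ((T j ^^ n) x) * ?R x \<partial>m) - (\<integral>x. d x \<partial>m) * ?P" .
  have "cmod (\<integral>x. d ((T j ^^ n) x) * ?R x \<partial>m) \<le> (\<integral>x. cmod (d ((T j ^^ n) x) * ?R x) \<partial>m)"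
    by (rule integral_norm_bound)
  also have "\<dots> \<le> (\<integral>x. cmod (d ((T j ^^ n) x)) * 2 ^ card I \<partial>m)"
  proof (rule integral_mono)
    show "integrable m (\<lambda>x. cmod (d ((T j ^^ n) x) * ?R x))"
      by (intro integrable_norm admissible_integrable admissible_mult dj R)
    show "integrable m (\<lambda>x. cmod (d ((T j ^^ n) x)) * 2 ^ card I)"
      using integrable_norm[OF admissible_integrable[OF dj]] by simp
    show "cmod (d ((T j ^^ n) x) * ?R x) \<le> cmod (d ((T j ^^ n) x)) * 2 ^ card I" for x
      unfolding norm_mult using Rb by (intro mult_left_mono) auto
  qed
  also have "\<dots> = 2 ^ card I * ?D"
  proof -
    have "(\<lambda>x. cmod (d x)) \<in> borel_measurable m" by (rule borel_measurable_integrable[OF integrable_norm[OF admissible_integrable[OF d]]])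
    from integral_comp[OF this j, of n] show ?thesis unfolding d_def by simp
  qed
  finally have 1: "cmod (\<integral>x. d ((T j ^^ n) x) * ?R x \<partial>m) \<le> 2 ^ card I * ?D" .
  have "cmod (\<integral>x. d x \<partial>m) \<le> ?D" unfolding d_def by (rule integral_norm_bound)
  then have 2: "cmod ((\<integral>x. d x \<partial>m) * ?P) \<le> ?D * 2 ^ card I"
    unfolding norm_mult using Pb by (intro mult_mono) auto
  have "cmod (corr f n - corr (f(j := g)) n) \<le> 2 ^ card I * ?D + ?D * 2 ^ card I"
    unfolding eq by (rule order_trans[OF norm_triangle_ineq4 add_mono[OF 1 2]])
  then show ?thesis by (simp add: mult_ac)
qed

lemma corr_limit:
  assumes j: "j \<in> I" and f: "\<And>k. k \<in> I \<Longrightarrow> f k \<in> borel_measurable m" "\<And>k x. k \<in> I \<Longrightarrow> cmod (f k x) \<le> 2"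
    and approx: "\<And>e. e > 0 \<Longrightarrow> \<exists>g. admissible g \<and> (\<integral>x. cmod (f j x - g x) \<partial>m) < e \<and> corr (f(j := g)) \<longlonglongrightarrow> 0"
  shows "corr f \<longlonglongrightarrow> 0"
proof (rule tendstoI)
  fix e :: real assume e: "e > 0"
  let ?c = "2 ^ Suc (card I) :: real"
  obtain g where g: "admissible g" "(\<integral>x. cmod (f j x - g x) \<partial>m) < e / 2 / ?c" "corr (f(j := g)) \<longlonglongrightarrow> 0"
    using approx[of "e / 2 / ?c"] e by auto
  have "\<forall>\<^sub>F n in sequentially. dist (corr (f(j := g)) n) 0 < e / 2"
    using tendstoD[OF g(3), of "e / 2"] e by simp
  then show "\<forall>\<^sub>F n in sequentially. dist (corr f n) 0 < e"
  proof eventually_elim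
    case (elim n)
    have "cmod (corr f n - corr (f(j := g)) n) \<le> ?c * (\<integral>x. cmod (f j x - g x) \<partial>m)"
      by (rule corr_close[OF j f g(1)])
    also have "\<dots> < e / 2" using g(2) by (simp add: field_simps)
    finally have "cmod (corr f n) < e"
      using elim norm_triangle_ineq[of "corr f n - corr (f(j := g)) n" "corr (f(j := g)) n"] by simp
    then show ?case by simp
  qed
qed

text \<open>Indicators are exchanged for characters one position at a time: an indicator is close in
  mean to a trigonometric polynomial, and linearity in that position reduces the polynomial to
  characters. J is the set of positions still to be exchanged.\<close>

lemma corr_indicators:
  assumes chars: "\<And>\<chi>. (\<And>k. k \<in> I \<Longrightarrow> \<chi> k \<in> characters) \<Longrightarrow> corr \<chi> \<longlonglongrightarrow> 0"
    and "J \<subseteq> I" "\<And>k. k \<in> J \<Longrightarrow> \<exists>B\<in>sets borel. f k = indicator B" "\<And>k. k \<in> I - J \<Longrightarrow> f k \<in> characters"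
  shows "corr f \<longlonglongrightarrow> 0"
proof -
  have "finite J" using assms(2) finite_I finite_subset by blast
  then show ?thesis using assms(2-)
  proof (induction J arbitrary: f)
    case empty
    then show ?case by (intro chars) auto
  next
    case (insert j J)
    have j: "j \<in> I" using insert.prems by auto
    have ind: "\<exists>B\<in>sets borel. f k = indicator B" if "k \<in> insert j J" for k using insert.prems that by blast
    have meas: "f k \<in> borel_measurable m" if "k \<in> I" for k
    proof (cases "k \<in> insert j J")
      case True
      then obtain B where B: "B \<in> sets borel" "f k = indicator B" using ind by blast
      show ?thesis unfolding B(2) using B(1) by (intro borel_measurable_indicator) simp
    next
      case False
      then show ?thesis using insert.prems(3) that by (intro measurable_cont characters_cont) auto
    qed
    have bound: "cmod (f k x) \<le> 2" if "k \<in> I" for k x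
    proof (cases "k \<in> insert j J")
      case True
      then obtain B where "f k = indicator B" using ind by blast
      then show ?thesis by (simp add: indicator_def)
    next
      case False
      then have "cmod (f k x) = 1" using insert.prems(3)[of k] that unfolding characters_def by auto
      then show ?thesis by simp
    qed
    have adm: "admissible (f k)" if "k \<in> I" for k using meas bound that unfolding admissible_def by blast
    obtain B where B: "B \<in> sets borel" "f j = indicator B" using ind by blast
    show ?case
    proof (rule corr_limit[OF j meas bound])
      fix e :: real assume e: "e > 0"
      obtain g where g: "trig_poly g" "(\<integral>x. cmod (indicator B x - g x) \<partial>m) < e"
        using indicator_trig_approx[OF B(1) e] by blast
      have "corr (f(j := g)) \<longlonglongrightarrow> 0"
      proof (rule corr_trig[OF j _ g(1)])
        show "admissible (f k)" if "k \<in> I - {j}" for k using adm that by blast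
        show "corr (f(j := \<chi>)) \<longlonglongrightarrow> 0" if chi: "\<chi> \<in> characters" for \<chi>
        proof (rule insert.IH)
          show "J \<subseteq> I" using insert.prems by auto
          show "\<exists>B\<in>sets borel. (f(j := \<chi>)) k = indicator B" if "k \<in> J" for k
            using that insert.hyps ind by (metis fun_upd_other insertCI)
          show "(f(j := \<chi>)) k \<in> characters" if "k \<in> I - J" for k
            using that chi insert.prems(3) by auto
        qed
      qed
      then show "\<exists>g. admissible g \<and> (\<integral>x. cmod (f j x - g x) \<partial>m) < e \<and> corr (f(j := g)) \<longlonglongrightarrow> 0"
        using g B(2) admissible_cont[OF trig_poly_cont[OF g(1)]] by auto
    qed
  qed
qed

section \<open>From Borel sets to the completion\<close>

lemma measure_completion_sandwich:
  assumes "A \<in> sets m" "N \<in> null_sets m" "A \<subseteq> X" "X \<subseteq> A \<union> N"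
  shows "measure (completion m) X = measure m A"
proof -
  have "X - A \<in> sets (completion m)" using assms by (intro sets_completionI_sub[OF assms(2)]) auto
  then have "A \<union> (X - A) \<in> sets (completion m)" using assms(1) by (intro sets.Un) auto
  moreover have "A \<union> (X - A) = X" using assms(3) by auto
  ultimately have X: "X \<in> sets (completion m)" by simp
  have AN: "A \<union> N \<in> sets m" using assms by auto
  have "emeasure (completion m) A \<le> emeasure (completion m) X" by (rule emeasure_mono[OF assms(3) X])
  moreover have "emeasure (completion m) X \<le> emeasure (completion m) (A \<union> N)"
    using AN by (intro emeasure_mono[OF assms(4)]) auto
  ultimately have "emeasure (completion m) X = emeasure m A"
    using assms(1,2) AN by (simp add: emeasure_Un_null_set del: emeasure_completion) (simp add: emeasure_Un_null_set)
  then show ?thesis by (simp add: measure_def)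
qed

text \<open>Each \<open>B k\<close> differs from a Borel set \<open>A k\<close> by part of a null
  set. Preimages of null sets under the iterates are null by invariance, so the intersections differ
  by part of a finite union of null sets.\<close>

lemma mixing_family_if_corr:
  assumes chars: "\<And>\<chi>. (\<And>k. k \<in> I \<Longrightarrow> \<chi> k \<in> characters) \<Longrightarrow> corr \<chi> \<longlonglongrightarrow> 0"
    and ne: "I \<noteq> {}" and B: "\<And>k. k \<in> I \<Longrightarrow> B k \<in> sets (completion m)"
  shows "(\<lambda>n. measure (completion m) (\<Inter>k\<in>I. (T k ^^ n) -` B k)) \<longlonglongrightarrow> (\<Prod>k\<in>I. measure (completion m) (B k))"
proof -
  have "\<exists>A N. A \<in> sets m \<and> N \<in> null_sets m \<and> A \<subseteq> B k \<and> B k \<subseteq> A \<union> N" if "k \<in> I" for k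
    using sets_completionE[OF B[OF that]] by (metis Un_mono order_refl sup_ge1)
  then obtain A N where AN: "\<And>k. k \<in> I \<Longrightarrow> A k \<in> sets m" "\<And>k. k \<in> I \<Longrightarrow> N k \<in> null_sets m"
    "\<And>k. k \<in> I \<Longrightarrow> A k \<subseteq> B k" "\<And>k. k \<in> I \<Longrightarrow> B k \<subseteq> A k \<union> N k" by metis
  have Bk: "measure (completion m) (B k) = measure m (A k)" if "k \<in> I" for k
    using AN[OF that] by (intro measure_completion_sandwich) auto
  have meas: "T k ^^ n \<in> measurable m m" if "k \<in> I" for k n
    using that by (intro measurable_cont_fun epimorphism_cont epimorphism_pow epi)
  have pre: "(T k ^^ n) -` S \<in> sets m" if "k \<in> I" "S \<in> sets m" for k n S
    using measurable_sets[OF meas[OF that(1)] that(2)] by simp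
  have null: "(T k ^^ n) -` N k \<in> null_sets m" if "k \<in> I" for k n
  proof (rule null_setsI)
    have N: "N k \<in> sets m" "emeasure m (N k) = 0" using AN(2)[OF that] by auto
    show "(T k ^^ n) -` N k \<in> sets m" by (rule pre[OF that N(1)])
    show "emeasure m ((T k ^^ n) -` N k) = 0"
      using N emeasure_distr[OF meas[OF that], of "N k" n] by (simp add: distr_epimorphism epimorphism_pow epi that)
  qed
  have inter: "(\<Inter>k\<in>I. (T k ^^ n) -` A k) \<in> sets m" for n
    using pre AN(1) finite_I ne by (intro sets.finite_INT) auto
  have In: "measure (completion m) (\<Inter>k\<in>I. (T k ^^ n) -` B k) = measure m (\<Inter>k\<in>I. (T k ^^ n) -` A k)" for n
  proof (rule measure_completion_sandwich)
    show "(\<Inter>k\<in>I. (T k ^^ n) -` A k) \<in> sets m" by (rule inter)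
    show "(\<Union>k\<in>I. (T k ^^ n) -` N k) \<in> null_sets m"
      using null finite_I by (intro null_sets_UN') (auto intro: countable_finite)
    show "(\<Inter>k\<in>I. (T k ^^ n) -` A k) \<subseteq> (\<Inter>k\<in>I. (T k ^^ n) -` B k)" using AN(3) by blast
    show "(\<Inter>k\<in>I. (T k ^^ n) -` B k) \<subseteq> (\<Inter>k\<in>I. (T k ^^ n) -` A k) \<union> (\<Union>k\<in>I. (T k ^^ n) -` N k)"
      using AN(4) by blast
  qed
  define f where "f k = (indicator (A k) :: 'a \<Rightarrow> complex)" for k
  have "corr f \<longlonglongrightarrow> 0"
    by (rule corr_indicators[OF chars, of I]) (use AN(1) in \<open>auto simp: f_def\<close>)
  moreover have eq: "corr f n = of_real (measure m (\<Inter>k\<in>I. (T k ^^ n) -` A k) - (\<Prod>k\<in>I. measure m (A k)))" for n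
  proof -
    have ind: "(\<integral>x. indicator S x \<partial>m) = complex_of_real (measure m S)" if "S \<in> sets m" for S
    proof -
      have "(\<integral>x. indicator S x \<partial>m) = (\<integral>x. complex_of_real (indicator S x) \<partial>m)" by (simp add: of_real_indicator)
      also have "\<dots> = complex_of_real (\<integral>x. indicator S x \<partial>m)" by (rule integral_complex_of_real)
      finally show ?thesis by simp
    qed
    have "(\<Prod>k\<in>I. f k ((T k ^^ n) x)) = indicator (\<Inter>k\<in>I. (T k ^^ n) -` A k) x" for x
      unfolding f_def using finite_I by (auto simp: indicator_def prod_zero_iff)
    then show ?thesis
      unfolding corr_def using ind inter AN(1) by (simp add: f_def)
  qed
  ultimately have "(\<lambda>n. complex_of_real (measure m (\<Inter>k\<in>I. (T k ^^ n) -` A k) - (\<Prod>k\<in>I. measure m (A k)))) \<longlonglongrightarrow> of_real 0"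
    by (simp only: eq[symmetric] of_real_0)
  then have "(\<lambda>n. measure m (\<Inter>k\<in>I. (T k ^^ n) -` A k) - (\<Prod>k\<in>I. measure m (A k))) \<longlonglongrightarrow> 0"
    by (simp only: tendsto_of_real_iff)
  then show ?thesis using Bk by (simp add: In LIM_zero_iff)
qed

end

section \<open>Relations between characters and eigenvectors of the dual matrices\<close>

lemma act_pow_zero_imp_zero:
  assumes "finite I" "\<And>x z. x \<in> I \<Longrightarrow> z \<in> I \<Longrightarrow> (\<Sum>y\<in>I. c x y * a y z) = (if x = z then 1 else 0)"
    and "\<And>x. x \<in> I \<Longrightarrow> (act I a ^^ n) f x = 0" "x \<in> I"
  shows "f x = 0"
  using assms(3,4)
proof (induction n arbitrary: x)
  case (Suc n)
  have "(act I a ^^ n) f y = 0" if y: "y \<in> I" for y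
  proof -
    have "(act I a ^^ n) f y = act I c (act I a ((act I a ^^ n) f)) y"
      using act_left_inverse[OF assms(1,2) y] by simp
    also have "\<dots> = 0" unfolding act_def[of I c] using Suc.prems(1) by simp
    finally show ?thesis .
  qed
  then show ?case using Suc by blast
qed auto

lemma act_linear: "Vector_Spaces.linear fscale fscale (act I a ^^ n :: ('i \<Rightarrow> complex) \<Rightarrow> 'i \<Rightarrow> complex)"
proof -
  have "(act I a ^^ n) (f + g) = (act I a ^^ n) f + (act I a ^^ n) g" for f g :: "'i \<Rightarrow> complex"
    using act_pow_add[of n I a f g] by (simp add: plus_fun_def)
  moreover have "(act I a ^^ n) (fscale c f) = fscale c ((act I a ^^ n) f)" for c and f :: "'i \<Rightarrow> complex"
    using act_pow_scale[of n I a c f] by (simp add: fscale_def)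
  ultimately show ?thesis
    by unfold_locales (auto simp: fscale_def fun_eq_iff algebra_simps)
qed

text \<open>The zero entries outside \<open>I \<times> {..<d}\<close> keep every image under
  \<open>act\<close> supported there, so orbits lie in a finite-dimensional space of
  functions.\<close>

definition block_matrix :: "'k set \<Rightarrow> nat \<Rightarrow> ('k \<Rightarrow> 'c::zero mat) \<Rightarrow> 'k \<times> nat \<Rightarrow> 'k \<times> nat \<Rightarrow> 'c" where
  "block_matrix I d A x y =
     (if x \<in> I \<times> {..<d} \<and> y \<in> I \<times> {..<d} \<and> fst x = fst y then A (fst x) $$ (snd x, snd y) else 0)"

lemma sum_block:
  assumes "finite I" "k \<in> I"
  shows "(\<Sum>y\<in>I \<times> {..<d}. (if fst y = k then g y else 0)) = (\<Sum>i<d. g (k, i) :: 'c::comm_monoid_add)"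
proof -
  have "(\<Sum>y\<in>I \<times> {..<d}. (if fst y = k then g y else 0)) = (\<Sum>k'\<in>I. \<Sum>i<d. (if k' = k then g (k', i) else 0))"
    by (subst sum.cartesian_product) (auto intro!: sum.cong)
  also have "\<dots> = (\<Sum>k'\<in>I. if k' = k then (\<Sum>i<d. g (k, i)) else 0)"
    by (intro sum.cong) auto
  finally show ?thesis using assms by simp
qed

lemma act_block_matrix:
  assumes I: "finite I" and A: "\<And>k. k \<in> I \<Longrightarrow> A k \<in> carrier_mat d d" and k: "k \<in> I" "j < d"
  shows "(act (I \<times> {..<d}) (block_matrix I d A) ^^ n) f (k, j) = (A k ^\<^sub>m n *\<^sub>v vec d (\<lambda>i. f (k, i))) $ j"
  using k(2)
proof (induction n arbitrary: f j)
  case 0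
  then show ?case using A[OF k(1)] by simp
next
  case (Suc n)
  let ?a = "act (I \<times> {..<d}) (block_matrix I d A)"
  have step: "?a f (k, i) = (A k *\<^sub>v vec d (\<lambda>i. f (k, i))) $ i" if "i < d" for i
  proof -
    have "?a f (k, i) = (\<Sum>y\<in>I \<times> {..<d}. (if fst y = k then A k $$ (i, snd y) * f y else 0))"
      unfolding act_def block_matrix_def using k(1) that by (intro sum.cong) auto
    also have "\<dots> = (\<Sum>i'<d. A k $$ (i, i') * f (k, i'))" by (simp add: sum_block[OF I k(1)])
    also have "\<dots> = (A k *\<^sub>v vec d (\<lambda>i. f (k, i))) $ i"
      using A[OF k(1)] that by (simp add: scalar_prod_def atLeast0LessThan)
    finally show ?thesis .
  qed
  have v: "vec d (\<lambda>i. ?a f (k, i)) = A k *\<^sub>v vec d (\<lambda>i. f (k, i))"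
    using A[OF k(1)] step by (intro eq_vecI) auto
  have "(?a ^^ Suc n) f (k, j) = (?a ^^ n) (?a f) (k, j)" by (simp only: funpow_Suc_right comp_apply)
  also have "\<dots> = (A k ^\<^sub>m n *\<^sub>v (A k *\<^sub>v vec d (\<lambda>i. f (k, i)))) $ j" unfolding Suc.IH[OF Suc.prems] v ..
  also have "A k ^\<^sub>m n *\<^sub>v (A k *\<^sub>v vec d (\<lambda>i. f (k, i))) = A k ^\<^sub>m Suc n *\<^sub>v vec d (\<lambda>i. f (k, i))"
    using A[OF k(1)] by (simp add: assoc_mult_mat_vec[of _ d d _ d])
  finally show ?case .
qed

lemma block_matrix_inverse:
  fixes A C :: "'k \<Rightarrow> 'c::comm_ring_1 mat"
  assumes I: "finite I" and A: "\<And>k. k \<in> I \<Longrightarrow> A k \<in> carrier_mat d d" "\<And>k. k \<in> I \<Longrightarrow> C k \<in> carrier_mat d d"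
    "\<And>k. k \<in> I \<Longrightarrow> C k * A k = 1\<^sub>m d"
    and x: "x \<in> I \<times> {..<d}" and z: "z \<in> I \<times> {..<d}"
  shows "(\<Sum>y\<in>I \<times> {..<d}. block_matrix I d C x y * block_matrix I d A y z) = (if x = z then 1 else 0)"
proof (cases "fst x = fst z")
  case True
  obtain k i j where k: "x = (k, i)" "z = (k, j)" "k \<in> I" "i < d" "j < d" using x z True by auto
  have "(\<Sum>y\<in>I \<times> {..<d}. block_matrix I d C x y * block_matrix I d A y z)
    = (\<Sum>y\<in>I \<times> {..<d}. (if fst y = k then C k $$ (i, snd y) * A k $$ (snd y, j) else 0))"
    unfolding block_matrix_def using k by (intro sum.cong) auto
  also have "\<dots> = (\<Sum>i'<d. C k $$ (i, i') * A k $$ (i', j))" by (simp add: sum_block[OF I k(3)])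
  also have "\<dots> = (C k * A k) $$ (i, j)"
    using A(1,2)[OF k(3)] k by (simp add: scalar_prod_def atLeast0LessThan)
  also have "\<dots> = (if x = z then 1 else 0)" using A(3)[OF k(3)] k by simp
  finally show ?thesis .
next
  case False
  then show ?thesis unfolding block_matrix_def by (auto intro!: sum.neutral)
qed

lemma finite_support_in_span:
  fixes f :: "'i \<Rightarrow> complex"
  assumes "finite X" "\<And>x. x \<notin> X \<Longrightarrow> f x = 0"
  shows "f \<in> fun_space.span ((\<lambda>y x. if x = y then 1 else 0) ` X)"
proof -
  have "f = (\<Sum>y\<in>X. fscale (f y) (\<lambda>x. if x = y then 1 else 0))"
  proof
    fix x show "f x = (\<Sum>y\<in>X. fscale (f y) (\<lambda>x. if x = y then 1 else 0)) x"
      using assms by (simp add: sum_fun_apply fscale_def if_distrib[of "\<lambda>t. _ * t"] cong: if_cong)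
  qed
  also have "\<dots> \<in> fun_space.span ((\<lambda>y x. if x = y then 1 else 0) ` X)"
    by (intro fun_space.span_sum fun_space.span_scale fun_space.span_base) auto
  finally show ?thesis .
qed

text \<open>A product relation along the multiples of \<open>l\<close> forbids points with one factor far from 1
  and all other factors close to 1, although the corresponding open sets have positive measure.\<close>

lemma (in compact_haar) not_mixing_if_character_relation:
  assumes I: "finite I" "inj_on T I" "i0 \<in> I" and chi: "\<And>k. k \<in> I \<Longrightarrow> \<chi> k \<in> characters"
    and ne: "\<chi> i0 \<noteq> (\<lambda>_. 1)" and l: "l \<ge> 1"
    and rel: "\<And>n x. (\<Prod>k\<in>I. \<chi> k ((T k ^^ (l * n)) x)) = 1"
  shows "\<not> mixing m (T ` I)"
proof
  assume mix: "mixing m (T ` I)"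
  obtain x0 where x0: "\<chi> i0 x0 \<noteq> 1" using ne by auto
  define \<delta> where "\<delta> = cmod (\<chi> i0 x0 - 1) / 2"
  have \<delta>: "\<delta> > 0" unfolding \<delta>_def using x0 by simp
  \<comment> \<open>A product of fewer than \<open>card I\<close> numbers of modulus 1, each within
    \<epsilon> of 1, is within \<delta> of 1.\<close>
  define \<epsilon> where "\<epsilon> = \<delta> / (real (card I) + 1)"
  have \<epsilon>: "\<epsilon> > 0" unfolding \<epsilon>_def using \<delta> by (simp add: add_nonneg_pos)
  define B where "B k = (if k = i0 then {x. \<delta> < cmod (\<chi> k x - 1)} else {x. cmod (\<chi> k x - 1) < \<epsilon>})" for k
  have cont: "continuous_on UNIV (\<lambda>x. cmod (\<chi> k x - 1))" if "k \<in> I" for k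
    using characters_cont(1)[OF chi[OF that]] by (intro continuous_intros)
  have B_open: "open (B k)" if "k \<in> I" for k
    unfolding B_def using open_Collect_less[OF continuous_on_const cont[OF that]]
      open_Collect_less[OF cont[OF that] continuous_on_const] by (cases "k = i0") simp_all
  have chi0: "\<chi> k 0 = 1" if "k \<in> I" for k
  proof -
    have "\<chi> k (0 + 0) = \<chi> k 0 * \<chi> k 0" "cmod (\<chi> k 0) = 1" using chi[OF that] unfolding characters_def by blast+
    then show ?thesis by auto
  qed
  have B_ne: "B k \<noteq> {}" if "k \<in> I" for k
  proof (cases "k = i0")
    case True
    then have "x0 \<in> B k" unfolding B_def using \<delta> by (simp add: \<delta>_def)
    then show ?thesis by auto
  next
    case False
    then have "0 \<in> B k" unfolding B_def using chi0[OF that] \<epsilon> by simp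
    then show ?thesis by auto
  qed
  have empty: "(\<Inter>k\<in>I. (T k ^^ (l * n)) -` B k) = {}" for n
  proof (rule ccontr)
    assume "\<not> ?thesis"
    then obtain x where x: "\<And>k. k \<in> I \<Longrightarrow> (T k ^^ (l * n)) x \<in> B k" by auto
    define z where "z k = \<chi> k ((T k ^^ (l * n)) x)" for k
    have nz: "cmod (z k) = 1" if "k \<in> I" for k using chi[OF that] unfolding z_def characters_def by auto
    let ?P = "\<Prod>k\<in>I - {i0}. z k"
    have one: "z i0 * ?P = 1" using rel[where n = n and x = x] prod.remove[OF I(1,3), of z] unfolding z_def by simp
    have "cmod (z i0 - 1) = cmod (z i0 * (?P - 1))"
      using one by (simp add: right_diff_distrib norm_minus_commute)
    also have "\<dots> = cmod (?P - 1)" using nz[OF I(3)] by (simp add: norm_mult)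
    also have "\<dots> \<le> (\<Sum>k\<in>I - {i0}. cmod (z k - 1))" using nz norm_prod_diff[of "I - {i0}" z "\<lambda>_. 1"] by simp
    also have "\<dots> \<le> (\<Sum>k\<in>I - {i0}. \<epsilon>)"
      using x unfolding B_def z_def by (intro sum_mono) (fastforce intro: less_imp_le)
    also have "\<dots> = real (card (I - {i0})) * \<epsilon>" by simp
    also have "\<dots> \<le> (real (card I) + 1) * \<epsilon>"
      using \<epsilon> card_mono[OF I(1), of "I - {i0}"] by (intro mult_right_mono) auto
    also have "\<dots> = \<delta>" unfolding \<epsilon>_def by (simp add: add_nonneg_eq_0_iff)
    finally have "cmod (z i0 - 1) \<le> \<delta>" .
    moreover have "\<delta> < cmod (z i0 - 1)" using x[OF I(3)] unfolding B_def z_def by simp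
    ultimately show False by simp
  qed
  define B' where "B' \<gamma> = B (the_inv_into I T \<gamma>)" for \<gamma>
  have B': "B' (T k) = B k" if "k \<in> I" for k unfolding B'_def using the_inv_into_f_f[OF I(2) that] by simp
  have "(\<forall>\<gamma>\<in>T ` I. B' \<gamma> \<in> sets (completion m)) \<longrightarrow>
      (\<lambda>n. measure (completion m) (\<Inter>\<gamma>\<in>T ` I. (\<gamma> ^^ n) -` B' \<gamma>))
      \<longlonglongrightarrow> (\<Prod>\<gamma>\<in>T ` I. measure (completion m) (B' \<gamma>))"
    using mix unfolding mixing_def by blast
  moreover have "\<forall>\<gamma>\<in>T ` I. B' \<gamma> \<in> sets (completion m)" using B_open B' by auto
  ultimately have "(\<lambda>n. measure (completion m) (\<Inter>\<gamma>\<in>T ` I. (\<gamma> ^^ n) -` B' \<gamma>))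
      \<longlonglongrightarrow> (\<Prod>\<gamma>\<in>T ` I. measure (completion m) (B' \<gamma>))"
    by (rule mp)
  moreover have "(\<Prod>\<gamma>\<in>T ` I. measure (completion m) (B' \<gamma>)) = (\<Prod>k\<in>I. measure m (B k))"
    using I(2) B' B_open by (simp add: prod.reindex)
  moreover have "(\<Inter>\<gamma>\<in>T ` I. (\<gamma> ^^ n) -` B' \<gamma>) = (\<Inter>k\<in>I. (T k ^^ n) -` B k)" for n
    using B' by auto
  ultimately have lim: "(\<lambda>n. measure (completion m) (\<Inter>k\<in>I. (T k ^^ n) -` B k)) \<longlonglongrightarrow> (\<Prod>k\<in>I. measure m (B k))"
    by simp
  \<comment> \<open>The relation is known along multiples of l only; mixing gives the same limit
    along this subsequence, on which all the intersections are empty.\<close>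
  have "strict_mono (\<lambda>n. l * n)" using l by (intro strict_monoI) simp
  from LIMSEQ_subseq_LIMSEQ[OF lim this]
  have "(\<lambda>n. 0) \<longlonglongrightarrow> (\<Prod>k\<in>I. measure m (B k))" by (simp add: comp_def empty)
  then have "(\<Prod>k\<in>I. measure m (B k)) = 0" by (simp add: LIMSEQ_const_iff)
  moreover have "(\<Prod>k\<in>I. measure m (B k)) > 0" using open_measure_pos B_open B_ne by (intro prod_pos) auto
  ultimately show False by simp
qed

locale dual_identified =
  fixes d :: nat and \<iota> :: "('a::topological_ab_group_add \<Rightarrow> complex) \<Rightarrow> rat vec"
  assumes ident: "dual_identification d \<iota>"
begin

section \<open>Characters as rational vectors\<close>

lemma iota_carrier: "\<chi> \<in> characters \<Longrightarrow> \<iota> \<chi> \<in> carrier_vec d"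
  using ident unfolding dual_identification_def by auto

lemma iota_dim [simp]: "\<chi> \<in> characters \<Longrightarrow> dim_vec (\<iota> \<chi>) = d"
  using iota_carrier by auto

lemma iota_inj: "\<chi> \<in> characters \<Longrightarrow> \<psi> \<in> characters \<Longrightarrow> \<iota> \<chi> = \<iota> \<psi> \<Longrightarrow> \<chi> = \<psi>"
  using ident unfolding dual_identification_def by (auto dest: inj_onD)

lemma iota_mult: "\<chi> \<in> characters \<Longrightarrow> \<psi> \<in> characters \<Longrightarrow> \<iota> (\<lambda>x. \<chi> x * \<psi> x) = \<iota> \<chi> + \<iota> \<psi>"
  using ident unfolding dual_identification_def by auto

lemma iota_lattice: "v \<in> integer_lattice d \<Longrightarrow> \<exists>\<chi>\<in>characters. \<iota> \<chi> = v"
  using ident unfolding dual_identification_def by (metis imageE subsetD)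

lemma iota_one: "\<iota> (\<lambda>_. 1) = 0\<^sub>v d"
proof (rule eq_vecI)
  fix i assume "i < dim_vec (0\<^sub>v d :: rat vec)"
  then have i: "i < d" by simp
  have "\<iota> (\<lambda>_. 1) $ i = (\<iota> (\<lambda>_. 1) + \<iota> (\<lambda>_. 1)) $ i"
    using arg_cong[OF iota_mult[OF characters_one characters_one], of "\<lambda>v::rat vec. v $ i"] by simp
  also have "\<dots> = \<iota> (\<lambda>_. 1) $ i + \<iota> (\<lambda>_. 1) $ i"
    using i iota_dim[OF characters_one] by (intro index_add_vec) simp
  finally show "\<iota> (\<lambda>_. 1) $ i = 0\<^sub>v d $ i" using i by simp
qed (use iota_dim[OF characters_one] in simp)

lemma iota_prod:
  assumes "finite S" "\<And>k. k \<in> S \<Longrightarrow> \<chi> k \<in> characters"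
  shows "(\<lambda>x. \<Prod>k\<in>S. \<chi> k x) \<in> characters \<and>
    (\<forall>i<d. \<iota> (\<lambda>x. \<Prod>k\<in>S. \<chi> k x) $ i = (\<Sum>k\<in>S. \<iota> (\<chi> k) $ i))"
  using assms
proof (induction S)
  case empty
  then show ?case using characters_one iota_one by simp
next
  case (insert k S)
  then have IH: "(\<lambda>x. \<Prod>k\<in>S. \<chi> k x) \<in> characters"
    "\<forall>i<d. \<iota> (\<lambda>x. \<Prod>k\<in>S. \<chi> k x) $ i = (\<Sum>k\<in>S. \<iota> (\<chi> k) $ i)" and k: "\<chi> k \<in> characters" by auto
  have eq: "(\<lambda>x. \<Prod>k\<in>insert k S. \<chi> k x) = (\<lambda>x. \<chi> k x * (\<Prod>k\<in>S. \<chi> k x))" using insert.hyps by simp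
  show ?case unfolding eq iota_mult[OF k IH(1)]
    using insert.hyps IH k characters_mult[OF k IH(1)] by simp
qed

lemma dual_matrix_props:
  assumes "continuous_endomorphism T"
  shows "dual_matrix d \<iota> T \<in> carrier_mat d d" "\<chi> \<in> characters \<Longrightarrow> dual_matrix d \<iota> T *\<^sub>v \<iota> \<chi> = \<iota> (\<chi> \<circ> T)"
  using theI'[OF dual_matrix_unique[OF ident assms]] unfolding dual_matrix_def by auto

text \<open>Stated for any map S with matrix M, so that it applies both to T and to the power
  \<open>T ^^ l\<close>.\<close>

lemma iota_comp_pow:
  assumes M: "M \<in> carrier_mat d d"
    and S: "\<And>\<chi>. \<chi> \<in> characters \<Longrightarrow> \<chi> \<circ> S \<in> characters \<and> \<iota> (\<chi> \<circ> S) = M *\<^sub>v \<iota> \<chi>"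
    and chi: "\<chi> \<in> characters"
  shows "\<chi> \<circ> (S ^^ n) \<in> characters \<and> \<iota> (\<chi> \<circ> (S ^^ n)) = M ^\<^sub>m n *\<^sub>v \<iota> \<chi>"
  using chi
proof (induction n arbitrary: \<chi>)
  case 0
  then show ?case using M iota_carrier by simp
next
  case (Suc n)
  have eq: "\<chi> \<circ> (S ^^ Suc n) = (\<chi> \<circ> S) \<circ> (S ^^ n)" by (simp only: funpow.simps comp_assoc)
  have c: "\<chi> \<circ> S \<in> characters" and e: "\<iota> (\<chi> \<circ> S) = M *\<^sub>v \<iota> \<chi>" using S[OF Suc.prems] by auto
  have "M ^\<^sub>m n *\<^sub>v (M *\<^sub>v \<iota> \<chi>) = M ^\<^sub>m Suc n *\<^sub>v \<iota> \<chi>"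
    using M iota_carrier[OF Suc.prems] by (simp add: assoc_mult_mat_vec[of _ d d _ d])
  then show ?case using Suc.IH[OF c] unfolding eq e by (simp only:)
qed

lemma iota_endomorphism_pow:
  assumes "continuous_endomorphism T" "\<chi> \<in> characters"
  shows "\<chi> \<circ> (T ^^ n) \<in> characters" "\<iota> (\<chi> \<circ> (T ^^ n)) = dual_matrix d \<iota> T ^\<^sub>m n *\<^sub>v \<iota> \<chi>"
  using iota_comp_pow[OF dual_matrix_props(1)[OF assms(1)], of T \<chi> n] assms
    characters_comp dual_matrix_props(2)[OF assms(1)] by auto

lemma iota_endomorphism_pow_pow:
  assumes T: "continuous_endomorphism T" and chi: "\<chi> \<in> characters"
  shows "\<chi> \<circ> (T ^^ (l * n)) \<in> characters"
    "\<iota> (\<chi> \<circ> (T ^^ (l * n))) = (dual_matrix d \<iota> T ^\<^sub>m l) ^\<^sub>m n *\<^sub>v \<iota> \<chi>"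
  using iota_comp_pow[OF pow_carrier_mat[OF dual_matrix_props(1)[OF T], of l], of "T ^^ l" \<chi> n] chi
    iota_endomorphism_pow[OF T] by (auto simp: funpow_mult)

text \<open>A multiple of a kernel vector lies in the integer lattice and so represents a character
  \<chi> with trivial \<open>\<chi> \<circ> T\<close>. Surjectivity makes \<chi> trivial; thus the
  determinant is nonzero and the adjugate provides the inverse.\<close>

lemma dual_matrix_left_inverse:
  assumes T: "epimorphism T"
  shows "\<exists>C \<in> carrier_mat d d. C * dual_matrix d \<iota> T = 1\<^sub>m d"
proof -
  have T': "continuous_endomorphism T" "surj T" using T unfolding epimorphism_def by auto
  let ?A = "dual_matrix d \<iota> T"
  note A = dual_matrix_props(1)[OF T'(1)]
  have "v = 0\<^sub>v d" if v: "v \<in> carrier_vec d" "?A *\<^sub>v v = 0\<^sub>v d" for v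
  proof -
    obtain N :: nat where N: "N > 0" "\<forall>i<d. of_nat N * v $ i \<in> \<int>" using common_denominator[of d v] by auto
    have "of_nat N \<cdot>\<^sub>v v \<in> integer_lattice d" unfolding integer_lattice_def using N(2) v(1) by auto
    then obtain \<chi> where chi: "\<chi> \<in> characters" "\<iota> \<chi> = of_nat N \<cdot>\<^sub>v v" using iota_lattice by blast
    have "\<iota> (\<chi> \<circ> T) = of_nat N \<cdot>\<^sub>v (?A *\<^sub>v v)"
      unfolding dual_matrix_props(2)[OF T'(1) chi(1), symmetric] chi(2) by (rule mult_mat_vec[OF A v(1)])
    also have "\<dots> = 0\<^sub>v d" unfolding v(2) by (intro eq_vecI) auto
    finally have "\<chi> \<circ> T = (\<lambda>_. 1)"
      using iota_inj[OF characters_comp[OF T'(1) chi(1)] characters_one] iota_one by simp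
    then have "\<chi> = (\<lambda>_. 1)" using T'(2) by (metis comp_apply surj_def ext)
    then have z: "of_nat N \<cdot>\<^sub>v v = 0\<^sub>v d" using chi(2) iota_one by simp
    have "v $ i = 0" if "i < d" for i
      using arg_cong[OF z, of "\<lambda>u::rat vec. u $ i"] that v(1) N(1) by simp
    then show ?thesis using v(1) by (intro eq_vecI) auto
  qed
  then have det: "det ?A \<noteq> 0" using det_0_iff_vec_prod_zero[OF A] by blast
  define C where "C = (1 / det ?A) \<cdot>\<^sub>m adj_mat ?A"
  have "C * ?A = (1 / det ?A) \<cdot>\<^sub>m (adj_mat ?A * ?A)"
    unfolding C_def by (rule mult_smult_assoc_mat[OF adj_mat(1)[OF A] A])
  also have "\<dots> = 1\<^sub>m d" unfolding adj_mat(3)[OF A] using det by (intro eq_matI) auto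
  finally show ?thesis using adj_mat(1)[OF A] unfolding C_def by (intro bexI[of _ C]) (auto simp: C_def)
qed


text \<open>A single factor N serves the whole family, so linear relations between the vectors carry
  over to the characters.\<close>

lemma character_of_rational_vectors:
  assumes S: "finite S" and v: "\<And>k. k \<in> S \<Longrightarrow> v k \<in> carrier_vec d"
  shows "\<exists>N \<chi>. (N::rat) \<noteq> 0 \<and> (\<forall>k\<in>S. \<chi> k \<in> characters \<and> \<iota> (\<chi> k) = N \<cdot>\<^sub>v v k)"
proof -
  have "finite ((\<lambda>(k, j). v k $ j) ` (S \<times> {..<d}))" using S by auto
  then obtain D :: int where D: "D > 0" "\<forall>q\<in>(\<lambda>(k, j). v k $ j) ` (S \<times> {..<d}). of_int D * q \<in> \<int>"
    using common_denominator_set by blast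
  have "\<exists>\<chi>\<in>characters. \<iota> \<chi> = of_int D \<cdot>\<^sub>v v k" if "k \<in> S" for k
    using D(2) v[OF that] that by (intro iota_lattice) (auto simp: integer_lattice_def)
  then obtain \<chi> where "\<forall>k\<in>S. \<chi> k \<in> characters \<and> \<iota> (\<chi> k) = of_int D \<cdot>\<^sub>v v k" by metis
  then show ?thesis using D(1) by (intro exI[of _ "of_int D"] exI[of _ \<chi>]) auto
qed

text \<open>With a common eigenvalue \<mu>, applying the n-th powers of the matrices multiplies the
  relation between the \<open>q k\<close> multiples of \<open>w k\<close> by
  \<open>\<mu> ^ n\<close>, so it persists for all n. A rational functional, applied to each
  coordinate, transfers it to rational vectors; it is chosen nonzero at one coordinate of one
  summand, so that not all characters become trivial.\<close>

lemma eigenvectors_give_character_relation: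
  fixes T :: "nat \<Rightarrow> 'a \<Rightarrow> 'a"
  assumes I: "finite I" and K: "K \<subseteq> I" and T: "\<And>k. k \<in> I \<Longrightarrow> continuous_endomorphism (T k)"
    and ev: "\<And>k. k \<in> K \<Longrightarrow> eigenvector (complex_dual_matrix d \<iota> (T k) ^\<^sub>m l) (w k) \<mu>"
    and dep: "rat_linearly_dependent d K w"
  shows "\<exists>\<chi>. (\<forall>k\<in>I. \<chi> k \<in> characters) \<and> (\<exists>k\<in>I. \<chi> k \<noteq> (\<lambda>_. 1)) \<and>
    (\<forall>n x. (\<Prod>k\<in>I. \<chi> k ((T k ^^ (l * n)) x)) = 1)"
proof -
  have fK: "finite K" using I K finite_subset by blast
  define A where "A k = dual_matrix d \<iota> (T k)" for k
  have A: "A k \<in> carrier_mat d d" if "k \<in> I" for k unfolding A_def by (rule dual_matrix_props(1)[OF T[OF that]])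
  define M where "M k = A k ^\<^sub>m l" for k
  have M: "M k \<in> carrier_mat d d" if "k \<in> I" for k unfolding M_def by (rule pow_carrier_mat[OF A[OF that]])
  have CM: "complex_dual_matrix d \<iota> (T k) ^\<^sub>m l = map_mat of_rat (M k)" if "k \<in> I" for k
    unfolding complex_dual_matrix_def M_def A_def[symmetric] by (rule of_rat_hom.mat_hom_pow[OF A[OF that], symmetric])
  have Cc: "map_mat of_rat (M k) \<in> carrier_mat d d" if "k \<in> I" for k using M[OF that] by simp
  have ev': "eigenvector (map_mat of_rat (M k)) (w k) \<mu>" if "k \<in> K" for k
    using ev[OF that] CM[of k] K that by auto
  have w: "w k \<in> carrier_vec d" "w k \<noteq> 0\<^sub>v d" if "k \<in> K" for k
    using ev'[OF that] M[of k] K that unfolding eigenvector_def by auto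
  obtain q :: "nat \<Rightarrow> rat" and i0 where q: "i0 \<in> K" "q i0 \<noteq> 0"
    "finsum_vec TYPE(complex) d (\<lambda>i. of_rat (q i) \<cdot>\<^sub>v w i) K = 0\<^sub>v d"
    using dep unfolding rat_linearly_dependent_def by blast
  have dep0: "(\<Sum>k\<in>K. of_rat (q k) * w k $ j) = 0" if j: "j < d" for j
  proof -
    have "finsum_vec TYPE(complex) d (\<lambda>i. of_rat (q i) \<cdot>\<^sub>v w i) K $ j = (\<Sum>k\<in>K. (of_rat (q k) \<cdot>\<^sub>v w k) $ j)"
      using w by (intro index_finsum_vec[OF fK j]) auto
    also have "\<dots> = (\<Sum>k\<in>K. of_rat (q k) * w k $ j)"
    proof (intro sum.cong refl)
      fix k assume "k \<in> K"
      then show "(of_rat (q k) \<cdot>\<^sub>v w k) $ j = of_rat (q k) * w k $ j" using w(1)[of k] j by auto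
    qed
    finally show ?thesis unfolding q(3) using j by simp
  qed
  obtain j0 where j0: "j0 < d" "w i0 $ j0 \<noteq> 0"
  proof -
    have "\<exists>j<d. w i0 $ j \<noteq> 0"
    proof (rule ccontr)
      assume "\<not> ?thesis"
      then have "w i0 = 0\<^sub>v d" using w(1)[OF q(1)] by (intro eq_vecI) auto
      then show False using w(2)[OF q(1)] by simp
    qed
    then show ?thesis using that by blast
  qed
  have "of_rat (q i0) * w i0 $ j0 \<noteq> 0" using q(2) j0(2) by simp
  then obtain \<phi> :: "complex \<Rightarrow> rat" where phi: "\<And>x y. \<phi> (x + y) = \<phi> x + \<phi> y"
    "\<And>r x. \<phi> (of_rat r * x) = r * \<phi> x" "\<phi> (of_rat (q i0) * w i0 $ j0) \<noteq> 0"
    using rational_functional by blast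
  have phi_0: "\<phi> 0 = 0" using phi(2)[of 0 0] by simp
  have phi_sum: "\<phi> (sum f S) = (\<Sum>x\<in>S. \<phi> (f x))" for f :: "nat \<Rightarrow> complex" and S
    by (induction S rule: infinite_finite_induct) (auto simp: phi_0 phi(1))
  \<comment> \<open>Rational entries pass through \<phi>, so it intertwines the complex and the
    rational action of B.\<close>
  have phi_mat: "(B *\<^sub>v map_vec \<phi> u) $ j = \<phi> ((map_mat of_rat B *\<^sub>v u) $ j)"
    if "B \<in> carrier_mat d d" "u \<in> carrier_vec d" "j < d" for B u j
    using that by (auto simp: scalar_prod_def phi_sum phi(2) intro!: sum.cong)
  \<comment> \<open>Indices outside K get the zero vector, hence the trivial character, and the
    relation extends to all of I.\<close>
  define u where "u k = (if k \<in> K then of_rat (q k) \<cdot>\<^sub>v w k else 0\<^sub>v d)" for k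
  have u: "u k \<in> carrier_vec d" for k unfolding u_def using w by auto
  define v where "v k = map_vec \<phi> (u k)" for k
  have v: "v k \<in> carrier_vec d" for k unfolding v_def using u by simp
  obtain N \<chi> where N: "N \<noteq> 0" and chi: "\<And>k. k \<in> I \<Longrightarrow> \<chi> k \<in> characters" "\<And>k. k \<in> I \<Longrightarrow> \<iota> (\<chi> k) = N \<cdot>\<^sub>v v k"
    using character_of_rational_vectors[OF I v, of "\<lambda>k. k"] by auto
  have "v i0 $ j0 \<noteq> 0" unfolding v_def u_def using q(1) j0 phi(3) w(1)[OF q(1)] by simp
  then have "(N \<cdot>\<^sub>v v i0) $ j0 \<noteq> 0" using N v[of i0] j0 by simp
  moreover have "i0 \<in> I" using q(1) K by auto
  ultimately have "\<iota> (\<chi> i0) $ j0 \<noteq> 0" using chi(2)[of i0] by simp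
  then have "\<iota> (\<chi> i0) \<noteq> 0\<^sub>v d" using j0(1) by auto
  then have ne: "\<chi> i0 \<noteq> (\<lambda>_. 1)" using iota_one by auto
  have Mw: "(map_mat of_rat (M k ^\<^sub>m n) *\<^sub>v u k) $ j = (if k \<in> K then \<mu> ^ n * (of_rat (q k) * w k $ j) else 0)"
    if k: "k \<in> I" and j: "j < d" for k j n
  proof (cases "k \<in> K")
    case True
    have hom: "map_mat of_rat (M k ^\<^sub>m n) = map_mat of_rat (M k) ^\<^sub>m n" by (rule of_rat_hom.mat_hom_pow[OF M[OF k]])
    have "map_mat of_rat (M k) ^\<^sub>m n *\<^sub>v (of_rat (q k) \<cdot>\<^sub>v w k) = of_rat (q k) \<cdot>\<^sub>v (map_mat of_rat (M k) ^\<^sub>m n *\<^sub>v w k)"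
      by (rule mult_mat_vec[OF pow_carrier_mat[OF Cc[OF k]] w(1)[OF True]])
    also have "map_mat of_rat (M k) ^\<^sub>m n *\<^sub>v w k = \<mu> ^ n \<cdot>\<^sub>v w k"
      by (rule eigenvector_pow[OF Cc[OF k] ev'[OF True]])
    finally show ?thesis unfolding hom u_def using True w(1)[OF True] j by (simp add: mult_ac)
  next
    case False
    then show ?thesis unfolding u_def using carrier_matD[OF pow_carrier_mat[OF M[OF k], of n]] j by (simp add: scalar_prod_def)
  qed
  have "(\<Prod>k\<in>I. \<chi> k ((T k ^^ (l * n)) x)) = 1" for n x
  proof -
    let ?\<psi> = "\<lambda>k. \<chi> k \<circ> (T k ^^ (l * n))"
    note psi = iota_endomorphism_pow_pow[OF T chi(1)]
    have P: "(\<lambda>x. \<Prod>k\<in>I. ?\<psi> k x) \<in> characters"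
      "\<forall>j<d. \<iota> (\<lambda>x. \<Prod>k\<in>I. ?\<psi> k x) $ j = (\<Sum>k\<in>I. \<iota> (?\<psi> k) $ j)"
      using iota_prod[OF I, of ?\<psi>] psi(1) by auto
    have "\<iota> (\<lambda>x. \<Prod>k\<in>I. ?\<psi> k x) $ j = 0" if j: "j < d" for j
    proof -
      have "\<iota> (?\<psi> k) $ j = N * \<phi> (if k \<in> K then \<mu> ^ n * (of_rat (q k) * w k $ j) else 0)" if k: "k \<in> I" for k
      proof -
        have c: "M k ^\<^sub>m n \<in> carrier_mat d d" by (rule pow_carrier_mat[OF M[OF k]])
        have "\<iota> (?\<psi> k) = N \<cdot>\<^sub>v (M k ^\<^sub>m n *\<^sub>v v k)"
          unfolding psi(2)[OF k k] chi(2)[OF k] M_def A_def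
          using mult_mat_vec[OF c v[of k], of N] unfolding M_def A_def .
        then have "\<iota> (?\<psi> k) $ j = N * (M k ^\<^sub>m n *\<^sub>v v k) $ j" using carrier_matD[OF c] j by simp
        then show ?thesis unfolding v_def phi_mat[OF c u j] Mw[OF k j] .
      qed
      \<comment> \<open>The sum is collected inside \<phi>: the factor \<open>\<mu> ^ n\<close>
        could not be taken out of \<phi>, but within its argument it multiplies a sum that is
        zero.\<close>
      then have "\<iota> (\<lambda>x. \<Prod>k\<in>I. ?\<psi> k x) $ j
        = N * \<phi> (\<Sum>k\<in>I. if k \<in> K then \<mu> ^ n * (of_rat (q k) * w k $ j) else 0)"
        using P(2) j by (simp add: phi_sum sum_distrib_left)
      also have "(\<Sum>k\<in>I. if k \<in> K then \<mu> ^ n * (of_rat (q k) * w k $ j) else 0) = (\<Sum>k\<in>K. \<mu> ^ n * (of_rat (q k) * w k $ j))"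
        using I K by (simp add: sum.inter_restrict[symmetric] Int_absorb1)
      also have "\<dots> = 0" using dep0[OF j] by (simp flip: sum_distrib_left)
      finally show ?thesis by (simp add: phi_0)
    qed
    then have "\<iota> (\<lambda>x. \<Prod>k\<in>I. ?\<psi> k x) = \<iota> (\<lambda>_. 1)"
      unfolding iota_one using iota_dim[OF P(1)] by (intro eq_vecI) auto
    then have "(\<lambda>x. \<Prod>k\<in>I. ?\<psi> k x) = (\<lambda>_. 1)" by (rule iota_inj[OF P(1) characters_one])
    then show ?thesis by (auto simp: fun_eq_iff)
  qed
  then show ?thesis using chi(1) ne q(1) K by (intro exI[of _ \<chi>]) auto
qed

text \<open>The relation at time n says that d fixed functionals vanish on the n-th iterate of one
  block vector, which is the situation of \<open>skolem_rat\<close>. The resulting eigenvector of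
  the block operator has blocks with sum zero; omitting the zero blocks leaves a dependence with all
  coefficients 1.\<close>

lemma character_relations_give_eigenvectors:
  fixes T :: "nat \<Rightarrow> 'a \<Rightarrow> 'a"
  assumes I: "finite I" and T: "\<And>k. k \<in> I \<Longrightarrow> epimorphism (T k)"
    and chi: "\<And>k. k \<in> I \<Longrightarrow> \<chi> k \<in> characters" and ne: "k0 \<in> I" "\<chi> k0 \<noteq> (\<lambda>_. 1)"
    and inf: "infinite {n. \<forall>x. (\<Prod>k\<in>I. \<chi> k ((T k ^^ n) x)) = 1}"
  shows "\<exists>l\<ge>1. \<exists>K. K \<noteq> {} \<and> K \<subseteq> I \<and> (\<exists>\<mu> w.
    (\<forall>k\<in>K. eigenvector (complex_dual_matrix d \<iota> (T k) ^\<^sub>m l) (w k) \<mu>) \<and> rat_linearly_dependent d K w)"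
proof -
  have T': "continuous_endomorphism (T k)" if "k \<in> I" for k using T[OF that] unfolding epimorphism_def by simp
  define A where "A k = dual_matrix d \<iota> (T k)" for k
  have A: "A k \<in> carrier_mat d d" if "k \<in> I" for k unfolding A_def by (rule dual_matrix_props(1)[OF T'[OF that]])
  have "\<forall>k\<in>I. \<exists>C. C \<in> carrier_mat d d \<and> C * A k = 1\<^sub>m d"
    using dual_matrix_left_inverse[OF T] unfolding A_def by blast
  then obtain C where C: "\<And>k. k \<in> I \<Longrightarrow> C k \<in> carrier_mat d d" "\<And>k. k \<in> I \<Longrightarrow> C k * A k = 1\<^sub>m d" by metis
  let ?X = "I \<times> {..<d}"
  have X: "finite ?X" using I by simp
  let ?a = "block_matrix I d A"
  have inv: "(\<Sum>y\<in>?X. block_matrix I d C x y * ?a y z) = (if x = z then 1 else 0)" if "x \<in> ?X" "z \<in> ?X" for x z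
    by (rule block_matrix_inverse[OF I]) (use A C that in auto)
  define v where "v x = (if x \<in> ?X then \<iota> (\<chi> (fst x)) $ snd x else 0)" for x
  \<comment> \<open>As a functional it adds up the t-th coordinates of all blocks.\<close>
  define \<rho> where "\<rho> t x = (if snd x = t then 1 else (0::rat))" for t :: nat and x :: "nat \<times> nat"
  have vk: "vec d (\<lambda>i. v (k, i)) = \<iota> (\<chi> k)" if "k \<in> I" for k
    using chi[OF that] that unfolding v_def by (intro eq_vecI) auto
  have rho: "(\<Sum>x\<in>?X. \<rho> t x * f x) = (\<Sum>k\<in>I. f (k, t))" if "t < d" for t and f :: "nat \<times> nat \<Rightarrow> rat"
  proof -
    have "(\<Sum>x\<in>?X. \<rho> t x * f x) = (\<Sum>k\<in>I. \<Sum>j<d. \<rho> t (k, j) * f (k, j))"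
      by (subst sum.cartesian_product) (auto intro!: sum.cong)
    also have "\<dots> = (\<Sum>k\<in>I. \<Sum>j<d. if j = t then f (k, t) else 0)"
      unfolding \<rho>_def by (intro sum.cong) auto
    finally show ?thesis using that by simp
  qed
  have "{n. \<forall>x. (\<Prod>k\<in>I. \<chi> k ((T k ^^ n) x)) = 1} \<subseteq> {n. \<forall>t\<in>{..<d}. (\<Sum>x\<in>?X. \<rho> t x * (act ?X ?a ^^ n) v x) = 0}"
  proof (intro Collect_mono impI ballI)
    fix n t assume one: "\<forall>x. (\<Prod>k\<in>I. \<chi> k ((T k ^^ n) x)) = 1" and "t \<in> {..<d}"
    then have t: "t < d" by simp
    have eq: "(\<lambda>x. \<Prod>k\<in>I. (\<chi> k \<circ> (T k ^^ n)) x) = (\<lambda>_. 1)" using one by auto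
    have "(\<Sum>k\<in>I. (act ?X ?a ^^ n) v (k, t)) = (\<Sum>k\<in>I. \<iota> (\<chi> k \<circ> (T k ^^ n)) $ t)"
    proof (intro sum.cong refl)
      fix k assume k: "k \<in> I"
      show "(act ?X ?a ^^ n) v (k, t) = \<iota> (\<chi> k \<circ> (T k ^^ n)) $ t"
        unfolding iota_endomorphism_pow(2)[OF T'[OF k] chi[OF k]] A_def[symmetric] vk[OF k, symmetric]
        by (rule act_block_matrix[OF I A k t])
    qed
    also have "\<dots> = \<iota> (\<lambda>x. \<Prod>k\<in>I. (\<chi> k \<circ> (T k ^^ n)) x) $ t"
      using iota_prod[OF I, of "\<lambda>k. \<chi> k \<circ> (T k ^^ n)"] iota_endomorphism_pow(1)[OF T' chi] t by simp
    also have "\<dots> = 0" unfolding eq iota_one using t by simp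
    finally show "(\<Sum>x\<in>?X. \<rho> t x * (act ?X ?a ^^ n) v x) = 0" unfolding rho[OF t] .
  qed
  then have "infinite {n. \<forall>t\<in>{..<d}. (\<Sum>x\<in>?X. \<rho> t x * (act ?X ?a ^^ n) v x) = 0}"
    using inf finite_subset by blast
  from skolem_rat[OF X inv this]
  obtain l r where l: "l \<ge> 1"
    and lr: "\<And>n t. t < d \<Longrightarrow> (\<Sum>x\<in>?X. \<rho> t x * (act ?X ?a ^^ (l * n + r)) v x) = 0" by auto
  let ?b = "block_matrix I d (\<lambda>k. map_mat complex_of_rat (A k))"
  have A': "map_mat complex_of_rat (A k) \<in> carrier_mat d d" if "k \<in> I" for k using A[OF that] by simp
  have ab: "?b x y = of_rat (?a x y)" for x y
    unfolding block_matrix_def using A by fastforce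
  define L where "L = act ?X ?b ^^ l"
  define v1 where "v1 x = complex_of_rat ((act ?X ?a ^^ r) v x)" for x
  have of_rat_act: "(act ?X ?b ^^ n) (\<lambda>x. of_rat (f x)) = (\<lambda>x. of_rat ((act ?X ?a ^^ n) f x))" for n f
    by (induction n) (simp_all add: act_def ab of_rat_sum of_rat_mult)
  have Lpow: "(L ^^ n) v1 x = of_rat ((act ?X ?a ^^ (l * n + r)) v x)" for n x
    unfolding L_def v1_def[abs_def] funpow_mult of_rat_act by (simp add: funpow_add mult.commute)
  have out: "(act ?X ?a ^^ n) v x = 0" if "x \<notin> ?X" for n x
    using that unfolding v_def by (cases n) (auto simp: act_def block_matrix_def)
  have lin: "Vector_Spaces.linear fscale fscale L" unfolding L_def by (rule act_linear)
  \<comment> \<open>Passing to the offset r loses nothing, since the block matrix is invertible and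
    the character at \<open>k0\<close> is nontrivial.\<close>
  have "v1 \<noteq> 0"
  proof
    assume "v1 = 0"
    have "(act ?X ?a ^^ r) v x = 0" for x
      using fun_cong[OF \<open>v1 = 0\<close>, of x] unfolding v1_def by simp
    then have "v x = 0" if "x \<in> ?X" for x using act_pow_zero_imp_zero[OF X inv _ that] by blast
    then have "\<iota> (\<chi> k0) = 0\<^sub>v d"
      using ne(1) chi[OF ne(1)] unfolding vk[OF ne(1), symmetric] by (intro eq_vecI) auto
    then show False using iota_inj[OF chi[OF ne(1)] characters_one] iota_one ne(2) by simp
  qed
  have orbit: "(L ^^ n) v1 \<in> fun_space.span ((\<lambda>y x. if x = y then 1 else 0) ` ?X)" for n
    using out by (intro finite_support_in_span[OF X]) (simp add: Lpow)
  obtain p where p: "p \<noteq> 0" "fun_space.poly_op p L v1 = 0"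
    using fun_space.annihilating_polynomial[OF finite_imageI[OF X] orbit] by auto
  obtain Q z where Q: "fun_space.poly_op Q L v1 \<noteq> 0"
    "L (fun_space.poly_op Q L v1) = fscale z (fun_space.poly_op Q L v1)"
    using fun_space.poly_op_eigenvector[OF lin p \<open>v1 \<noteq> 0\<close>] by auto
  define U where "U = fun_space.poly_op Q L v1"
  have U: "U x = (\<Sum>i\<le>degree Q. coeff Q i * of_rat ((act ?X ?a ^^ (l * i + r)) v x))" for x
    unfolding U_def fun_space.poly_op_def by (simp add: sum_fun_apply fscale_def Lpow)
  have Uout: "U x = 0" if "x \<notin> ?X" for x unfolding U by (simp add: out[OF that])
  \<comment> \<open>U is a combination of the vectors \<open>(L ^^ i) v1\<close>, that is, of the
    iterates at times \<open>l * i + r\<close>, and each of these has block sum zero.\<close>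
  have Usum: "(\<Sum>k\<in>I. U (k, t)) = 0" if t: "t < d" for t
  proof -
    have "(\<Sum>k\<in>I. U (k, t)) = (\<Sum>i\<le>degree Q. coeff Q i * of_rat (\<Sum>k\<in>I. (act ?X ?a ^^ (l * i + r)) v (k, t)))"
      unfolding U by (subst sum.swap) (simp add: sum_distrib_left of_rat_sum)
    also have "\<dots> = 0" using lr[OF t] unfolding rho[OF t] by simp
    finally show ?thesis .
  qed
  define w where "w k = vec d (\<lambda>j. U (k, j))" for k
  define K where "K = {k \<in> I. w k \<noteq> 0\<^sub>v d}"
  have K: "K \<subseteq> I" unfolding K_def by auto
  have "K \<noteq> {}"
  proof -
    obtain x where x: "U x \<noteq> 0" using Q(1) unfolding U_def by (auto simp: fun_eq_iff)
    then have xX: "x \<in> ?X" using Uout by blast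
    then have "w (fst x) $ snd x \<noteq> 0" using x unfolding w_def by auto
    then have "w (fst x) \<noteq> 0\<^sub>v d" using xX by auto
    then have "fst x \<in> K" using xX unfolding K_def by auto
    then show ?thesis by auto
  qed
  moreover have "eigenvector (complex_dual_matrix d \<iota> (T k) ^\<^sub>m l) (w k) z" if "k \<in> K" for k
  proof -
    have k: "k \<in> I" using that K by auto
    have M: "complex_dual_matrix d \<iota> (T k) = map_mat complex_of_rat (A k)"
      unfolding complex_dual_matrix_def A_def ..
    have c: "map_mat complex_of_rat (A k) ^\<^sub>m l \<in> carrier_mat d d" by (rule pow_carrier_mat[OF A'[OF k]])
    have "map_mat complex_of_rat (A k) ^\<^sub>m l *\<^sub>v w k = z \<cdot>\<^sub>v w k"
    proof (rule eq_vecI)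
      fix j assume "j < dim_vec (z \<cdot>\<^sub>v w k)"
      then have j: "j < d" unfolding w_def by simp
      have "(map_mat complex_of_rat (A k) ^\<^sub>m l *\<^sub>v w k) $ j = L U (k, j)"
        unfolding w_def L_def by (rule act_block_matrix[OF I A' k j, symmetric])
      also have "\<dots> = z * U (k, j)" using Q(2) unfolding U_def[symmetric] by (simp add: fscale_def)
      finally show "(map_mat complex_of_rat (A k) ^\<^sub>m l *\<^sub>v w k) $ j = (z \<cdot>\<^sub>v w k) $ j"
        unfolding w_def using j by simp
    qed (use carrier_matD[OF A[OF k]] in \<open>simp add: w_def\<close>)
    then show ?thesis
      unfolding M eigenvector_def carrier_matD(1)[OF c] using that by (simp add: w_def K_def)
  qed
  moreover have "rat_linearly_dependent d K w"
    unfolding rat_linearly_dependent_def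
  proof (intro exI[of _ "\<lambda>_. 1"] conjI)
    show "\<exists>i\<in>K. (1::rat) \<noteq> 0" using \<open>K \<noteq> {}\<close> by auto
    have fK: "finite K" using K I finite_subset by blast
    have wc: "(\<lambda>i. of_rat 1 \<cdot>\<^sub>v w i) \<in> K \<rightarrow> carrier_vec d" unfolding w_def by auto
    show "finsum_vec TYPE(complex) d (\<lambda>i. of_rat 1 \<cdot>\<^sub>v w i) K = 0\<^sub>v d"
    proof (rule eq_vecI)
      fix j assume "j < dim_vec (0\<^sub>v d :: complex vec)"
      then have j: "j < d" by simp
      have "finsum_vec TYPE(complex) d (\<lambda>i. of_rat 1 \<cdot>\<^sub>v w i) K $ j = (\<Sum>k\<in>K. (of_rat 1 \<cdot>\<^sub>v w k) $ j)"
        by (rule index_finsum_vec[OF fK j wc])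
      also have "\<dots> = (\<Sum>k\<in>K. U (k, j))" unfolding w_def using j by simp
      also have "\<dots> = (\<Sum>k\<in>I. U (k, j))"
      proof (rule sum.mono_neutral_left[OF I K])
        show "\<forall>k\<in>I - K. U (k, j) = 0"
        proof
          fix k assume "k \<in> I - K"
          then have "w k = 0\<^sub>v d" unfolding K_def by auto
          then have "w k $ j = 0" using j by simp
          then show "U (k, j) = 0" unfolding w_def using j by simp
        qed
      qed
      also have "\<dots> = 0" by (rule Usum[OF j])
      finally show "finsum_vec TYPE(complex) d (\<lambda>i. of_rat 1 \<cdot>\<^sub>v w i) K $ j = 0\<^sub>v d $ j" using j by simp
    qed (use finsum_vec_closed[OF wc] in auto)
  qed
  ultimately show ?thesis using l K by blast
qed

end

section \<open>Correlations of characters and the equivalence\<close>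

text \<open>The product of the composed characters is a character, so its integral is 1 when the
  relation holds at time n and 0 otherwise; the product of the separate integrals is 0 unless all
  characters are trivial. Finitely many relations therefore make the correlation eventually
  0.\<close>

lemma (in epimorphism_family) corr_characters:
  assumes chi: "\<And>k. k \<in> I \<Longrightarrow> \<chi> k \<in> characters"
    and fin: "(\<exists>k\<in>I. \<chi> k \<noteq> (\<lambda>_. 1)) \<Longrightarrow> finite {n. \<forall>x. (\<Prod>k\<in>I. \<chi> k ((T k ^^ n) x)) = 1}"
  shows "corr \<chi> \<longlonglongrightarrow> 0"
proof (cases "\<exists>k\<in>I. \<chi> k \<noteq> (\<lambda>_. 1)")
  case True
  then obtain k0 where k0: "k0 \<in> I" "\<chi> k0 \<noteq> (\<lambda>_. 1)" by blast
  have int: "(\<Prod>k\<in>I. \<integral>x. \<chi> k x \<partial>m) = 0"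
    using k0 integral_character[OF chi[OF k0(1)]] finite_I by (intro prod_zero) auto
  have P: "(\<lambda>x. \<Prod>k\<in>I. \<chi> k ((T k ^^ n) x)) \<in> characters" for n
  proof -
    have c: "\<chi> k \<circ> (T k ^^ n) \<in> characters" if "k \<in> I" for k
      using epimorphism_pow[OF epi[OF that], of n] chi[OF that] unfolding epimorphism_def by (intro characters_comp) auto
    have "(\<lambda>x. \<Prod>k\<in>S. (\<chi> k \<circ> (T k ^^ n)) x) \<in> characters" if "S \<subseteq> I" for S
      using finite_subset[OF that finite_I] that
    proof (induction S rule: finite_induct)
      case (insert k S)
      then show ?case using c[of k] characters_mult[of "\<chi> k \<circ> (T k ^^ n)" "\<lambda>x. \<Prod>k\<in>S. (\<chi> k \<circ> (T k ^^ n)) x"] by simp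
    qed (simp add: characters_one)
    from this[OF order_refl] show ?thesis by simp
  qed
  obtain n0 where n0: "\<And>n. (\<forall>x. (\<Prod>k\<in>I. \<chi> k ((T k ^^ n) x)) = 1) \<Longrightarrow> n \<le> n0"
    using fin[OF True] unfolding finite_nat_set_iff_bounded_le by auto
  have "corr \<chi> n = 0" if "n > n0" for n
  proof -
    have "(\<lambda>x. \<Prod>k\<in>I. \<chi> k ((T k ^^ n) x)) \<noteq> (\<lambda>_. 1)"
      using n0[of n] that by (auto simp: fun_eq_iff)
    then show ?thesis unfolding corr_def int using integral_character[OF P[of n]] by simp
  qed
  then have "\<forall>\<^sub>F n in sequentially. corr \<chi> n = 0" unfolding eventually_sequentially by (intro exI[of _ "Suc n0"]) auto
  then show ?thesis by (rule tendsto_eventually)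
next
  case False
  then have one: "\<chi> k = (\<lambda>_. 1)" if "k \<in> I" for k using that by blast
  have "(\<Prod>k\<in>I. \<integral>x. \<chi> k x \<partial>m) = 1" by (rule prod.neutral) (simp add: one)
  moreover have "(\<Prod>k\<in>I. \<chi> k ((T k ^^ n) x)) = 1" for n x by (rule prod.neutral) (simp add: one)
  ultimately have "corr \<chi> = (\<lambda>_. 0)" unfolding corr_def by simp
  then show ?thesis by simp
qed

theorem theorem1p3:
  fixes m :: "'a::{topological_ab_group_add, t2_space} measure"
    and d s :: nat
    and \<iota> :: "('a \<Rightarrow> complex) \<Rightarrow> rat vec"
    and T :: "nat \<Rightarrow> 'a \<Rightarrow> 'a"
  assumes "compact (UNIV :: 'a set)"
    and "connected (UNIV :: 'a set)"
    and "has_dimension TYPE('a) d"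
    and "normalized_haar_measure m"
    and "dual_identification d \<iota>"
    and "s \<ge> 2"
    and "inj_on T {1..s}"
    and "\<And>i. i \<in> {1..s} \<Longrightarrow> epimorphism (T i)"
  shows "mixing m (T ` {1..s}) \<longleftrightarrow>
    (\<forall>l\<ge>1. \<forall>K. K \<noteq> {} \<and> K \<subseteq> {1..s} \<longrightarrow> (\<forall>\<mu>::complex.
      \<not> (\<exists>w. (\<forall>k\<in>K. eigenvector (complex_dual_matrix d \<iota> (T k) ^\<^sub>m l) (w k) \<mu>) \<and>
             rat_linearly_dependent d K w)))"
proof -
  let ?I = "{1..s}"
  interpret epimorphism_family m ?I T
    using assms by unfold_locales auto
  interpret dual_identified d \<iota>
    using assms by unfold_locales
  have endo: "continuous_endomorphism (T k)" if "k \<in> ?I" for k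
    using assms(8)[OF that] unfolding epimorphism_def by simp
  show ?thesis
  proof (intro iffI allI impI notI)
    fix l K \<mu>
    assume mix: "mixing m (T ` ?I)" and l: "1 \<le> l" and K: "K \<noteq> {} \<and> K \<subseteq> ?I"
      and "\<exists>w. (\<forall>k\<in>K. eigenvector (complex_dual_matrix d \<iota> (T k) ^\<^sub>m l) (w k) \<mu>) \<and> rat_linearly_dependent d K w"
    then obtain w where w: "\<And>k. k \<in> K \<Longrightarrow> eigenvector (complex_dual_matrix d \<iota> (T k) ^\<^sub>m l) (w k) \<mu>"
      "rat_linearly_dependent d K w" by blast
    obtain \<chi> k0 where chi: "\<And>k. k \<in> ?I \<Longrightarrow> \<chi> k \<in> characters" "k0 \<in> ?I" "\<chi> k0 \<noteq> (\<lambda>_. 1)"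
      "\<And>n x. (\<Prod>k\<in>?I. \<chi> k ((T k ^^ (l * n)) x)) = 1"
      using eigenvectors_give_character_relation[OF finite_I conjunct2[OF K] endo w] by blast
    show False
      using not_mixing_if_character_relation[OF finite_I assms(7) chi(2) chi(1) chi(3) l chi(4)] mix by simp
  next
    assume alg: "\<forall>l\<ge>1. \<forall>K. K \<noteq> {} \<and> K \<subseteq> ?I \<longrightarrow> (\<forall>\<mu>::complex.
      \<not> (\<exists>w. (\<forall>k\<in>K. eigenvector (complex_dual_matrix d \<iota> (T k) ^\<^sub>m l) (w k) \<mu>) \<and>
             rat_linearly_dependent d K w))"
    have chars: "corr \<chi> \<longlonglongrightarrow> 0" if chi: "\<And>k. k \<in> ?I \<Longrightarrow> \<chi> k \<in> characters" for \<chi>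
    proof (rule corr_characters[OF chi])
      assume "\<exists>k\<in>?I. \<chi> k \<noteq> (\<lambda>_. 1)"
      then obtain k0 where k0: "k0 \<in> ?I" "\<chi> k0 \<noteq> (\<lambda>_. 1)" by blast
      show "finite {n. \<forall>x. (\<Prod>k\<in>?I. \<chi> k ((T k ^^ n) x)) = 1}"
      proof (rule ccontr)
        assume "\<not> ?thesis"
        from character_relations_give_eigenvectors[OF finite_I assms(8) chi k0 this]
        show False using alg by blast
      qed
    qed
    show "mixing m (T ` ?I)"
      unfolding mixing_def
    proof (intro conjI allI impI ballI)
      show "1 < card (T ` ?I)" using assms(6,7) by (simp add: card_image)
      show "epimorphism \<gamma>" if "\<gamma> \<in> T ` ?I" for \<gamma> using that assms(8) by auto
      fix B assume B: "\<forall>\<gamma>\<in>T ` ?I. B \<gamma> \<in> sets (completion m)"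
      have "?I \<noteq> {}" using assms(6) by simp
      \<comment> \<open>Here the sets are indexed by numbers, in the definition of mixing by maps;
        injectivity of T identifies the two products.\<close>
      from mixing_family_if_corr[OF chars this, of "\<lambda>k. B (T k)"] B
      show "(\<lambda>n. measure (completion m) (\<Inter>\<gamma>\<in>T ` ?I. (\<gamma> ^^ n) -` B \<gamma>))
          \<longlonglongrightarrow> (\<Prod>\<gamma>\<in>T ` ?I. measure (completion m) (B \<gamma>))"
        using assms(7) by (simp add: prod.reindex)
    qed simp
  qed
qed

end
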